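(* Let $H$ be a Krull monoid with finite class group $G$ such that every class contains a prime divisor. Suppose that $|G|\ge 3$, let $n=\exp(G)$ be the exponent of $G$, let $r=\mathsf r(G)$ be the rank of $G$, and let $k\in\mathbb N$ be maximal such that $G$ has a subgroup isomorphic to $C_n^k$. Then \[ [1,r-1]\cup\{\max\{1,\lfloor \tfrac n2\rfloor-1\}\}\cup[\max\{1,n-k-1\},n-2]\ \subset\ \Delta^*(H) \] and \[ \Delta^*(H)\ \subset\ [1,\max\{r-1,\lfloor\tfrac n2\rfloor-1\}]\cup[\max\{1,n-k-1\},n-2]. \] In particular, the following holds. (1) If $r\ge\lfloor\frac n2\rfloor-1$, then \[ \Delta^*(H)=[1,\max\{r-1,\lfloor\tfrac n2\rfloor-1\}]\cup[\max\{1,n-k-1\},n-2]. \] (2) The following statements are equivalent: (a) $\Delta^*(H)$ is an interval. (b) $\max\{1,n-k-2\}\in\Delta^*(H)$. (c) $n-k-2\le\max\{r-1,\lfloor\frac n2\rfloor-1\}$. (d) $r+k\ge n-1$, or ($r+k=n-2$ and $G\cong C_{2r+2}^{\,r}$).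
   Context: Notation: $\mathbb N$ is the set of positive integers; for rationals $a,b$, $[a,b]=\{x\in\mathbb Z\mid a\le x\le b\}$ (empty if $a>b$), and "interval" means a set of integers of this form. $\subset$ allows equality. $C_m$ is the cyclic group of order $m$. A finite abelian group $G$ is isomorphic to $C_{n_1}\oplus\dots\oplus C_{n_r}$ with $1<n_1\mid\dots\mid n_r$; then $\mathsf r(G)=r$ is its rank and $\exp(G)=n_r$ its exponent. A monoid is a commutative cancellative semigroup with identity. A Krull monoid is a monoid $H$ for which there is a monoid homomorphism $\varphi\colon H\to F$ into a free abelian monoid $F$ such that, for all $a,b\in H$, $a\mid b$ in $H$ if and only if $\varphi(a)\mid\varphi(b)$ in $F$. For a Krull monoid one may choose $F=\mathcal F(P)$ (free abelian with basis $P$) and $\varphi$ such that, in addition, every $p\in P$ is the greatest common divisor in $F$ of finitely many elements of $\varphi(H)$ (a divisor theory, unique up to isomorphism). The class group is $G=\mathsf q(F)/\mathsf q(\varphi(H))$, where $\mathsf q(\cdot)$ denotes the quotient group. The elements of $P$ are the prime divisors, and "every class contains a prime divisor" means that every element of $G$, viewed as a coset, contains some $p\in P$. An atom of $H$ is a non-unit that is not a product of two non-units. For a non-unit $a\in H$, the set of lengths $\mathsf L(a)$ is the set of all $\ell\in\mathbb N$ such that $a$ is a product of $\ell$ atoms; for a unit $a$ one sets $\mathsf L(a)=\{0\}$. For a finite set $L=\{m_1<\dots<m_s\}$ of integers, $\Delta(L)=\{m_i-m_{i-1}\mid i\in[2,s]\}$. For a monoid $S$ in which every non-unit is a product of atoms,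 $\Delta(S)=\bigcup_{a\in S}\Delta(\mathsf L(a))$. A submonoid $S\subset H$ is divisor-closed if $a\in S$, $b\in H$ and $b\mid a$ in $H$ imply $b\in S$. The set of minimal distances of $H$ is \[ \Delta^*(H)=\{\min\Delta(S)\mid S\subset H\text{ a divisor-closed submonoid with }\Delta(S)\ne\emptyset\}. \] *)

theory Defs
  imports "HOL-Algebra.Algebra" "HOL-Library.Multiset"
begin

section \<open>Divisor theories and class groups\<close>

definition free_comm_monoid :: "'p set \<Rightarrow> 'p multiset monoid" where
  "free_comm_monoid P = \<lparr>carrier = {A. set_mset A \<subseteq> P}, monoid.mult = (+), one = {#}\<rparr>"

text \<open>
  A commutative cancellative monoid \<open>H\<close> is a Krull monoid iff it has a divisor homomorphism into
  some free abelian monoid.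
\<close>

definition divisor_homomorphism ::
    "('a, 'b) monoid_scheme \<Rightarrow> 'p set \<Rightarrow> ('a \<Rightarrow> 'p multiset) \<Rightarrow> bool" where
  "divisor_homomorphism H P \<phi> \<longleftrightarrow>
     \<phi> \<in> hom H (free_comm_monoid P) \<and>
     \<phi> \<one>\<^bsub>H\<^esub> = \<one>\<^bsub>free_comm_monoid P\<^esub> \<and>
     (\<forall>a\<in>carrier H. \<forall>b\<in>carrier H.
        a divides\<^bsub>H\<^esub> b \<longleftrightarrow> \<phi> a divides\<^bsub>free_comm_monoid P\<^esub> \<phi> b)"

definition is_gcd_of_set :: "('a, 'b) monoid_scheme \<Rightarrow> 'a \<Rightarrow> 'a set \<Rightarrow> bool" where
  "is_gcd_of_set F d A \<longleftrightarrow>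
     d \<in> carrier F \<and> (\<forall>x\<in>A. d divides\<^bsub>F\<^esub> x) \<and>
     (\<forall>c\<in>carrier F. (\<forall>x\<in>A. c divides\<^bsub>F\<^esub> x) \<longrightarrow> c divides\<^bsub>F\<^esub> d)"

text \<open>
  The existence of a divisor theory implies that \<open>H\<close> is a Krull monoid, and every Krull monoid has
  one, unique up to isomorphism.
\<close>

definition divisor_theory ::
    "('a, 'b) monoid_scheme \<Rightarrow> 'p set \<Rightarrow> ('a \<Rightarrow> 'p multiset) \<Rightarrow> bool" where
  "divisor_theory H P \<phi> \<longleftrightarrow>
     divisor_homomorphism H P \<phi> \<and>
     (\<forall>p\<in>P. \<exists>A. finite A \<and> A \<noteq> {} \<and> A \<subseteq> \<phi> ` carrier H \<and>
        is_gcd_of_set (free_comm_monoid P) {#p#} A)"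

text \<open>
  The quotient group of the free abelian monoid with basis \<open>P\<close> is the free abelian group with
  basis \<open>P\<close>; the canonical embedding sends a multiset to the formal sum of its elements.
\<close>

definition frag_of_mset :: "'p multiset \<Rightarrow> 'p \<Rightarrow>\<^sub>0 int" where
  "frag_of_mset A = (\<Sum>p\<in>#A. frag_of p)"

definition principal_quotients ::
    "('a, 'b) monoid_scheme \<Rightarrow> ('a \<Rightarrow> 'p multiset) \<Rightarrow> ('p \<Rightarrow>\<^sub>0 int) set" where
  "principal_quotients H \<phi> =
     {frag_of_mset (\<phi> a) - frag_of_mset (\<phi> b) | a b. a \<in> carrier H \<and> b \<in> carrier H}"

definition class_group ::
    "('a, 'b) monoid_scheme \<Rightarrow> 'p set \<Rightarrow> ('a \<Rightarrow> 'p multiset) \<Rightarrow> ('p \<Rightarrow>\<^sub>0 int) set monoid" where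
  "class_group H P \<phi> = free_Abelian_group P Mod principal_quotients H \<phi>"

definition every_class_contains_prime ::
    "('a, 'b) monoid_scheme \<Rightarrow> 'p set \<Rightarrow> ('a \<Rightarrow> 'p multiset) \<Rightarrow> bool" where
  "every_class_contains_prime H P \<phi> \<longleftrightarrow>
     (\<forall>g\<in>carrier (class_group H P \<phi>). \<exists>p\<in>P. frag_of p \<in> g)"


section \<open>Rank and exponent of finite abelian groups\<close>

text \<open>Since the index sets are finite, the direct sums below are direct products.\<close>

definition cyclic_sum :: "nat list \<Rightarrow> (nat \<Rightarrow> int) monoid" where
  "cyclic_sum ns = product_group {..<length ns} (\<lambda>i. integer_mod_group (ns ! i))"

definition cyclic_power :: "nat \<Rightarrow> nat \<Rightarrow> (nat \<Rightarrow> int) monoid" where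
  "cyclic_power n k = cyclic_sum (replicate k n)"

definition is_invariant_factors :: "('a, 'b) monoid_scheme \<Rightarrow> nat list \<Rightarrow> bool" where
  "is_invariant_factors G ns \<longleftrightarrow>
     (\<forall>n\<in>set ns. 1 < n) \<and> sorted_wrt (dvd) ns \<and> G \<cong> cyclic_sum ns"

text \<open>For a finite abelian group the list of invariant factors exists and is unique.\<close>

definition invariant_factors :: "('a, 'b) monoid_scheme \<Rightarrow> nat list" where
  "invariant_factors G = (SOME ns. is_invariant_factors G ns)"

definition group_rank :: "('a, 'b) monoid_scheme \<Rightarrow> nat" where
  "group_rank G = length (invariant_factors G)"

text \<open>The leading \<open>1\<close> only gives the trivial group, which has no invariant factors, exponent \<open>1\<close>.\<close>

definition group_exp :: "('a, 'b) monoid_scheme \<Rightarrow> nat" where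
  "group_exp G = last (1 # invariant_factors G)"

definition has_subgroup_iso :: "('a, 'b) monoid_scheme \<Rightarrow> ('c, 'd) monoid_scheme \<Rightarrow> bool" where
  "has_subgroup_iso G K \<longleftrightarrow> (\<exists>U. subgroup U G \<and> G\<lparr>carrier := U\<rparr> \<cong> K)"


section \<open>Sets of lengths and minimal distances\<close>

definition atom :: "('a, 'b) monoid_scheme \<Rightarrow> 'a \<Rightarrow> bool" where
  "atom S u \<longleftrightarrow>
     u \<in> carrier S - Units S \<and>
     \<not> (\<exists>b \<in> carrier S - Units S. \<exists>c \<in> carrier S - Units S. u = b \<otimes>\<^bsub>S\<^esub> c)"

definition lengths :: "('a, 'b) monoid_scheme \<Rightarrow> 'a \<Rightarrow> nat set" where
  "lengths S a =
     (if a \<in> Units S then {0}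
      else {l. 1 \<le> l \<and> (\<exists>us. length us = l \<and> (\<forall>u\<in>set us. atom S u) \<and>
                              foldr (\<otimes>\<^bsub>S\<^esub>) us \<one>\<^bsub>S\<^esub> = a)})"

text \<open>Differences of consecutive elements of \<open>L\<close>.\<close>

definition distances_of_set :: "nat set \<Rightarrow> nat set" where
  "distances_of_set L =
     {m - l | l m. l \<in> L \<and> m \<in> L \<and> l < m \<and> (\<forall>x\<in>L. \<not> (l < x \<and> x < m))}"

definition distances :: "('a, 'b) monoid_scheme \<Rightarrow> nat set" where
  "distances S = (\<Union>a\<in>carrier S. distances_of_set (lengths S a))"

definition divisor_closed_submonoid :: "'a set \<Rightarrow> ('a, 'b) monoid_scheme \<Rightarrow> bool" where
  "divisor_closed_submonoid S H \<longleftrightarrow>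
     submonoid S H \<and> (\<forall>a\<in>S. \<forall>b\<in>carrier H. b divides\<^bsub>H\<^esub> a \<longrightarrow> b \<in> S)"

text \<open>A set of integers, so that it can be compared with intervals whose end points are
  computed without truncated subtraction.\<close>

definition minimal_distances :: "('a, 'b) monoid_scheme \<Rightarrow> int set" where
  "minimal_distances H =
     {int (LEAST d. d \<in> distances (H\<lparr>carrier := S\<rparr>)) | S.
        divisor_closed_submonoid S H \<and> distances (H\<lparr>carrier := S\<rparr>) \<noteq> {}}"

definition integer_interval :: "int set \<Rightarrow> bool" where
  "integer_interval A \<longleftrightarrow> (\<exists>(a :: rat) (b :: rat). A = {x. a \<le> of_int x \<and> of_int x \<le> b})"

end

theory Submission
  imports Defs
begin

text \<open>
  Divisor-closed submonoids of \<open>H\<close> correspond to sets \<open>Q\<close> of prime divisors, and the lengths of an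
  element only depend on the zero-sum multiset over \<open>Q\<close> formed by its prime divisors, so that one may
  work with zero-sum multisets of primes throughout, several of which may lie in the same class. Let
  \<open>d\<close> be the minimal distance; it divides every difference of two lengths.

  Upper bound. Let \<open>wt A\<close> be \<open>n\<close> times the cross number of \<open>A\<close>. Comparing the two obvious
  factorizations of the \<open>n\<close>-th power of an atom \<open>U\<close> shows that \<open>d\<close> divides \<open>n - wt U\<close>. If
  \<open>wt U < n\<close> and \<open>d \<ge> \<lfloor>n/2\<rfloor>\<close>, then \<open>U\<close> is a product of \<open>n - d\<close> distinct elements of order \<open>n\<close>, any
  \<open>n - d - 1\<close> of which are independent. If no such \<open>U\<close> exists, take a minimal set \<open>J\<close> which is not
  half-factorial. When \<open>|J| \<le> r + 1\<close>, splitting off an atom of cross number greater than \<open>1\<close>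
  from the product of all \<open>g\<close> to the power \<open>ord g\<close>, \<open>g\<close> in \<open>J\<close>, gives \<open>d \<le> |J| - 2\<close>. When
  \<open>|J| \<ge> r + 2\<close>, the relations supported on proper subsets of \<open>J\<close> generate all relations, so every
  zero-sum multiset becomes a product of atoms of cross number \<open>1\<close> after multiplication by suitable
  \<open>g\<close> to the power \<open>ord g\<close>, and a minimal multiset that needs just one such factor gives
  \<open>2 d + 3 \<le> n\<close>.

  Lower bound. With \<open>e\<^sub>1, \<dots>, e\<^sub>s\<close> independent of the same order, the sets
  \<open>{e\<^sub>1, \<dots>, e\<^sub>s, e\<^sub>1 + \<dots> + e\<^sub>s}\<close> and \<open>{e\<^sub>1, \<dots>, e\<^sub>s, - e\<^sub>1 - \<dots> - e\<^sub>s}\<close> give the two intervals,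
  and \<open>{g, -2 g}\<close> or \<open>{g, - g, (n/2) g}\<close> gives the point in the middle.
\<close>

section \<open>Zero-sum monoids and their sets of lengths\<close>

text \<open>For the upper bound the class group is replaced by a predicate \<open>Z\<close> on
  multisets that is closed under sums and cancellation and for which \<open>n\<close> copies of a
  letter are zero-sum. Primes of the same class are then simply different letters, and the group
  returns through two facts only: any \<open>r + 1\<close> elements satisfy a relation with a
  coefficient prime to a given prime \<open>q\<close>, and independent elements of order
  \<open>n\<close> span a power of \<open>C_n\<close>. The hard case is
  \<open>|J| \<ge> r + 2\<close>. That the relations on proper subsets generate everything is seen
  one prime at a time: for each prime \<open>q\<close> dividing \<open>n\<close>, some multiple of a
  given relation by a number prime to \<open>q\<close> decomposes, and the admissible multipliers,
  among them \<open>n\<close>, have no common prime factor. Generation in a group becomes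
  factorization in a monoid by replacing inverses with \<open>(n - 1)\<close>-fold powers; the price
  is extra atoms \<open>g\<close> to the power \<open>ord g\<close>, harmless because they have
  cross number \<open>1\<close>. The three terms of the bound match three outcomes: a light atom
  with \<open>n - d - 1 \<le> k\<close>, a small \<open>J\<close> with \<open>d \<le> r - 1\<close>,
  and otherwise \<open>d \<le> \<lfloor>n/2\<rfloor> - 1\<close>.\<close>

definition zatom :: "('p multiset \<Rightarrow> bool) \<Rightarrow> 'p multiset \<Rightarrow> bool" where
  "zatom Z A \<longleftrightarrow> Z A \<and> A \<noteq> {#} \<and> (\<forall>B. B \<subseteq># A \<longrightarrow> Z B \<longrightarrow> B = {#} \<or> B = A)"

definition zlengths :: "('p multiset \<Rightarrow> bool) \<Rightarrow> 'p multiset \<Rightarrow> nat set" where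
  "zlengths Z A = {size M | M. (\<forall>a\<in>#M. zatom Z a) \<and> \<Sum>\<^sub># M = A}"

definition zdistances :: "('p multiset \<Rightarrow> bool) \<Rightarrow> nat set" where
  "zdistances Z = (\<Union>A\<in>Collect Z. distances_of_set (zlengths Z A))"

lemma distances_of_set_pos: "d \<in> distances_of_set L \<Longrightarrow> 0 < d"
  by (auto simp: distances_of_set_def)

lemma ex_distance_le:
  assumes "l \<in> L" "m \<in> L" "l < m"
  shows "\<exists>d\<in>distances_of_set L. d \<le> m - l"
proof -
  define x where "x = (LEAST x. x \<in> L \<and> l < x)"
  have x: "x \<in> L \<and> l < x"
    unfolding x_def using assms(2,3) by (rule LeastI[where P = "\<lambda>x. x \<in> L \<and> l < x", OF conjI])
  have le: "x \<le> y" if "y \<in> L" "l < y" for y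
    unfolding x_def using that by (rule Least_le[where P = "\<lambda>x. x \<in> L \<and> l < x", OF conjI])
  have xm: "x \<le> m" using le assms(2,3) by blast
  hence "x - l \<in> distances_of_set L"
    unfolding distances_of_set_def using x assms(1) le by (fastforce simp: not_less)
  thus ?thesis using xm by (intro bexI[of _ "x - l"]) auto
qed

lemma zlengthsE:
  assumes "l \<in> zlengths Z A"
  obtains M where "\<forall>a\<in>#M. zatom Z a" "\<Sum>\<^sub># M = A" "size M = l"
  using assms by (auto simp: zlengths_def)

lemma zlengths_add:
  assumes "k \<in> zlengths Z A" "l \<in> zlengths Z B"
  shows "k + l \<in> zlengths Z (A + B)"
proof -
  obtain M N where "size M = k" "\<forall>a\<in>#M. zatom Z a" "\<Sum>\<^sub># M = A"
      "size N = l" "\<forall>a\<in>#N. zatom Z a" "\<Sum>\<^sub># N = B"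
    using assms by (auto simp: zlengths_def)
  thus ?thesis unfolding zlengths_def by (intro CollectI exI[of _ "M + N"]) auto
qed

lemma zlengths_empty: "0 \<in> zlengths Z {#}"
  unfolding zlengths_def by (intro CollectI exI[of _ "{#}"]) auto

lemma zlengths_repeat: "l \<in> zlengths Z A \<Longrightarrow> k * l \<in> zlengths Z (repeat_mset k A)"
  by (induction k) (auto intro: zlengths_add zlengths_empty)

lemma zlengths_zatom: "zatom Z A \<Longrightarrow> 1 \<in> zlengths Z A"
  unfolding zlengths_def by (intro CollectI exI[of _ "{#A#}"]) auto

lemma set_mset_repeat: "set_mset (repeat_mset k A) = (if k = 0 then {} else set_mset A)"
  by (induction k) auto

text \<open>\<open>Z_cancel\<close> makes the inclusion of the zero-sum multisets into the free
  monoid a divisor homomorphism. \<open>Z_exp\<close> speaks only of letters that occur in some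
  zero-sum multiset because \<open>Z\<close> may also confine the support.\<close>

locale block_monoid =
  fixes Z :: "'p multiset \<Rightarrow> bool" and n :: nat
  assumes Z_empty: "Z {#}"
    and Z_add: "Z A \<Longrightarrow> Z B \<Longrightarrow> Z (A + B)"
    and Z_cancel: "Z A \<Longrightarrow> Z (A + B) \<Longrightarrow> Z B"
    and n_pos: "0 < n"
    and Z_exp: "Z A \<Longrightarrow> p \<in># A \<Longrightarrow> Z (replicate_mset n p)"
begin

definition supp :: "'p set" where "supp = {p. Z (replicate_mset n p)}"

definition ord :: "'p \<Rightarrow> nat" where "ord p = (LEAST k. 0 < k \<and> Z (replicate_mset k p))"

text \<open>Since \<open>ord p\<close> divides \<open>n\<close>, \<open>wt\<close> is \<open>n\<close> times the cross number.\<close>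

definition wt :: "'p multiset \<Rightarrow> nat" where "wt A = (\<Sum>p\<in>#A. n div ord p)"

lemma Z_suppD: "Z A \<Longrightarrow> set_mset A \<subseteq> supp"
  using Z_exp by (auto simp: supp_def)

lemma Z_diff: "Z A \<Longrightarrow> Z B \<Longrightarrow> B \<subseteq># A \<Longrightarrow> Z (A - B)"
  by (metis Z_cancel subset_mset.add_diff_inverse)

lemma Z_repeat: "Z A \<Longrightarrow> Z (repeat_mset k A)"
  by (induction k) (auto intro: Z_empty Z_add)

lemma Z_sum_mset: "(\<And>a. a \<in># M \<Longrightarrow> Z a) \<Longrightarrow> Z (\<Sum>\<^sub># M)"
  by (induction M) (auto intro: Z_empty Z_add)

lemma zatomD: "zatom Z A \<Longrightarrow> Z A"
  by (simp add: zatom_def)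

lemma ex_zatom_le: "Z A \<Longrightarrow> A \<noteq> {#} \<Longrightarrow> \<exists>B. zatom Z B \<and> B \<subseteq># A"
proof (induction "size A" arbitrary: A rule: less_induct)
  case less
  show ?case
  proof (cases "zatom Z A")
    case False
    then obtain B where B: "B \<subseteq># A" "Z B" "B \<noteq> {#}" "B \<noteq> A" using less.prems by (auto simp: zatom_def)
    hence "size B < size A" by (simp add: mset_subset_size subset_mset.le_neq_trans)
    thus ?thesis using less.hyps[of B] B by (meson subset_mset.order_trans)
  qed auto
qed

lemma ex_factorization: "Z A \<Longrightarrow> \<exists>M. (\<forall>a\<in>#M. zatom Z a) \<and> \<Sum>\<^sub># M = A"
proof (induction "size A" arbitrary: A rule: less_induct)
  case less
  show ?case
  proof (cases "A = {#}")
    case True thus ?thesis by (intro exI[of _ "{#}"]) auto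
  next
    case False
    then obtain B where B: "zatom Z B" "B \<subseteq># A" using ex_zatom_le less.prems by blast
    have "Z (A - B)" using B less.prems Z_diff zatomD by blast
    moreover have "size (A - B) < size A" using B False
      by (metis diff_less nonempty_has_size size_Diff_submset zatom_def)
    ultimately obtain M where "\<forall>a\<in>#M. zatom Z a" "\<Sum>\<^sub># M = A - B" using less.hyps by blast
    thus ?thesis using B by (intro exI[of _ "add_mset B M"]) (auto)
  qed
qed

lemma ex_zlength: "Z A \<Longrightarrow> \<exists>l. l \<in> zlengths Z A"
  using ex_factorization by (fastforce simp: zlengths_def)

lemma zlengths_pos: "l \<in> zlengths Z A \<Longrightarrow> A \<noteq> {#} \<Longrightarrow> 1 \<le> l"
  by (auto simp: zlengths_def Suc_le_eq nonempty_has_size[symmetric])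

lemma ord_props:
  assumes "p \<in> supp"
  shows ord_pos: "0 < ord p" and Z_ord: "Z (replicate_mset (ord p) p)"
  using LeastI[of "\<lambda>k. 0 < k \<and> Z (replicate_mset k p)" n] assms n_pos
  by (auto simp: ord_def supp_def)

lemma ord_le: "0 < k \<Longrightarrow> Z (replicate_mset k p) \<Longrightarrow> ord p \<le> k"
  unfolding ord_def by (rule Least_le) simp

lemma replicate_add: "replicate_mset (a + b) p = replicate_mset a p + replicate_mset b p"
  by (rule multiset_eqI) simp

lemma replicate_mult: "replicate_mset (a * b) p = repeat_mset a (replicate_mset b p)"
  by (rule multiset_eqI) simp

lemma Z_replicate_iff:
  assumes "p \<in> supp"
  shows "Z (replicate_mset k p) \<longleftrightarrow> ord p dvd k"
proof
  assume k: "Z (replicate_mset k p)"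
  have "replicate_mset k p = repeat_mset (k div ord p) (replicate_mset (ord p) p) + replicate_mset (k mod ord p) p"
    by (simp only: replicate_mult[symmetric] replicate_add[symmetric] div_mult_mod_eq)
  hence "Z (replicate_mset (k mod ord p) p)"
    using k Z_cancel Z_repeat[OF Z_ord[OF assms]] by metis
  thus "ord p dvd k" using ord_le ord_pos[OF assms]
    by (meson linorder_not_less mod_eq_0_iff_dvd mod_less_divisor neq0_conv)
next
  assume "ord p dvd k"
  thus "Z (replicate_mset k p)"
    using Z_repeat[OF Z_ord[OF assms]] by (metis dvdE mult.commute replicate_mult)
qed

lemma ord_dvd: "p \<in> supp \<Longrightarrow> ord p dvd n"
  using Z_replicate_iff[of p n] by (simp add: supp_def)

lemma ord_le_n: "p \<in> supp \<Longrightarrow> ord p \<le> n"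
  using ord_dvd n_pos dvd_imp_le by blast

lemma zatom_ord:
  assumes "p \<in> supp"
  shows "zatom Z (replicate_mset (ord p) p)"
  unfolding zatom_def
proof (intro conjI allI impI)
  show "Z (replicate_mset (ord p) p)" by (rule Z_ord[OF assms])
  show "replicate_mset (ord p) p \<noteq> {#}" using ord_pos[OF assms] by auto
  fix B assume B: "B \<subseteq># replicate_mset (ord p) p" "Z B"
  then obtain k where k: "k \<le> ord p" "B = replicate_mset k p"
    by (metis msubseteq_replicate_msetE)
  hence "ord p dvd k" using B Z_replicate_iff assms by blast
  hence "k = 0 \<or> k = ord p" using k by (metis dvd_imp_le le_antisym not_gr_zero)
  thus "B = {#} \<or> B = replicate_mset (ord p) p" using k by auto
qed

lemma zatom_count_le:
  assumes "zatom Z A" "p \<in># A"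
  shows "count A p \<le> ord p"
proof (rule ccontr)
  assume "\<not> count A p \<le> ord p"
  hence *: "replicate_mset (ord p) p \<subseteq># A" "count A p \<noteq> ord p"
    using count_le_replicate_mset_subset_eq[of "ord p" A p] by simp_all
  have p: "p \<in> supp" using assms Z_suppD zatomD by blast
  hence "replicate_mset (ord p) p = A"
    using * assms Z_ord ord_pos[OF p] unfolding zatom_def by (metis neq0_conv replicate_mset_eq_empty_iff)
  thus False using * by (metis count_replicate_mset)
qed

lemma zatom_eq_replicate:
  assumes "zatom Z A" "p \<in># A" "ord p \<le> count A p"
  shows "A = replicate_mset (ord p) p"
proof -
  have p: "p \<in> supp" using assms Z_suppD zatomD by blast
  have "replicate_mset (ord p) p \<subseteq># A" using assms(3) by (simp add: count_le_replicate_mset_subset_eq)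
  thus ?thesis using assms Z_ord[OF p] ord_pos[OF p] unfolding zatom_def by (metis neq0_conv replicate_mset_eq_empty_iff)
qed

lemma wt_empty [simp]: "wt {#} = 0" by (simp add: wt_def)
lemma wt_add [simp]: "wt (A + B) = wt A + wt B" by (simp add: wt_def)
lemma wt_add_mset [simp]: "wt (add_mset p A) = n div ord p + wt A" by (simp add: wt_def)
lemma wt_repeat [simp]: "wt (repeat_mset k A) = k * wt A" by (induction k) auto
lemma wt_replicate [simp]: "wt (replicate_mset k p) = k * (n div ord p)" by (induction k) auto
lemma wt_sum_mset: "wt (\<Sum>\<^sub># M) = (\<Sum>a\<in>#M. wt a)" by (induction M) auto
lemma wt_diff: "B \<subseteq># A \<Longrightarrow> wt (A - B) = wt A - wt B"
  by (metis add_diff_cancel_left' subset_mset.add_diff_inverse wt_add)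
lemma wt_ord: "p \<in> supp \<Longrightarrow> wt (replicate_mset (ord p) p) = n"
  using ord_dvd by simp

text \<open>Repeated \<open>n\<close> times, each letter \<open>p\<close> splits into
  \<open>n div ord p\<close> atoms \<open>replicate_mset (ord p) p\<close>. This makes the weight a
  length, to be compared with \<open>n\<close> times a length of \<open>A\<close>.\<close>

lemma wt_zlengths: "set_mset A \<subseteq> supp \<Longrightarrow> wt A \<in> zlengths Z (repeat_mset n A)"
proof (induction A)
  case empty thus ?case by (simp add: zlengths_empty)
next
  case (add p A)
  have p: "p \<in> supp" using add by auto
  have "(n div ord p) * 1 \<in> zlengths Z (repeat_mset (n div ord p) (replicate_mset (ord p) p))"
    by (intro zlengths_repeat zlengths_zatom zatom_ord p)
  also have "repeat_mset (n div ord p) (replicate_mset (ord p) p) = replicate_mset n p"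
    using ord_dvd[OF p] by (metis dvd_div_mult_self replicate_mult)
  finally have "n div ord p + wt A \<in> zlengths Z (replicate_mset n p + repeat_mset n A)"
    using add by (intro zlengths_add) auto
  moreover have "replicate_mset n p + repeat_mset n A = repeat_mset n (add_mset p A)"
    by (rule multiset_eqI) (auto simp: algebra_simps)
  ultimately show ?case by (simp only: wt_add_mset)
qed

lemma size_le_sum_mset:
  "(\<And>a. a \<in># M \<Longrightarrow> c \<le> f a) \<Longrightarrow> size M * c \<le> (\<Sum>a\<in>#M. f a :: nat)"
  by (induction M) (auto intro: add_mono)

text \<open>The bound is asked only of atoms over the letters of \<open>A\<close>, so that it can be
  applied on a subset that carries no light atom.\<close>

lemma zlengths_wt_le:
  assumes "l \<in> zlengths Z A" "\<And>a. zatom Z a \<Longrightarrow> set_mset a \<subseteq> set_mset A \<Longrightarrow> c \<le> wt a"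
  shows "l * c \<le> wt A"
proof -
  obtain M where M: "size M = l" "\<forall>a\<in>#M. zatom Z a" "\<Sum>\<^sub># M = A" using assms by (auto simp: zlengths_def)
  have "size M * c \<le> (\<Sum>a\<in>#M. wt a)"
    using M assms(2) by (intro size_le_sum_mset) (auto simp: subset_iff)
  thus ?thesis using M wt_sum_mset by metis
qed

lemma zlengths_wt_eq:
  assumes "l \<in> zlengths Z A" "\<And>a. zatom Z a \<Longrightarrow> set_mset a \<subseteq> set_mset A \<Longrightarrow> wt a = c"
  shows "wt A = l * c"
proof -
  obtain M where M: "size M = l" "\<forall>a\<in>#M. zatom Z a" "\<Sum>\<^sub># M = A" using assms by (auto simp: zlengths_def)
  have "wt a = c" if "a \<in># M" for a
    using M assms(2) that by (auto simp: subset_iff)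
  hence "(\<Sum>a\<in>#M. wt a) = size M * c" by (simp cong: image_mset_cong)
  thus ?thesis using M wt_sum_mset by metis
qed

text \<open>If a difference of lengths of \<open>A\<close> had remainder \<open>0 < \<rho> < d\<close> modulo \<open>d\<close>, then adding \<open>q\<close> copies of an
  element with lengths \<open>k\<close> and \<open>k + d\<close> would produce two lengths that differ by \<open>\<rho>\<close>.\<close>

lemma least_distance:
  assumes "zdistances Z \<noteq> {}"
  defines "d \<equiv> (LEAST d. d \<in> zdistances Z)"
  shows "0 < d"
    and "l \<in> zlengths Z A \<Longrightarrow> l' \<in> zlengths Z A \<Longrightarrow> Z A \<Longrightarrow> int d dvd int l - int l'"
    and "\<exists>A l. Z A \<and> l \<in> zlengths Z A \<and> l + d \<in> zlengths Z A"
proof -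
  have d: "d \<in> zdistances Z" unfolding d_def using assms(1) by (metis LeastI all_not_in_conv)
  have dle: "d \<le> x" if "x \<in> zdistances Z" for x unfolding d_def using that by (rule Least_le)
  show "0 < d" using d by (auto simp: zdistances_def dest: distances_of_set_pos)
  obtain B k where B: "Z B" "k \<in> zlengths Z B" "k + d \<in> zlengths Z B"
    using d by (auto simp: zdistances_def distances_of_set_def)
  thus "\<exists>A l. Z A \<and> l \<in> zlengths Z A \<and> l + d \<in> zlengths Z A" by blast
  have main: "int d dvd int l' - int l"
    if "l \<in> zlengths Z A" "l' \<in> zlengths Z A" "Z A" "l \<le> l'" for l l' A
  proof (rule ccontr)
    assume nd: "\<not> int d dvd int l' - int l"
    define q where "q = (l' - l) div d"
    define r where "r = (l' - l) mod d"
    have lq: "l' = l + q * d + r" using that by (simp add: q_def r_def)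
    have r: "0 < r" "r < d" 
      using nd that(4) \<open>0 < d\<close> by (simp_all add: r_def of_nat_diff[symmetric] dvd_eq_mod_eq_0 of_nat_mod[symmetric] del: of_nat_diff of_nat_mod)
    have "q * (k + d) + l \<in> zlengths Z (repeat_mset q B + A)"
         "q * k + l' \<in> zlengths Z (repeat_mset q B + A)"
      using B that by (auto intro: zlengths_add zlengths_repeat)
    moreover have "q * (k + d) + l < q * k + l'" using lq r by (simp add: algebra_simps)
    ultimately obtain x where x: "x \<in> distances_of_set (zlengths Z (repeat_mset q B + A))"
      "x \<le> q * k + l' - (q * (k + d) + l)" using ex_distance_le by blast
    have "x \<le> r" using x lq by (simp add: algebra_simps)
    moreover have "x \<in> zdistances Z" 
      using x(1) Z_add[OF Z_repeat[OF B(1), of q] that(3)] unfolding zdistances_def by blast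
    ultimately show False using dle r by fastforce
  qed
  show "int d dvd int l - int l'" if "l \<in> zlengths Z A" "l' \<in> zlengths Z A" "Z A"
    using main that by (metis dvd_diff_commute nat_le_linear)
qed

text \<open>The factor \<open>c\<close> keeps \<open>f\<close> integral: the natural choice of \<open>f / c\<close> has denominators.\<close>

lemma least_distanceI:
  assumes "0 < d" "0 < c" "l \<in> zlengths Z A" "l + d \<in> zlengths Z A" "Z A"
    and add: "\<And>A B. f (A + B) = f A + f B"
    and atom: "\<And>a. zatom Z a \<Longrightarrow> int (c * d) dvd f a - int c"
  shows "(LEAST d. d \<in> zdistances Z) = d" "zdistances Z \<noteq> {}"
proof -
  have f: "int (c * d) dvd f (\<Sum>\<^sub># M) - int c * int (size M)" if "\<forall>a\<in>#M. zatom Z a" for M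
    using that
  proof (induction M)
    case empty
    have "f {#} = 0" using add[of "{#}" "{#}"] by simp
    thus ?case by simp
  next
    case (add a M)
    have "int (c * d) dvd (f a - int c) + (f (\<Sum>\<^sub># M) - int c * int (size M))"
      using add atom by (intro dvd_add) auto
    thus ?case by (simp add: assms(6) algebra_simps)
  qed
  have dd: "int d dvd int m - int l" if l: "l \<in> zlengths Z B" and m: "m \<in> zlengths Z B" for l m B
  proof -
    obtain M where M: "\<forall>a\<in>#M. zatom Z a" "\<Sum>\<^sub># M = B" "size M = l" by (rule zlengthsE[OF l])
    obtain N where N: "\<forall>a\<in>#N. zatom Z a" "\<Sum>\<^sub># N = B" "size N = m" by (rule zlengthsE[OF m])
    have "int (c * d) dvd f B - int c * int l" "int (c * d) dvd f B - int c * int m"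
      using f[OF M(1)] f[OF N(1)] M N by simp_all
    hence "int (c * d) dvd (f B - int c * int l) - (f B - int c * int m)" by (rule dvd_diff)
    hence "int c * int d dvd int c * (int m - int l)" by (simp add: algebra_simps)
    thus ?thesis using assms(2) by simp
  qed
  have ge: "d \<le> x" if x: "x \<in> zdistances Z" for x
  proof -
    obtain B l m where "l \<in> zlengths Z B" "m \<in> zlengths Z B" "l < m" "x = m - l"
      using x by (auto simp: zdistances_def distances_of_set_def)
    hence "int d dvd int x" "0 < x" using dd[of l B m] by (auto simp: of_nat_diff)
    thus ?thesis by (simp add: dvd_imp_le)
  qed
  obtain x where x: "x \<in> zdistances Z" "x \<le> d"
    using ex_distance_le[OF assms(3,4)] assms(1,5) by (auto simp: zdistances_def)
  hence "x = d" using ge by fastforce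
  thus "(LEAST d. d \<in> zdistances Z) = d" using x ge by (intro Least_equality) auto
  show "zdistances Z \<noteq> {}" using x by auto
qed

end

section \<open>Atoms of small cross number\<close>

lemma int_dvd_diffD: "int d dvd int a - int b \<Longrightarrow> b \<le> a \<Longrightarrow> d dvd a - b"
  by (metis int_dvd_int_iff of_nat_diff)

context block_monoid begin

lemma wt_mono: "B \<subseteq># A \<Longrightarrow> wt B \<le> wt A"
  by (metis le_add1 subset_mset.add_diff_inverse wt_add)

lemma zlengths_Z: "l \<in> zlengths Z A \<Longrightarrow> Z A"
  by (elim zlengthsE) (metis Z_sum_mset zatomD)

lemma count_sum_replicate:
  "finite C \<Longrightarrow> count (\<Sum>p\<in>C. replicate_mset (f p) p) x = (if x \<in> C then f x else 0)"
  by (simp add: count_sum)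

lemma zlengths_sum_ord:
  "finite C \<Longrightarrow> C \<subseteq> supp \<Longrightarrow> card C \<in> zlengths Z (\<Sum>p\<in>C. replicate_mset (ord p) p)"
proof (induction C rule: finite_induct)
  case (insert p C)
  have "1 + card C \<in> zlengths Z (replicate_mset (ord p) p + (\<Sum>p\<in>C. replicate_mset (ord p) p))"
    using insert by (intro zlengths_add zlengths_zatom zatom_ord) auto
  thus ?case using insert by simp
qed (simp add: zlengths_empty)

lemma wt_sum_ord:
  "finite C \<Longrightarrow> C \<subseteq> supp \<Longrightarrow> wt (\<Sum>p\<in>C. replicate_mset (ord p) p) = card C * n"
  by (induction C rule: finite_induct) (simp_all add: wt_ord del: wt_replicate)

lemma Z_sum_ord:
  "finite C \<Longrightarrow> C \<subseteq> supp \<Longrightarrow> Z (\<Sum>p\<in>C. replicate_mset (ord p) p)"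
  using zlengths_sum_ord zlengths_Z by blast

lemma size_le_wt: "set_mset A \<subseteq> supp \<Longrightarrow> size A \<le> wt A"
proof (induction A)
  case (add p A)
  hence "0 < n div ord p" using ord_le_n ord_pos by (simp add: div_greater_zero_iff)
  thus ?case using add by simp
qed simp

end

text \<open>\<open>d\<close> is any positive common divisor of all differences of lengths. That two
  different lengths occur at all is fed in separately, through an atom of weight different from
  \<open>n\<close>.\<close>

locale distance_divisor = block_monoid +
  fixes d :: nat
  assumes d_pos: "0 < d"
    and d_dvd: "l \<in> zlengths Z A \<Longrightarrow> l' \<in> zlengths Z A \<Longrightarrow> int d dvd int l - int l'"
begin

text \<open>Both numbers are lengths of \<open>repeat_mset n A\<close>.\<close>

lemma wt_cong:
  assumes "l \<in> zlengths Z A" shows "int d dvd int (n * l) - int (wt A)"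
  using d_dvd[OF zlengths_repeat[OF assms, of n] wt_zlengths] assms Z_suppD zlengths_Z by blast

text \<open>The gap \<open>n - wt U\<close> is a positive multiple of \<open>d\<close>, and
  \<open>2 \<le> wt U\<close> keeps it below \<open>2 * d\<close>.\<close>

lemma light_atom_wt:
  assumes "zatom Z U" "wt U < n" "n \<le> 2 * d + 1"
  shows "wt U = n - d" "d + 2 \<le> n"
proof -
  have sub: "set_mset U \<subseteq> supp" using assms zatomD Z_suppD by blast
  \<comment> \<open>A single letter that is zero-sum has order \<open>1\<close>, hence weight
    \<open>n\<close>, and is not light.\<close>
  have "2 \<le> size U"
  proof (rule ccontr)
    assume "\<not> 2 \<le> size U"
    moreover have "U \<noteq> {#}" using assms by (simp add: zatom_def)
    ultimately have "size U = 1" by (metis One_nat_def Suc_leI le_antisym nonempty_has_size not_less_eq_eq numeral_2_eq_2)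
    then obtain p where p: "U = {#p#}" using size_1_singleton_mset by blast
    hence "Z (replicate_mset 1 p)" using assms zatomD by auto
    moreover have "p \<in> supp" using p sub by simp
    ultimately have "ord p dvd 1" using Z_replicate_iff by blast
    hence "ord p = 1" by simp
    thus False using p assms by simp
  qed
  hence w2: "2 \<le> wt U" using size_le_wt[OF sub] by simp
  have "int d dvd int (n * 1) - int (wt U)" by (rule wt_cong[OF zlengths_zatom[OF assms(1)]])
  hence "d dvd n - wt U" using assms(2) by (simp add: of_nat_diff[symmetric] del: of_nat_diff)
  then obtain k where k: "n - wt U = d * k" by blast
  have "k \<noteq> 0" using k assms(2) by (cases k) auto
  moreover have "k < 2"
  proof (rule ccontr)
    assume "\<not> k < 2"
    hence "d * 2 \<le> d * k" by simp
    thus False using k w2 assms by linarith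
  qed
  ultimately have "k = 1" by simp
  thus "wt U = n - d" "d + 2 \<le> n" using k w2 assms by auto
qed

text \<open>Let \<open>j\<close> be the first exponent for which \<open>U\<close> to the power \<open>j\<close> is divisible by some \<open>p\<close> to the
  power \<open>ord p\<close>. Comparing lengths gives \<open>j \<ge> d + 2\<close>, which is more than \<open>n / 2\<close>.\<close>

lemma light_atom_count:
  assumes U: "zatom Z U" "wt U < n" "n \<le> 2 * d + 1" and p: "p \<in># U"
  shows "count U p = 1" "ord p = n"
proof -
  have sub: "set_mset U \<subseteq> supp" using U zatomD Z_suppD by blast
  have n: "wt U = n - d" "d + 2 \<le> n" using light_atom_wt[OF U] by auto
  have wt_ge: "n - d \<le> wt a" if "zatom Z a" for a
    using light_atom_wt[OF that _ U(3)] n by (cases "wt a < n") auto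
  define P where "P = (\<lambda>j. \<exists>p. p \<in># U \<and> ord p \<le> j * count U p)"
  define j where "j = (LEAST j. P j)"
  have "P n" unfolding P_def
  proof (intro exI[of _ p] conjI p)
    show "ord p \<le> n * count U p" using ord_le_n[of p] p sub
      by (metis Suc_leI count_greater_zero_iff mult.comm_neutral mult_le_mono One_nat_def subsetD)
  qed
  hence Pj: "P j" unfolding j_def by (rule LeastI)
  have jmin: "\<not> P i" if "i < j" for i using that not_less_Least unfolding j_def by blast
  \<comment> \<open>All letters that reach their order at exponent \<open>j\<close> are split off
    together; what remains is \<open>Y\<close>.\<close>
  define C where "C = {p. p \<in># U \<and> ord p \<le> j * count U p}"
  have C: "finite C" "C \<subseteq> supp" "C \<noteq> {}" using sub Pj by (auto simp: C_def P_def)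
  define T where "T = (\<Sum>p\<in>C. replicate_mset (ord p) p)"
  have T: "T \<subseteq># repeat_mset j U"
    unfolding T_def using C by (intro mset_subset_eqI) (auto simp: count_sum_replicate C_def)
  define Y where "Y = repeat_mset j U - T"
  have ZU: "Z (repeat_mset j U)" using U zatomD Z_repeat by blast
  have "Z Y" unfolding Y_def using T ZU C by (intro Z_diff) (auto simp: T_def intro: Z_sum_ord)
  then obtain l where l: "l \<in> zlengths Z Y" using ex_zlength by blast
  have "card C + l \<in> zlengths Z (T + Y)"
    unfolding T_def using C l by (intro zlengths_add zlengths_sum_ord)
  moreover have "T + Y = repeat_mset j U" unfolding Y_def using T by simp
  ultimately have lC: "card C + l \<in> zlengths Z (repeat_mset j U)" by simp
  have jU: "j * 1 \<in> zlengths Z (repeat_mset j U)" by (intro zlengths_repeat zlengths_zatom U)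
  have dvd: "int d dvd int j - int (card C + l)" using d_dvd[OF jU lC] by simp
  have "l * (n - d) \<le> wt Y" using l wt_ge by (rule zlengths_wt_le)
  also have "wt Y = j * (n - d) - card C * n"
    unfolding Y_def using T C n by (simp add: wt_diff T_def wt_sum_ord)
  finally have lj: "l * (n - d) \<le> j * (n - d) - card C * n" .
  have Cpos: "0 < card C" using C by (simp add: card_gt_0_iff)
  have "card C * n \<le> j * (n - d)" using wt_mono[OF T] C n by (simp add: T_def wt_sum_ord)
  hence "l * (n - d) + card C * n \<le> j * (n - d)" using lj by linarith
  \<comment> \<open>Each of the \<open>card C\<close> atoms split off weighs \<open>n\<close>, more
    than the \<open>n - d\<close> that a factor \<open>U\<close> contributes, so the new
    factorization is strictly shorter.\<close>
  moreover have "card C * (n - d) < card C * n" using Cpos d_pos n by simp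
  ultimately have "(l + card C) * (n - d) < j * (n - d)" by (simp add: algebra_simps)
  hence "card C + l < j" by (simp add: add.commute)
  hence "d \<le> j - (card C + l)" using int_dvd_diffD[OF dvd] by (intro dvd_imp_le) auto
  hence j1: "card C + l + d \<le> j" using \<open>card C + l < j\<close> by linarith
  \<comment> \<open>The new factorization has at least two factors: a single one would make
    \<open>U\<close> a power of one letter, hence an atom of weight \<open>n\<close>.\<close>
  have j2: "d + 2 \<le> j"
  proof (cases "l = 0")
    case True
    have "Y = {#}" using l True zlengths_pos by fastforce
    hence eq: "repeat_mset j U = T" using T unfolding Y_def by (metis \<open>T + Y = repeat_mset j U\<close> \<open>Y = {#}\<close> add.right_neutral)
    have "card C \<noteq> 1"
    proof
      assume "card C = 1"
      then obtain q where q: "C = {q}" by (auto simp: card_1_singleton_iff)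
      hence "set_mset (repeat_mset j U) = {q}" using eq T_def ord_pos C by (auto simp: set_mset_repeat)
      hence Uq: "set_mset U = {q}" "j \<noteq> 0" by (auto simp: set_mset_repeat split: if_splits)
      have "U = replicate_mset (size U) q" by (rule set_mset_subset_singletonD) (simp add: Uq)
      hence Ur: "U = replicate_mset (count U q) q" by (metis count_replicate_mset)
      have qs: "q \<in> supp" using Uq sub by simp
      have "Z (replicate_mset (count U q) q)" using U(1) zatomD Ur by simp
      hence "ord q dvd count U q" using Z_replicate_iff[OF qs] by simp
      hence "ord q \<le> count U q" using Uq by (metis count_greater_zero_iff dvd_imp_le insertI1)
      hence "U = replicate_mset (ord q) q" using U Uq by (intro zatom_eq_replicate) auto
      thus False using U(2) wt_ord[OF qs] by simp
    qed
    thus ?thesis using j1 Cpos by linarith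
  qed (use j1 Cpos in linarith)
  \<comment> \<open>Minimality of \<open>j\<close> at \<open>j - 1 \<ge> d + 1\<close>, which
    exceeds \<open>n / 2\<close>: this leaves room for one copy of \<open>p\<close> only and forces
    \<open>ord p\<close>, a divisor of \<open>n\<close>, to be \<open>n\<close> itself.\<close>
  have "(j - 1) * count U p < ord p" using jmin[of "j - 1"] j2 p by (auto simp: P_def not_le)
  moreover have "(d + 1) * count U p \<le> (j - 1) * count U p" using j2 by (intro mult_le_mono1) simp
  ultimately have less: "(d + 1) * count U p < ord p" by linarith
  have ordn: "ord p \<le> n" "ord p dvd n" using ord_le_n ord_dvd p sub by auto
  show cnt: "count U p = 1"
  proof (rule ccontr)
    assume "count U p \<noteq> 1"
    hence "2 \<le> count U p" using p by (metis Suc_1 Suc_leI count_greater_zero_iff le_neq_implies_less One_nat_def)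
    hence "(d + 1) * 2 \<le> (d + 1) * count U p" by (rule mult_le_mono2)
    hence "(d + 1) * 2 < n" using less ordn(1) by linarith
    thus False using U(3) by simp
  qed
  obtain k where k: "n = ord p * k" using ordn by blast
  have "k = 1"
  proof (rule ccontr)
    assume "k \<noteq> 1"
    hence "2 \<le> k" using k n_pos by (cases k; cases "k - 1") auto
    hence "ord p * 2 \<le> n" using k by simp
    moreover have "d + 1 < ord p" using less cnt by simp
    ultimately show False using U(3) by linarith
  qed
  thus "ord p = n" using k by simp
qed

text \<open>By the count above all light atoms are squarefree with exactly \<open>n - d\<close>
  letters. Over a proper subset of the support of \<open>U\<close> there is thus no light atom; then
  every atom there weighs exactly \<open>n\<close>, and then it is a power of one letter. Removing
  one letter from the support gives \<open>E\<close>.\<close>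

lemma light_atom_independent:
  assumes U: "zatom Z U" "wt U < n" "n \<le> 2 * d + 1"
  shows "\<exists>E \<subseteq> supp. finite E \<and> card E = n - d - 1 \<and>
    (\<forall>A. Z A \<longrightarrow> set_mset A \<subseteq> E \<longrightarrow> (\<forall>p. n dvd count A p))"
proof -
  have sub: "set_mset U \<subseteq> supp" using U zatomD Z_suppD by blast
  have n: "wt U = n - d" "d + 2 \<le> n" using light_atom_wt[OF U] by auto
  have cnt: "count a p = 1" "ord p = n" if "zatom Z a" "wt a < n" "p \<in># a" for a p
    using light_atom_count[OF that(1,2) U(3) that(3)] by auto
  have card_light: "card (set_mset a) = n - d" if a: "zatom Z a" "wt a < n" for a
  proof -
    have "a = mset_set (set_mset a)"
      using cnt[OF a] by (intro multiset_eqI) (auto simp: count_mset_set' not_in_iff)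
    moreover have "wt a = size a"
    proof -
      have "image_mset (\<lambda>p. n div ord p) a = image_mset (\<lambda>_. 1) a"
        using cnt[OF a] n_pos by (intro image_mset_cong) auto
      thus ?thesis unfolding wt_def by simp
    qed
    ultimately have "wt a = card (set_mset a)" by (metis size_mset_set)
    thus ?thesis using light_atom_wt[OF a U(3)] by simp
  qed
  have ordn: "ord p = n" if "p \<in># U" for p using cnt U that by blast
  have heavy: "n \<le> wt z" if "zatom Z z" "set_mset z \<subset> set_mset U" for z
    using card_light[OF that(1)] card_light[OF U(1,2)] psubset_card_mono[OF _ that(2)]
    by (cases "wt z < n") auto
  \<comment> \<open>\<open>z\<close> divides the product \<open>T\<close> of the \<open>f\<close>
    atoms over its letters, where \<open>f < n - d \<le> d + 1\<close>. The difference of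
    \<open>f\<close> and the length \<open>1 + l\<close> is a multiple of \<open>d\<close> smaller
    than \<open>d\<close>, so it vanishes and the weights balance.\<close>
  have half: "wt z = n" if z: "zatom Z z" "set_mset z \<subset> set_mset U" for z
  proof -
    define f where "f = card (set_mset z)"
    define T where "T = (\<Sum>p\<in>set_mset z. replicate_mset (ord p) p)"
    have zs: "set_mset z \<subseteq> supp" using z zatomD Z_suppD by blast
    have zT: "z \<subseteq># T" unfolding T_def
      using zatom_count_le[OF z(1)] by (intro mset_subset_eqI) (auto simp: count_sum_replicate not_in_iff)
    have fT: "f \<in> zlengths Z T" unfolding T_def f_def using zs by (intro zlengths_sum_ord) auto
    have ZT: "Z T" unfolding T_def using zs by (intro Z_sum_ord) auto
    hence "Z (T - z)" using zT z zatomD Z_diff by blast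
    then obtain l where l: "l \<in> zlengths Z (T - z)" using ex_zlength by blast
    have "1 + l \<in> zlengths Z (z + (T - z))" by (intro zlengths_add zlengths_zatom z l)
    hence lT: "1 + l \<in> zlengths Z T" using zT by simp
    have setT: "set_mset (T - z) \<subseteq> set_mset z"
    proof
      fix x assume "x \<in># (T - z)"
      hence "0 < count T x" by (auto dest: in_diffD)
      thus "x \<in># z" by (simp add: T_def count_sum_replicate split: if_splits)
    qed
    have wT: "wt T = f * n" unfolding T_def f_def using zs by (intro wt_sum_ord) auto
    have "l * n \<le> wt (T - z)" using l by (rule zlengths_wt_le) (use heavy setT z in blast)
    also have "\<dots> = f * n - wt z" using zT wT wt_diff by simp
    finally have ln: "l * n \<le> f * n - wt z" .
    have f1: "1 \<le> f" using z by (simp add: f_def zatom_def card_gt_0_iff Suc_le_eq)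
    have "l * n \<le> (f - 1) * n" using ln heavy[OF z] by (simp add: diff_mult_distrib)
    hence lf: "l \<le> f - 1" using n_pos by simp
    have "int d dvd int f - int (1 + l)" by (rule d_dvd[OF fT lT])
    hence "d dvd f - (1 + l)" using lf f1 by (intro int_dvd_diffD) auto
    moreover have "f - (1 + l) < d"
    proof -
      have "f < n - d" unfolding f_def using psubset_card_mono[OF _ z(2)] card_light U by simp
      thus ?thesis using U(3) n by linarith
    qed
    ultimately have "f = 1 + l" using lf f1 by (metis diff_is_0_eq dvd_imp_le le_antisym le_diff_conv2 not_gr_zero not_le add.commute)
    hence "wt z \<le> n" using ln n_pos f1 zT wT
      by (metis Nat.le_diff_conv2 add_mult_distrib le_add_diff_inverse2 mult_1 nat_add_left_cancel_le subset_mset.add_diff_inverse wt_add le_add1 add.commute)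
    thus ?thesis using heavy[OF z] by simp
  qed
  have pure: "n \<le> count z p" if z: "zatom Z z" "set_mset z \<subset> set_mset U" "p \<in># z" for z p
  proof (rule ccontr)
    assume small: "\<not> n \<le> count z p"
    have "count z x < n" if "x \<in># z" for x
    proof (rule ccontr)
      assume "\<not> count z x < n"
      hence *: "ord x \<le> count z x" using ordn z that by auto
      hence zx: "z = replicate_mset (ord x) x" using zatom_eq_replicate z that by blast
      hence "p = x" using z(3) by (metis in_replicate_mset)
      thus False using small \<open>\<not> count z x < n\<close> by simp
    qed
    \<comment> \<open>With \<open>c\<close> the largest multiplicity in \<open>z\<close>, the letter
      \<open>i\<close> attaining it disappears from \<open>repeat_mset c U - z\<close>, whose
      factors therefore all weigh \<open>n\<close>.\<close>
    moreover define c where "c = Max (count z ` set_mset z)"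
    have "c \<in> count z ` set_mset z" unfolding c_def using z by (intro Max_in) auto
    then obtain i where i: "i \<in># z" "c = count z i" by auto
    ultimately have c: "0 < c" "c < n" by auto
    have cmax: "count z x \<le> c" for x
    proof (cases "x \<in># z")
      case False thus ?thesis by (simp add: not_in_iff)
    qed (simp add: c_def)
    have zc: "z \<subseteq># repeat_mset c U"
    proof (intro mset_subset_eqI)
      fix x show "count z x \<le> count (repeat_mset c U) x"
        using cmax[of x] cnt[OF U(1,2), of x] z by (cases "x \<in># z") (auto simp: not_in_iff)
    qed
    have "Z (repeat_mset c U - z)" using zc Z_diff Z_repeat z U zatomD by blast
    then obtain l where l: "l \<in> zlengths Z (repeat_mset c U - z)" using ex_zlength by blast
    have iU: "i \<in># U" using i z by blast
    have "i \<notin># repeat_mset c U - z" using i cnt[OF U(1,2) iU] by (simp add: not_in_iff)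
    moreover have "set_mset (repeat_mset c U - z) \<subseteq> set_mset U"
      using in_diffD by (fastforce simp: set_mset_repeat split: if_splits)
    ultimately have ss: "set_mset (repeat_mset c U - z) \<subset> set_mset U" using iU by blast
    have "wt (repeat_mset c U - z) = l * n"
      using l by (rule zlengths_wt_eq) (use half ss in blast)
    hence ln: "l * n + n = c * (n - d)" using half[OF z(1,2)] n zc
      by (metis add.commute subset_mset.add_diff_inverse wt_add wt_repeat)
    have "1 + l \<in> zlengths Z (z + (repeat_mset c U - z))" by (intro zlengths_add zlengths_zatom z l)
    hence "1 + l \<in> zlengths Z (repeat_mset c U)" using zc by simp
    moreover have "c * 1 \<in> zlengths Z (repeat_mset c U)" by (intro zlengths_repeat zlengths_zatom U)
    ultimately have "int d dvd int (c * 1) - int (1 + l)" using d_dvd by blast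
    then obtain t where t: "int c - (1 + int l) = int d * t" by auto
    have "int l * int n + int n = int c * (int n - int d)" using ln n
      by (metis of_nat_add of_nat_mult of_nat_diff add_leD1)
    \<comment> \<open>The weights and the divisibility together give
      \<open>d * c = n * d * t\<close>, so \<open>n\<close> divides \<open>c\<close>, although
      \<open>0 < c < n\<close>.\<close>
    hence "int d * int c = int n * (int c - (1 + int l))" by (simp add: algebra_simps)
    also have "\<dots> = int d * (int n * t)" by (simp only: t mult.left_commute)
    finally have "int d * int c = int d * (int n * t)" .
    hence "int c = int n * t" using d_pos by simp
    hence "int n dvd int c" by simp
    thus False using c by (auto dest: dvd_imp_le)
  qed
  obtain p0 where p0: "p0 \<in># U" using U by (auto simp: zatom_def)
  define E where "E = set_mset U - {p0}"
  have "card E = n - d - 1" using p0 card_light[OF U(1,2)] by (simp add: E_def)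
  moreover have "n dvd count A p" if A: "Z A" "set_mset A \<subseteq> E" for A p
  proof -
    obtain M where M: "\<forall>a\<in>#M. zatom Z a" "\<Sum>\<^sub># M = A" using ex_factorization[OF A(1)] by blast
    have "n dvd count a p" if "a \<in># M" for a
    proof (cases "p \<in># a")
      case True
      have "set_mset a \<subseteq> E" using M(2) A(2) that by auto
      hence a: "set_mset a \<subset> set_mset U" using p0 by (auto simp: E_def)
      have "n \<le> count a p" using pure[OF _ a True] M that by blast
      moreover have "count a p \<le> n" using zatom_count_le[of a p] M that True ordn[of p] a by auto
      ultimately show ?thesis by simp
    qed (simp add: not_in_iff)
    hence "n dvd count (\<Sum>\<^sub># M) p" by (induction M) auto
    thus ?thesis using M by simp
  qed
  ultimately show ?thesis using sub by (intro exI[of _ E]) (auto simp: E_def)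
qed

end

section \<open>Sets of large cross number\<close>

context block_monoid begin

definition half_factorial_product :: "'p multiset \<Rightarrow> bool" where
  "half_factorial_product A \<longleftrightarrow> (\<exists>R. (\<forall>a\<in>#R. zatom Z a \<and> wt a = n) \<and> \<Sum>\<^sub># R = A)"

text \<open>The only factors by which multisets are enlarged in this part; \<open>S\<close> records
  them with multiplicity.\<close>

definition ord_sum :: "'p multiset \<Rightarrow> 'p multiset" where
  "ord_sum S = (\<Sum>p\<in>#S. replicate_mset (ord p) p)"

lemma ord_sum_simps [simp]:
  "ord_sum {#} = {#}" "ord_sum (S + T) = ord_sum S + ord_sum T"
  "ord_sum (add_mset p S) = replicate_mset (ord p) p + ord_sum S"
  by (simp_all add: ord_sum_def)

lemma hfp_empty: "half_factorial_product {#}"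
  unfolding half_factorial_product_def by (intro exI[of _ "{#}"]) auto

lemma hfp_add:
  assumes "half_factorial_product A" "half_factorial_product B"
  shows "half_factorial_product (A + B)"
proof -
  obtain R S where "\<forall>a\<in>#R. zatom Z a \<and> wt a = n" "\<Sum>\<^sub># R = A" "\<forall>a\<in>#S. zatom Z a \<and> wt a = n" "\<Sum>\<^sub># S = B"
    using assms unfolding half_factorial_product_def by blast
  thus ?thesis unfolding half_factorial_product_def by (intro exI[of _ "R + S"]) auto
qed

lemma hfp_sum: "(\<And>x. x \<in># M \<Longrightarrow> half_factorial_product (f x)) \<Longrightarrow> half_factorial_product (\<Sum>x\<in>#M. f x)"
  by (induction M) (auto intro: hfp_empty hfp_add)

lemma hfp_zatom: "zatom Z a \<Longrightarrow> wt a = n \<Longrightarrow> half_factorial_product a"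
  unfolding half_factorial_product_def by (intro exI[of _ "{#a#}"]) auto

lemma hfp_Z: "half_factorial_product A \<Longrightarrow> Z A"
  unfolding half_factorial_product_def using Z_sum_mset zatomD by blast

lemma hfp_ord_sum: "set_mset S \<subseteq> supp \<Longrightarrow> half_factorial_product (ord_sum S)"
  unfolding ord_sum_def by (intro hfp_sum hfp_zatom zatom_ord wt_ord) auto

lemma zlengths_ord_sum: "set_mset S \<subseteq> supp \<Longrightarrow> size S \<in> zlengths Z (ord_sum S)"
proof (induction S)
  case (add p S)
  have "1 + size S \<in> zlengths Z (replicate_mset (ord p) p + ord_sum S)"
    using add by (intro zlengths_add zlengths_zatom zatom_ord) auto
  thus ?case by simp
qed (simp add: zlengths_empty)

lemma wt_ord_sum: "set_mset S \<subseteq> supp \<Longrightarrow> wt (ord_sum S) = size S * n"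
  by (induction S) (auto simp: wt_ord simp del: wt_replicate)

text \<open>Supplies inverses up to factors of \<open>ord_sum\<close>: together with
  \<open>A\<close>, the multiset \<open>repeat_mset (n - 1) A\<close> amounts to such a
  product.\<close>

lemma repeat_eq_ord_sum:
  "set_mset A \<subseteq> supp \<Longrightarrow> \<exists>S. set_mset S \<subseteq> set_mset A \<and> repeat_mset n A = ord_sum S"
proof (induction A)
  case (add p A)
  then obtain S where S: "set_mset S \<subseteq> set_mset A" "repeat_mset n A = ord_sum S" by auto
  have os: "ord_sum (replicate_mset k p) = replicate_mset (k * ord p) p" for k
    by (induction k) (simp_all add: replicate_add)
  have "repeat_mset n (add_mset p A) = replicate_mset n p + repeat_mset n A"
    by (rule multiset_eqI) (auto simp: algebra_simps)
  also have "replicate_mset n p = ord_sum (replicate_mset (n div ord p) p)"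
    using add.prems ord_dvd[of p] by (simp add: os)
  finally have "repeat_mset n (add_mset p A) = ord_sum (replicate_mset (n div ord p) p + S)"
    using S by simp
  moreover have "set_mset (replicate_mset (n div ord p) p + S) \<subseteq> set_mset (add_mset p A)"
    using S by auto
  ultimately show ?case by blast
qed auto

text \<open>If \<open>E\<close> generates, up to torsion prime to \<open>q\<close>, the same group as \<open>J\<close> and is minimal with
  this property, then a relation on \<open>E\<close> has all coefficients divisible by \<open>q\<close>.\<close>

lemma ex_small_generating_set:
  assumes J: "finite J" "J \<subseteq> supp" and q: "Factorial_Ring.prime q"
    and rank: "\<And>E. E \<subseteq> J \<Longrightarrow> card E = Suc r \<Longrightarrow>
      \<exists>A. Z A \<and> set_mset A \<subseteq> E \<and> (\<exists>e\<in>E. \<not> q dvd count A e)"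
  shows "\<exists>E M. E \<subseteq> J \<and> card E \<le> r \<and> \<not> q dvd M \<and>
    (\<forall>g\<in>J. \<exists>s. set_mset s \<subseteq> E \<and> Z (replicate_mset M g + s))"
proof -
  define P where "P = (\<lambda>E. E \<subseteq> J \<and> (\<exists>M. \<not> q dvd M \<and>
    (\<forall>g\<in>J. \<exists>s. set_mset s \<subseteq> E \<and> Z (replicate_mset M g + s))))"
  \<comment> \<open>Here \<open>M = 1\<close> works, \<open>n - 1\<close> copies of \<open>g\<close>
    being its inverse.\<close>
  have "P J"
    unfolding P_def
  proof (intro conjI exI[of _ 1] ballI)
    show "\<not> q dvd 1" using q by (simp add: prime_nat_iff)
    fix g assume "g \<in> J"
    moreover have "replicate_mset 1 g + replicate_mset (n - 1) g = replicate_mset n g"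
      using n_pos by (simp add: replicate_add[symmetric] del: replicate_mset_Suc)
    ultimately show "\<exists>s. set_mset s \<subseteq> J \<and> Z (replicate_mset 1 g + s)"
      using J by (intro exI[of _ "replicate_mset (n - 1) g"]) (auto simp: supp_def)
  qed simp
  then obtain E where E: "P E" "\<And>E'. P E' \<Longrightarrow> card E \<le> card E'"
    using ex_has_least_nat[of P J card] by blast
  then obtain M where M: "\<not> q dvd M" and Mg: "\<forall>g\<in>J. \<exists>s. set_mset s \<subseteq> E \<and> Z (replicate_mset M g + s)"
    unfolding P_def by blast
  have EJ: "E \<subseteq> J" using E by (simp add: P_def)
  have "card E \<le> r"
  proof (rule ccontr)
    assume "\<not> card E \<le> r"
    then obtain E' where E': "E' \<subseteq> E" "card E' = Suc r"
      by (metis not_less_eq_eq obtain_subset_with_card_n)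
    \<comment> \<open>The coefficient \<open>u\<close> of \<open>e\<close> in the relation
      \<open>A\<close> is prime to \<open>q\<close>, so \<open>e\<close> can be eliminated from
      \<open>E\<close> at the cost of replacing \<open>M\<close> by \<open>u * M\<close>.\<close>
    then obtain A e where A: "Z A" "set_mset A \<subseteq> E'" "e \<in> E'" "\<not> q dvd count A e"
      using rank[of E'] EJ by blast
    define u where "u = count A e"
    define A' where "A' = filter_mset (\<lambda>x. x \<noteq> e) A"
    have AA: "A = replicate_mset u e + A'" by (rule multiset_eqI) (auto simp: A'_def u_def)
    have A's: "set_mset A' \<subseteq> E - {e}" using A E' by (auto simp: A'_def)
    have ns: "set_mset A' \<subseteq> supp" using A's EJ J by blast
    have "P (E - {e})"
      unfolding P_def
    proof (intro conjI exI[of _ "u * M"] ballI)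
      show "E - {e} \<subseteq> J" using EJ by blast
      show "\<not> q dvd u * M" using M A q by (simp add: u_def prime_dvd_mult_iff)
      fix g assume "g \<in> J"
      then obtain s where s: "set_mset s \<subseteq> E" "Z (replicate_mset M g + s)" using Mg by blast
      define a where "a = count s e"
      define s' where "s' = filter_mset (\<lambda>x. x \<noteq> e) s"
      have ss: "s = replicate_mset a e + s'" by (rule multiset_eqI) (auto simp: s'_def a_def)
      \<comment> \<open>Multiplied by \<open>u\<close>, the \<open>a\<close> copies of
        \<open>e\<close> in \<open>s\<close> complete to \<open>a\<close> copies of \<open>A\<close>
        once \<open>a\<close> copies of \<open>A'\<close> are present. These are added as
        \<open>a * n\<close> copies, which are zero-sum, and \<open>a * (n - 1)\<close> of them
        remain.\<close>
      have "Z (repeat_mset u (replicate_mset M g + s) + repeat_mset (a * n) A')"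
      proof (rule Z_add[OF Z_repeat[OF s(2)]])
        have "repeat_mset (a * n) A' = repeat_mset a (repeat_mset n A')" by (rule multiset_eqI) simp
        moreover have "Z (repeat_mset n A')" using wt_zlengths[OF ns] zlengths_Z by blast
        ultimately show "Z (repeat_mset (a * n) A')" using Z_repeat by metis
      qed
      moreover have "repeat_mset u (replicate_mset M g + s) + repeat_mset (a * n) A'
          = repeat_mset a A + (replicate_mset (u * M) g + (repeat_mset u s' + repeat_mset (a * (n - 1)) A'))"
      proof (rule multiset_eqI)
        fix x
        obtain m where "n = Suc m" using n_pos gr0_implies_Suc by blast
        thus "count (repeat_mset u (replicate_mset M g + s) + repeat_mset (a * n) A') x =
          count (repeat_mset a A + (replicate_mset (u * M) g + (repeat_mset u s' + repeat_mset (a * (n - 1)) A'))) x"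
          by (simp add: AA ss algebra_simps)
      qed
      ultimately have "Z (replicate_mset (u * M) g + (repeat_mset u s' + repeat_mset (a * (n - 1)) A'))"
        using Z_cancel[OF Z_repeat[OF A(1), of a]] by metis
      moreover have "set_mset (repeat_mset u s' + repeat_mset (a * (n - 1)) A') \<subseteq> E - {e}"
        using s A's by (auto simp: s'_def set_mset_repeat split: if_splits)
      ultimately show "\<exists>s. set_mset s \<subseteq> E - {e} \<and> Z (replicate_mset (u * M) g + s)" by blast
    qed
    moreover have "card (E - {e}) < card E"
      using A E' EJ J by (intro psubset_card_mono) (auto intro: finite_subset)
    ultimately show False using E(2) by fastforce
  qed
  thus ?thesis using EJ M Mg by blast
qed

end

context distance_divisor begin

text \<open>\<open>rank\<close> is what a group of rank \<open>r\<close> provides: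
  \<open>r + 1\<close> elements satisfy a relation that is nontrivial modulo \<open>q\<close>. The
  first alternative comes from sets \<open>J\<close> with at most \<open>r + 1\<close> letters, the
  second from larger ones.\<close>

lemma large_cross_number_bound:
  assumes lcn: "\<And>a. zatom Z a \<Longrightarrow> n \<le> wt a"
    and "\<exists>a. zatom Z a \<and> wt a \<noteq> n"
    and rank: "\<And>E q. E \<subseteq> supp \<Longrightarrow> finite E \<Longrightarrow> card E = Suc r \<Longrightarrow> Factorial_Ring.prime q \<Longrightarrow> q dvd n \<Longrightarrow>
      \<exists>A. Z A \<and> set_mset A \<subseteq> E \<and> (\<exists>e\<in>E. \<not> q dvd count A e)"
  shows "d + 1 \<le> r \<or> 2 * d + 3 \<le> n"
proof -
  obtain a where a: "zatom Z a" "wt a \<noteq> n"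
    and amin: "\<And>b. zatom Z b \<Longrightarrow> wt b \<noteq> n \<Longrightarrow> card (set_mset a) \<le> card (set_mset b)"
    using assms(2) ex_has_least_nat[of "\<lambda>a. zatom Z a \<and> wt a \<noteq> n" _ "\<lambda>a. card (set_mset a)"] by blast
  define J where "J = set_mset a"
  have J: "finite J" "J \<subseteq> supp" using a Z_suppD zatomD by (auto simp: J_def)
  have wa: "n < wt a" using lcn a by (simp add: order_neq_le_trans)
  have hf: "wt b = n" if "zatom Z b" "set_mset b \<subset> J" for b
    using amin[OF that(1)] psubset_card_mono[OF J(1) that(2)] by (auto simp: J_def)
  have J_nonhf: "set_mset b = J" if "zatom Z b" "set_mset b \<subseteq> J" "wt b \<noteq> n" for b
    using hf that by blast
  show ?thesis
  proof (cases "card J \<le> r + 1")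
    case True
    define T where "T = (\<Sum>p\<in>J. replicate_mset (ord p) p)"
    have aT: "a \<subseteq># T" unfolding T_def J_def
      using zatom_count_le[OF a(1)] by (intro mset_subset_eqI) (auto simp: count_sum_replicate not_in_iff)
    \<comment> \<open>A nonempty remainder gives \<open>l \<ge> 1\<close>, which improves
      \<open>d \<le> card J - 1\<close> to \<open>d \<le> card J - 2\<close>.\<close>
    have ne: "T - a \<noteq> {#}"
    proof
      assume "T - a = {#}"
      hence "T = a" using aT by (metis subset_mset.add_diff_inverse add.right_neutral)
      obtain p where p: "p \<in> J" using a by (auto simp: J_def zatom_def)
      hence "count a p = ord p" using \<open>T = a\<close> J by (auto simp: T_def count_sum_replicate)
      hence "a = replicate_mset (ord p) p" using zatom_eq_replicate a p by (simp add: J_def)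
      thus False using a wt_ord[of p] p J by auto
    qed
    have "Z (T - a)" using aT a zatomD Z_sum_ord[OF J] by (intro Z_diff) (auto simp: T_def)
    then obtain l where l: "l \<in> zlengths Z (T - a)" using ex_zlength by blast
    have "1 + l \<in> zlengths Z (a + (T - a))" by (intro zlengths_add zlengths_zatom a l)
    hence lT: "1 + l \<in> zlengths Z T" using aT by simp
    have wT: "wt T = card J * n" unfolding T_def by (rule wt_sum_ord[OF J])
    have "l * n \<le> wt (T - a)" using l lcn by (rule zlengths_wt_le)
    hence "l * n + wt a \<le> card J * n" using wt_diff[OF aT] wt_mono[OF aT] wT by linarith
    hence "(l + 1) * n < card J * n" using wa by simp
    hence lJ: "1 + l < card J" by (metis mult_less_cancel2 add.commute)
    have "int d dvd int (card J) - int (1 + l)"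
      using zlengths_sum_ord[OF J] lT unfolding T_def by (rule d_dvd)
    hence "d dvd card J - (1 + l)" using lJ by (intro int_dvd_diffD) auto
    hence "d \<le> card J - (1 + l)" using lJ by (intro dvd_imp_le) auto
    moreover have "1 \<le> l" using l ne zlengths_pos by blast
    ultimately show ?thesis using True lJ by linarith
  next
    case False
    hence m: "r + 2 \<le> card J" by simp
    have small: "half_factorial_product z" if z: "Z z" "set_mset z \<subset> J" for z
    proof -
      obtain M where M: "\<forall>a\<in>#M. zatom Z a" "\<Sum>\<^sub># M = z" using ex_factorization[OF z(1)] by blast
      have "set_mset b \<subset> J" if "b \<in># M" for b using M(2) z(2) that by auto
      thus ?thesis unfolding half_factorial_product_def using M hf by blast
    qed
    define good where "good = (\<lambda>z. \<exists>S. set_mset S \<subseteq> J \<and> half_factorial_product (z + ord_sum S))"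
    have good_add: "good (x + y)" if "good x" "good y" for x y
    proof -
      obtain S T where "set_mset S \<subseteq> J" "half_factorial_product (x + ord_sum S)"
          "set_mset T \<subseteq> J" "half_factorial_product (y + ord_sum T)" using \<open>good x\<close> \<open>good y\<close> by (auto simp: good_def)
      thus ?thesis unfolding good_def using hfp_add[of "x + ord_sum S" "y + ord_sum T"]
        by (intro exI[of _ "S + T"]) (auto simp: ac_simps)
    qed
    have good: "good z" if z: "Z z" "set_mset z \<subseteq> J" for z
    proof -
      \<comment> \<open>The multipliers \<open>c\<close> for which \<open>c\<close> copies of
        \<open>z\<close> are good are closed under sums, include \<open>n\<close> and stay good when
        multiples of \<open>n\<close> are removed, since \<open>n * j\<close> copies of
        \<open>z\<close> are an \<open>ord_sum\<close> themselves. They include \<open>1\<close>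
        once no prime dividing \<open>n\<close> divides all of them.\<close>
      define C where "C = {c. good (repeat_mset c z)}"
      have zs: "set_mset z \<subseteq> supp" using z J by blast
      obtain Sn where Sn: "set_mset Sn \<subseteq> set_mset z" "repeat_mset n z = ord_sum Sn"
        using repeat_eq_ord_sum[OF zs] by blast
      have ord_sum_repeat: "ord_sum (repeat_mset j S) = repeat_mset j (ord_sum S)" for j S
        by (induction j) auto
      have nj: "repeat_mset (n * j) z = ord_sum (repeat_mset j Sn)" "set_mset (repeat_mset j Sn) \<subseteq> J" for j
      proof -
        have "repeat_mset (n * j) z = repeat_mset j (repeat_mset n z)" by (rule multiset_eqI) simp
        thus "repeat_mset (n * j) z = ord_sum (repeat_mset j Sn)" by (simp add: Sn ord_sum_repeat)
        show "set_mset (repeat_mset j Sn) \<subseteq> J" using Sn z by (auto simp: set_mset_repeat)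
      qed
      have repeat_add: "repeat_mset (b + c) z = repeat_mset b z + repeat_mset c z" for b c
        by (rule multiset_eqI) (simp add: algebra_simps)
      have C_add: "b + c \<in> C" if "b \<in> C" "c \<in> C" for b c
        using good_add that by (simp add: C_def repeat_add)
      have C_mult: "b * c \<in> C" if "c \<in> C" "0 < b" for b c
        using that(2)
      proof (induction b rule: nat_induct_non_zero)
        case (Suc b) thus ?case using C_add[OF that(1), of "b * c"] by simp
      qed (use that in simp)
      have C_red: "c \<in> C" if cC: "c + n * j \<in> C" for c j
      proof -
        obtain S where S: "set_mset S \<subseteq> J" "half_factorial_product (repeat_mset (c + n * j) z + ord_sum S)"
          using cC unfolding C_def good_def by blast
        have "repeat_mset (c + n * j) z + ord_sum S = repeat_mset c z + ord_sum (repeat_mset j Sn + S)"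
          by (simp add: repeat_add nj(1) add.assoc)
        hence "half_factorial_product (repeat_mset c z + ord_sum (repeat_mset j Sn + S))" using S(2) by metis
        moreover have "set_mset (repeat_mset j Sn + S) \<subseteq> J" using S(1) nj(2)[of j] by simp
        ultimately show ?thesis unfolding C_def good_def by blast
      qed
      have nC: "n \<in> C"
      proof -
        have "half_factorial_product (repeat_mset n z + ord_sum {#})"
          using hfp_ord_sum[of Sn] Sn zs by simp
        thus ?thesis unfolding C_def good_def by (intro CollectI exI[of _ "{#}"]) auto
      qed
      \<comment> \<open>Each letter \<open>g\<close> of \<open>z\<close> is expressed, up to a
        multiplier \<open>M\<close> prime to \<open>q\<close>, through at most \<open>r\<close>
        letters \<open>E\<close>. Such a relation lives on at most \<open>r + 1 < card J\<close>
        letters, where every zero-sum multiset is a product of atoms of weight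
        \<open>n\<close>.\<close>
      have qC: "\<exists>M\<in>C. \<not> q dvd M" if q: "Factorial_Ring.prime q" "q dvd n" for q
      proof -
        have rk: "\<exists>A. Z A \<and> set_mset A \<subseteq> E \<and> (\<exists>e\<in>E. \<not> q dvd count A e)"
          if "E \<subseteq> J" "card E = Suc r" for E
          using rank[OF subset_trans[OF that(1) J(2)] finite_subset[OF that(1) J(1)] that(2) q] .
        obtain E M where E: "E \<subseteq> J" "card E \<le> r" and M: "\<not> q dvd M"
          and sex: "\<forall>g\<in>J. \<exists>s. set_mset s \<subseteq> E \<and> Z (replicate_mset M g + s)"
          using ex_small_generating_set[OF J q(1), of r] rk by auto
        obtain s where "\<forall>g\<in>J. set_mset (s g) \<subseteq> E \<and> Z (replicate_mset M g + s g)"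
          using bchoice[OF sex] by blast
        hence s: "\<And>g. g \<in> J \<Longrightarrow> set_mset (s g) \<subseteq> E" "\<And>g. g \<in> J \<Longrightarrow> Z (replicate_mset M g + s g)"
          by blast+
        define S where "S = (\<Sum>g\<in>#z. s g)"
        have SE: "set_mset S \<subseteq> E" using s z by (fastforce simp: S_def)
        have sum_eq: "(\<Sum>g\<in>#z. replicate_mset M g + s g) = repeat_mset M z + S"
        proof -
          have "(\<Sum>g\<in>#z. replicate_mset M g) = repeat_mset M z"
            by (induction z) (auto simp: multiset_eq_iff)
          thus ?thesis by (simp add: S_def sum_mset.distrib)
        qed
        have "half_factorial_product (replicate_mset M g + s g)" if "g \<in># z" for g
        proof (rule small)
          have g: "g \<in> J" using that z by blast
          show "Z (replicate_mset M g + s g)" using s g by blast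
          have "set_mset (replicate_mset M g + s g) \<subseteq> insert g E" using s(1)[OF g] by auto
          moreover have "insert g E \<subset> J"
          proof -
            have "finite E" using E J finite_subset by blast
            hence "card (insert g E) \<le> r + 1" using E(2) by (simp add: card_insert_if)
            hence "insert g E \<noteq> J" using m by auto
            thus ?thesis using g E by blast
          qed
          ultimately show "set_mset (replicate_mset M g + s g) \<subset> J" by (rule subset_psubset_trans)
        qed
        hence h1: "half_factorial_product (repeat_mset M z + S)" using hfp_sum[of z "\<lambda>g. replicate_mset M g + s g"] sum_eq by simp
        \<comment> \<open>\<open>S\<close> is the leftover over \<open>E\<close>: adding
          \<open>n - 1\<close> further copies turns it into an \<open>ord_sum\<close>, which
          \<open>good\<close> permits.\<close>
        have "Z S" using hfp_Z[OF h1] Z_repeat[OF z(1)] Z_cancel by blast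
        moreover have "E \<subset> J" using E m by auto
        ultimately have "half_factorial_product (repeat_mset (n - 1) S)"
          using SE by (intro small Z_repeat) (auto simp: set_mset_repeat)
        with h1 have "half_factorial_product (repeat_mset M z + S + repeat_mset (n - 1) S)" by (rule hfp_add)
        moreover have eq: "repeat_mset M z + S + repeat_mset (n - 1) S = repeat_mset M z + repeat_mset n S"
          using n_pos by (intro multiset_eqI) (cases n, auto)
        moreover obtain S' where S': "set_mset S' \<subseteq> set_mset S" "repeat_mset n S = ord_sum S'"
          using repeat_eq_ord_sum[of S] SE E J by blast
        ultimately have "half_factorial_product (repeat_mset M z + ord_sum S')" by metis
        moreover have "set_mset S' \<subseteq> J" using S' SE E by blast
        ultimately have "M \<in> C" unfolding C_def good_def by blast
        thus ?thesis using M by blast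
      qed
      define c where "c = (LEAST c. 0 < c \<and> c \<in> C)"
      have c: "0 < c \<and> c \<in> C" unfolding c_def using n_pos nC by (rule LeastI[where P = "\<lambda>c. 0 < c \<and> c \<in> C", OF conjI])
      have cmin: "c \<le> x" if "x \<in> C" "0 < x" for x
        unfolding c_def using that(2,1) by (rule Least_le[where P = "\<lambda>c. 0 < c \<and> c \<in> C", OF conjI])
      have cdvd: "c dvd x" if x: "x \<in> C" for x
      proof (rule ccontr)
        assume nd: "\<not> c dvd x"
        have "x mod c \<in> C"
        \<comment> \<open>Subtracting \<open>x div c\<close> copies of \<open>c\<close> is done
          modulo \<open>n\<close>, by adding \<open>n - 1\<close> times as many. As
          \<open>C_mult\<close> asks for a positive factor, the cases with nothing to add are
          separate.\<close>
        proof (cases "x div c * (n - 1) = 0")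
          case True
          consider "x div c = 0" | "n = 1" using True n_pos by fastforce
          thus ?thesis
          proof cases
            case 1 thus ?thesis using x by (metis add.left_neutral mod_div_mult_eq mult_zero_left add_0 div_mult_mod_eq)
          next
            case 2 thus ?thesis using C_red[of "x mod c" "x - x mod c"] x by simp
          qed
        next
          case False
          have "x + x div c * (n - 1) * c \<in> C" using x C_mult[of c "x div c * (n - 1)"] c False by (intro C_add) auto
          also have "x + x div c * (n - 1) * c = x mod c + n * (x div c * c)"
          proof -
            have "x + x div c * (n - 1) * c = x mod c + (x div c * c + x div c * (n - 1) * c)"
              using mod_div_mult_eq[of x c] by linarith
            also have "x div c * c + x div c * (n - 1) * c = n * (x div c * c)"
              using n_pos by (cases n) (auto simp: algebra_simps)
            finally show ?thesis .
          qed
          finally show ?thesis by (rule C_red)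
        qed
        moreover have "0 < x mod c" using nd by (auto simp: dvd_eq_mod_eq_0)
        ultimately have "c \<le> x mod c" by (rule cmin)
        moreover have "x mod c < c" using c by simp
        ultimately show False by linarith
      qed
      have "c = 1"
      proof (rule ccontr)
        assume "c \<noteq> 1"
        then obtain q where "Factorial_Ring.prime q" "q dvd c" using prime_factor_nat by blast
        thus False using qC[of q] cdvd nC by (meson dvd_trans)
      qed
      thus ?thesis using c by (simp add: C_def)
    qed
    define bad where "bad = (\<lambda>y. Z y \<and> set_mset y \<subseteq> J \<and> \<not> half_factorial_product y)"
    have badD: "n * (1 + d) \<le> wt y" "J \<subseteq> set_mset y" if "bad y" for y
    proof -
      have "Z y" using \<open>bad y\<close> by (simp add: bad_def)
      then obtain M where M: "\<forall>a\<in>#M. zatom Z a" "\<Sum>\<^sub># M = y" using ex_factorization by blast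
      then obtain b where b: "b \<in># M" "wt b \<noteq> n" using \<open>bad y\<close> by (auto simp: bad_def half_factorial_product_def)
      have by': "b \<subseteq># y" using b M by (metis mset_subset_eq_add_left sum_mset.remove)
      have bb: "zatom Z b" "set_mset b \<subseteq> J" using b M by' \<open>bad y\<close> set_mset_mono by (auto simp: bad_def)
      show "J \<subseteq> set_mset y" using J_nonhf[OF bb b(2)] by' set_mset_mono by blast
      \<comment> \<open>Two factorizations of \<open>b + ord_sum S\<close>: the weights give
        \<open>wt b = n * (size R - size S)\<close>, and the lengths \<open>size R\<close> and
        \<open>1 + size S\<close> differ by a positive multiple of \<open>d\<close>.\<close>
      obtain S R where S: "set_mset S \<subseteq> J" and R: "\<forall>a\<in>#R. zatom Z a \<and> wt a = n" "\<Sum>\<^sub># R = b + ord_sum S"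
        using good[OF zatomD[OF bb(1)] bb(2)] by (auto simp: good_def half_factorial_product_def)
      have SJ: "set_mset S \<subseteq> supp" using S J by blast
      have l1: "1 + size S \<in> zlengths Z (b + ord_sum S)" by (intro zlengths_add zlengths_zatom bb zlengths_ord_sum SJ)
      have l2: "size R \<in> zlengths Z (b + ord_sum S)" unfolding zlengths_def using R by auto
      have "(\<Sum>a\<in>#R. wt a) = size R * n" using R(1) by (simp cong: image_mset_cong)
      hence eq: "size R * n = wt b + size S * n" using wt_sum_mset[of R] R(2) wt_ord_sum[OF SJ] by simp
      moreover have "n < wt b" using lcn[OF bb(1)] b(2) by simp
      ultimately have "(size S + 1) * n < size R * n" by simp
      hence sz: "1 + size S < size R" by (metis mult_less_cancel2 add.commute)
      have "d dvd size R - (1 + size S)" using d_dvd[OF l2 l1] sz by (intro int_dvd_diffD) auto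
      hence "d \<le> size R - (1 + size S)" using sz by (intro dvd_imp_le) auto
      hence "(1 + size S + d) * n \<le> size R * n" using sz by (intro mult_le_mono1) linarith
      hence "n * (1 + d) \<le> wt b" using eq by (simp add: algebra_simps)
      thus "n * (1 + d) \<le> wt y" using wt_mono[OF by'] by linarith
    qed
    \<comment> \<open>A minimal \<open>y\<close> with \<open>near y\<close>: if a factor \<open>B\<close> of \<open>y + replicate_mset (ord g) g\<close> had at most
      \<open>count y g\<close> copies of \<open>g\<close>, then removing \<open>B\<close> from \<open>y\<close> would leave a smaller one.\<close>
    define near where "near = (\<lambda>y. bad y \<and> (\<exists>g\<in>J. half_factorial_product (y + replicate_mset (ord g) g)))"
    \<comment> \<open>The factors of \<open>ord_sum S\<close> are added one at a time; the last
      multiset that is still bad is near.\<close>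
    have ex_near: "\<exists>y. near y"
      if "bad y" "set_mset S \<subseteq> J" "half_factorial_product (y + ord_sum S)" for y S
      using that
    proof (induction S arbitrary: y)
      case empty thus ?case by (simp add: bad_def)
    next
      case (add g S)
      have g: "g \<in> J" using add.prems by simp
      show ?case
      proof (cases "half_factorial_product (y + replicate_mset (ord g) g)")
        case True thus ?thesis using add.prems g by (auto simp: near_def)
      next
        case False
        hence "bad (y + replicate_mset (ord g) g)"
          using add.prems g J Z_ord[of g] by (auto simp: bad_def intro!: Z_add)
        thus ?thesis using add.IH[of "y + replicate_mset (ord g) g"] add.prems by (simp add: ac_simps)
      qed
    qed
    have "bad a"
    proof -
      have "\<not> half_factorial_product a"
      proof
        assume "half_factorial_product a"
        then obtain R where R: "\<forall>b\<in>#R. zatom Z b \<and> wt b = n" "\<Sum>\<^sub># R = a" by (auto simp: half_factorial_product_def)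
        obtain b where b: "b \<in># R" using R a by (cases "R = {#}") (auto simp: zatom_def)
        hence "b \<subseteq># a" using R by (metis mset_subset_eq_add_left sum_mset.remove)
        hence "b = a" using a R b unfolding zatom_def by blast
        thus False using R a b by auto
      qed
      thus ?thesis using a zatomD by (simp add: bad_def J_def)
    qed
    moreover obtain S where "set_mset S \<subseteq> J" "half_factorial_product (a + ord_sum S)"
      using good[of a] a zatomD by (auto simp: good_def J_def)
    ultimately obtain y0 where "near y0" using ex_near by blast
    then obtain y where y: "near y" and ymin: "\<And>x. near x \<Longrightarrow> size y \<le> size x"
      using ex_has_least_nat[of near y0 size] by blast
    then obtain g where yb: "bad y" and g: "g \<in> J" "half_factorial_product (y + replicate_mset (ord g) g)"
      by (auto simp: near_def)
    then obtain R where R: "\<forall>a\<in>#R. zatom Z a \<and> wt a = n" "\<Sum>\<^sub># R = y + replicate_mset (ord g) g"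
      by (auto simp: half_factorial_product_def)
    have key: "count y g + 1 \<le> count B g" if B: "B \<in># R" for B
    proof (rule ccontr)
      assume small_B: "\<not> count y g + 1 \<le> count B g"
      define W where "W = \<Sum>\<^sub># (R - {#B#})"
      have BW: "B + W = y + replicate_mset (ord g) g" using R(2) B by (metis W_def sum_mset.remove)
      hence "count B g + count W g = count y g + ord g" by (metis count_replicate_mset count_union)
      hence "ord g \<le> count W g" using small_B by linarith
      hence sub: "replicate_mset (ord g) g \<subseteq># W" using count_le_replicate_mset_subset_eq by metis
      define x where "x = W - replicate_mset (ord g) g"
      have xW: "x + replicate_mset (ord g) g = W" using sub by (simp add: x_def)
      hence yBx: "y = B + x" using BW by (metis add.assoc add_right_cancel)
      have hB: "half_factorial_product B" "Z B" "B \<noteq> {#}"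
        using R B by (auto intro: hfp_zatom zatomD simp: zatom_def)
      have "half_factorial_product W" unfolding half_factorial_product_def
        using R(1) by (intro exI[of _ "R - {#B#}"]) (auto simp: W_def dest: in_diffD)
      moreover have "bad x"
        using yb hfp_add[OF hB(1), of x] Z_cancel[OF hB(2), of x] yBx by (auto simp: bad_def)
      ultimately have "near x" using g xW by (auto simp: near_def)
      hence "size y \<le> size x" by (rule ymin)
      thus False using yBx hB(3) by simp
    qed
    have "count (\<Sum>\<^sub># M) g = (\<Sum>B\<in>#M. count B g)" for M by (induction M) auto
    hence "(\<Sum>B\<in>#R. count B g) = count y g + ord g" using R(2) by (metis count_replicate_mset count_union)
    moreover have "size R * (count y g + 1) \<le> (\<Sum>B\<in>#R. count B g)" using key by (rule size_le_sum_mset)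
    ultimately have le1: "size R * (count y g + 1) \<le> count y g + ord g" by simp
    have gs: "g \<in> supp" using g J by blast
    have "(\<Sum>a\<in>#R. wt a) = size R * n" using R(1) by (simp cong: image_mset_cong)
    hence "size R * n = wt y + n" using wt_sum_mset[of R] R(2) wt_ord[OF gs] by simp
    \<comment> \<open>Each of the at least \<open>d + 2\<close> factors contains \<open>g\<close> at
      least \<open>count y g + 1\<close> times. With \<open>c = count y g\<close> this reads
      \<open>(d + 1) * c + d + 2 \<le> ord g\<close>, and \<open>c \<ge> 1\<close> turns the left
      side into at least \<open>2 * d + 3\<close>.\<close>
    hence "(d + 2) * n \<le> size R * n" using badD(1)[OF yb] by (simp add: algebra_simps)
    hence "d + 2 \<le> size R" using n_pos by (metis mult_le_cancel2)
    hence "(d + 2) * (count y g + 1) \<le> count y g + ord g" using le1 by (meson le_trans mult_le_mono1)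
    moreover have "1 \<le> count y g" using badD(2)[OF yb] g(1) by (metis Suc_le_eq count_greater_zero_iff One_nat_def subsetD)
    then obtain c where "count y g = Suc c" by (metis One_nat_def Suc_le_D)
    ultimately have "2 * d + 3 \<le> ord g" by (auto simp: algebra_simps)
    thus ?thesis using ord_le_n[OF gs] by linarith
  qed
qed

lemma not_half_factorial:
  assumes "l \<in> zlengths Z A" "m \<in> zlengths Z A" "l \<noteq> m"
  shows "\<exists>a. zatom Z a \<and> wt a \<noteq> n"
proof (rule ccontr)
  assume "\<nexists>a. zatom Z a \<and> wt a \<noteq> n"
  hence "wt A = l * n" "wt A = m * n" using assms by (auto intro!: zlengths_wt_eq)
  thus False using assms n_pos by simp
qed

end

section \<open>Zero-sum monoids with prescribed minimal distance\<close>

lemma mset_subset_eqI_on: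
  "set_mset A \<subseteq> S \<Longrightarrow> (\<And>x. x \<in> S \<Longrightarrow> count A x \<le> count B x) \<Longrightarrow> A \<subseteq># B"
  by (intro mset_subset_eqI) (metis count_eq_zero_iff le0 subsetD)

lemma zatomI:
  assumes "Z A" "A \<noteq> {#}" "\<And>B. B \<subseteq># A \<Longrightarrow> Z B \<Longrightarrow> B \<noteq> {#} \<Longrightarrow> A \<subseteq># B"
  shows "zatom Z A"
  unfolding zatom_def using assms subset_mset.antisym by blast

lemma zatom_eqI: "zatom Z A \<Longrightarrow> B \<subseteq># A \<Longrightarrow> Z B \<Longrightarrow> B \<noteq> {#} \<Longrightarrow> A = B"
  unfolding zatom_def by blast

lemma dvd_small_imp_0: "(m::int) dvd x \<Longrightarrow> - m < x \<Longrightarrow> x < m \<Longrightarrow> x = 0"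
  using dvd_imp_le_int[of x m] by fastforce

lemma nat_dvd_le: "(m::nat) dvd x \<Longrightarrow> 0 < x \<Longrightarrow> x \<le> m \<Longrightarrow> x = m"
  by (simp add: dvd_imp_le le_antisym)

lemma zlengths_sum_set:
  "finite C \<Longrightarrow> (\<And>p. p \<in> C \<Longrightarrow> zatom Z (f p)) \<Longrightarrow> card C \<in> zlengths Z (\<Sum>p\<in>C. f p)"
proof (induction C rule: finite_induct)
  case (insert p C)
  have "1 + card C \<in> zlengths Z (f p + (\<Sum>p\<in>C. f p))"
    using insert by (intro zlengths_add zlengths_zatom) auto
  thus ?case using insert by simp
qed (simp add: zlengths_empty)

lemma subset_replicateD: "B \<subseteq># replicate_mset k p \<Longrightarrow> \<exists>j\<le>k. B = replicate_mset j p"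
  by (metis msubseteq_replicate_msetE)

context block_monoid begin

text \<open>\<open>Zc\<close> describes the relations of
  \<open>e_1, ..., e_{s-1}, - e_1 - ... - e_{s-1}\<close> for independent \<open>e_i\<close> of
  order \<open>m\<close>. The atoms are \<open>U\<close>, one copy of each letter, and
  \<open>m\<close> copies of one letter; \<open>m\<close> factors \<open>U\<close> equal
  \<open>s\<close> of the latter.\<close>

lemma least_distance_simplex:
  assumes Q: "finite Q" "card Q = s" "2 \<le> s" "s < m"
    and Zc: "\<And>A. Z A \<longleftrightarrow> set_mset A \<subseteq> Q \<and> (\<forall>p\<in>Q. \<forall>q\<in>Q. count A p mod m = count A q mod m)"
  shows "(LEAST d. d \<in> zdistances Z) = m - s" "zdistances Z \<noteq> {}"
proof -
  have other: "\<exists>q\<in>Q. q \<noteq> p" for p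
  proof (rule ccontr)
    assume "\<not> (\<exists>q\<in>Q. q \<noteq> p)"
    hence "card Q \<le> card {p}" by (intro card_mono) auto
    thus False using Q by simp
  qed
  have Zr: "Z (replicate_mset m p)" if "p \<in> Q" for p using that Zc by simp
  have at1: "zatom Z (replicate_mset m p)" if "p \<in> Q" for p
  proof (rule zatomI)
    show "Z (replicate_mset m p)" using Zr that .
    show "replicate_mset m p \<noteq> {#}" using Q by auto
    fix B assume B: "B \<subseteq># replicate_mset m p" "Z B" "B \<noteq> {#}"
    obtain j where j: "j \<le> m" "B = replicate_mset j p" using subset_replicateD[OF B(1)] by blast
    obtain q where "q \<in> Q" "q \<noteq> p" using other by blast
    hence "j mod m = 0" using B Zc[of B] that j by (metis count_replicate_mset mod_0)
    hence "j = m" using j B by (intro nat_dvd_le) (auto simp: dvd_eq_mod_eq_0)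
    thus "replicate_mset m p \<subseteq># B" using j by simp
  qed
  define U where "U = mset_set Q"
  have cU: "count U p = (if p \<in> Q then 1 else 0)" for p using Q by (simp add: U_def count_mset_set')
  have Qn: "Q \<noteq> {}" using Q by auto
  have ZU: "Z U" "U \<noteq> {#}" using Zc[of U] Q Qn by (auto simp: cU) (auto simp: U_def mset_set_empty_iff)
  have atU: "zatom Z U"
  proof (rule zatomI[of Z U, OF ZU])
    fix B assume B: "B \<subseteq># U" "Z B" "B \<noteq> {#}"
    have le: "count B p \<le> 1" if "p \<in> Q" for p using B(1) cU that by (metis mset_subset_eq_count)
    obtain p where p: "p \<in># B" using B by blast
    hence pQ: "p \<in> Q" using B Zc by blast
    hence "count B p = 1" using p le[OF pQ] by (simp add: le_antisym)
    hence "count B q mod m = 1 mod m" if "q \<in> Q" for q using B(2) Zc pQ that by metis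
    hence "count B q = 1" if "q \<in> Q" for q using le[OF that] that Q
      by (cases "count B q = 0") (force, linarith)
    thus "U \<subseteq># B" by (intro mset_subset_eqI) (simp add: cU)
  qed
  obtain p0 where p0: "p0 \<in> Q" using Qn by blast
  define T where "T = (\<Sum>p\<in>Q. replicate_mset m p)"
  have "T = repeat_mset m U" unfolding T_def using Q cU
    by (intro multiset_eqI) (simp add: count_sum_replicate)
  moreover have "m * 1 \<in> zlengths Z (repeat_mset m U)" by (intro zlengths_repeat zlengths_zatom atU)
  ultimately have l2: "s + (m - s) \<in> zlengths Z T" using Q by simp
  have l1: "s \<in> zlengths Z T" unfolding T_def using zlengths_sum_set[of Q Z] at1 Q by blast
  \<comment> \<open>The functional is \<open>m\<close> on \<open>U\<close> and on \<open>m\<close>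
    copies of a letter other than \<open>p0\<close>, and it is \<open>m + m * (m - s)\<close> on
    \<open>m\<close> copies of \<open>p0\<close>.\<close>
  have dv: "int (m * (m - s)) dvd (int (m - s) * int (count a p0) + int (size a)) - int m" if a: "zatom Z a" for a
  proof (cases "\<forall>p\<in>Q. p \<in># a")
    case True
    have "U \<subseteq># a" using True by (intro mset_subset_eqI) (auto simp: cU Suc_le_eq)
    hence "a = U" using zatom_eqI[OF a] ZU by blast
    moreover have "size U = s" using Q by (simp add: U_def)
    ultimately show ?thesis using cU[of p0] p0 Q by simp
  next
    case False
    then obtain q where q: "q \<in> Q" "count a q = 0" by (auto simp: not_in_iff)
    obtain p where p: "p \<in># a" using a by (auto simp: zatom_def)
    hence pQ: "p \<in> Q" using a zatomD Zc by blast
    have "count a p mod m = 0" using q pQ a zatomD Zc by (metis mod_0)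
    hence "m \<le> count a p" using p by (auto simp: dvd_eq_mod_eq_0[symmetric] intro: dvd_imp_le)
    hence "replicate_mset m p \<subseteq># a" by (simp add: count_le_replicate_mset_subset_eq)
    hence "a = replicate_mset m p" using zatom_eqI[OF a] Zr[OF pQ] Q by (metis count_replicate_mset count_empty not_less_zero)
    thus ?thesis by (cases "p = p0") (simp_all add: mult.commute)
  qed
  show "(LEAST d. d \<in> zdistances Z) = m - s" "zdistances Z \<noteq> {}"
    using least_distanceI[of "m - s" m s T "\<lambda>A. int (m - s) * int (count A p0) + int (size A)", OF _ _ l1 l2 _ _ dv]
      Q zlengths_Z[OF l1] by (auto simp: algebra_simps)
qed

text \<open>The letters of \<open>Q\<close> stand for independent \<open>e_i\<close> of order
  \<open>m\<close> and \<open>p0\<close> for their sum, up to sign conventions encoded in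
  \<open>Zc\<close>. Besides \<open>m\<close> copies of a letter the atoms are \<open>V j\<close>
  with \<open>0 < j < m\<close>, and \<open>V 1 + V (m - 1)\<close> is also the product of the
  \<open>s + 1\<close> atoms of the first kind.\<close>

lemma least_distance_star:
  assumes Q: "finite Q" "card Q = s" "2 \<le> s" "2 \<le> m" "p0 \<notin> Q"
    and Zc: "\<And>A. Z A \<longleftrightarrow> set_mset A \<subseteq> insert p0 Q \<and> (\<forall>p\<in>Q. m dvd count A p + count A p0)"
  shows "(LEAST d. d \<in> zdistances Z) = s - 1" "zdistances Z \<noteq> {}"
proof -
  have Zr: "Z (replicate_mset m p)" if "p \<in> insert p0 Q" for p
    using that Zc Q by (auto split: if_splits)
  have Qn: "Q \<noteq> {}" using Q by auto
  have at1: "zatom Z (replicate_mset m p)" if p: "p \<in> insert p0 Q" for p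
  proof (rule zatomI)
    show "Z (replicate_mset m p)" using Zr p .
    show "replicate_mset m p \<noteq> {#}" using Q by auto
    fix B assume B: "B \<subseteq># replicate_mset m p" "Z B" "B \<noteq> {#}"
    obtain j where j: "j \<le> m" "B = replicate_mset j p" using subset_replicateD[OF B(1)] by blast
    obtain q where q: "q \<in> Q" using Qn by blast
    have "m dvd j"
    proof (cases "p = p0")
      case True
      have "m dvd count B q + count B p0" using B q Zc by blast
      thus ?thesis using j True Q q by (auto split: if_splits)
    next
      case False
      hence "m dvd count B p + count B p0" using B p Zc by blast
      thus ?thesis using j False by auto
    qed
    hence "j = m" using j B by (intro nat_dvd_le) auto
    thus "replicate_mset m p \<subseteq># B" using j by simp
  qed
  define V where "V = (\<lambda>j. replicate_mset j p0 + (\<Sum>p\<in>Q. replicate_mset (m - j) p))"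
  have cV: "count (V j) p = (if p = p0 then j else if p \<in> Q then m - j else 0)" for p j
    using Q by (auto simp: V_def count_sum_replicate)
  have setV: "set_mset (V j) \<subseteq> insert p0 Q" for j
  proof
    fix x assume "x \<in># V j"
    hence "0 < count (V j) x" by simp
    thus "x \<in> insert p0 Q" by (simp add: cV split: if_splits)
  qed
  have ZV: "Z (V j)" if "j < m" for j
    unfolding Zc using setV Q that by (auto simp: cV)
  have Vn: "V j \<noteq> {#}" if "0 < j" for j using that cV[of j p0] by (metis count_empty less_irrefl)
  have atV: "zatom Z (V j)" if j: "0 < j" "j < m" for j
  proof (rule zatomI[of Z "V j", OF ZV[OF j(2)] Vn[OF j(1)]])
    fix B assume B: "B \<subseteq># V j" "Z B" "B \<noteq> {#}"
    have le: "count B p \<le> count (V j) p" for p using B(1) by (rule mset_subset_eq_count)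
    have b0: "count B p0 \<le> j" using le[of p0] by (simp add: cV)
    have bp: "count B p \<le> m - j" if "p \<in> Q" for p using le[of p] that Q by (auto simp: cV split: if_splits)
    have dvd: "m dvd count B p + count B p0" if "p \<in> Q" for p using B Zc that by blast
    have pos: "0 < count B p0"
    proof (rule ccontr)
      assume z: "\<not> 0 < count B p0"
      have "count B p = 0" if "p \<in> Q" for p
      proof (rule ccontr)
        assume "count B p \<noteq> 0"
        moreover have "count B p0 = 0" using z by linarith
        hence "m dvd count B p" using dvd[OF that] by (simp only: add.right_neutral)
        ultimately have "m \<le> count B p" by (intro dvd_imp_le) simp_all
        thus False using bp[OF that] j by linarith
      qed
      moreover obtain x where "x \<in># B" using B by blast
      ultimately show False using B(2) Zc z by (metis count_greater_zero_iff insertE less_irrefl subsetD)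
    qed
    have eq: "count B p + count B p0 = m" if "p \<in> Q" for p
      using dvd[OF that] pos bp[OF that] b0 j by (intro nat_dvd_le) auto
    obtain q where q: "q \<in> Q" using Qn by blast
    have e0: "count B p0 = j" using eq[OF q] bp[OF q] b0 j by linarith
    show "V j \<subseteq># B"
    proof (rule mset_subset_eqI_on[OF setV])
      fix x assume "x \<in> insert p0 Q"
      thus "count (V j) x \<le> count B x" using e0 eq[of x] Q by (auto simp: cV)
    qed
  qed
  have l2: "1 + 1 \<in> zlengths Z (V 1 + V (m - 1))"
    using Q by (intro zlengths_add zlengths_zatom atV) auto
  have "1 + s \<in> zlengths Z (replicate_mset m p0 + (\<Sum>p\<in>Q. replicate_mset m p))"
    using zlengths_sum_set[of Q Z "replicate_mset m"] at1 Q by (intro zlengths_add zlengths_zatom) auto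
  moreover have "replicate_mset m p0 + (\<Sum>p\<in>Q. replicate_mset m p) = V 1 + V (m - 1)"
  proof (rule multiset_eqI)
    fix x show "count (replicate_mset m p0 + (\<Sum>p\<in>Q. replicate_mset m p)) x = count (V 1 + V (m - 1)) x"
      using Q by (auto simp: cV count_sum_replicate)
  qed
  ultimately have l1: "1 + 1 + (s - 1) \<in> zlengths Z (V 1 + V (m - 1))" using Q by simp
  obtain p1 where p1: "p1 \<in> Q" using Qn by blast
  have p10: "p1 \<noteq> p0" using p1 Q by blast
  \<comment> \<open>The functional is \<open>m\<close> on every \<open>V j\<close> and on
    \<open>m\<close> copies of a letter other than \<open>p1\<close>; on \<open>m\<close> copies of
    \<open>p1\<close> it is \<open>m - m * (s - 1)\<close>.\<close>
  have dv: "int (m * (s - 1)) dvd (int (size a) - int (s - 1) * int (count a p1)) - int m" if a: "zatom Z a" for a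
  proof -
    have ded: "a = replicate_mset m p" if "p \<in> insert p0 Q" "m \<le> count a p" for p
    proof -
      have "replicate_mset m p \<subseteq># a" using that(2) by (simp add: count_le_replicate_mset_subset_eq)
      thus ?thesis using zatom_eqI[OF a _ Zr[OF that(1)]] Q by auto
    qed
    have rep: ?thesis if "a = replicate_mset m p" for p
      using that by (cases "p = p1") (simp_all add: mult.commute)
    have Za: "Z a" using a zatomD by blast
    consider "m \<le> count a p0" | "count a p0 = 0" | "0 < count a p0" "count a p0 < m" by linarith
    thus ?thesis
    proof cases
      case 1 thus ?thesis using ded[of p0] rep by blast
    next
      case 2
      obtain p where p: "p \<in># a" using a by (auto simp: zatom_def)
      hence pQ: "p \<in> Q" using Za Zc 2 by (metis insertE not_in_iff subsetD)
      hence "m dvd count a p + count a p0" using Za Zc by blast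
      hence "m dvd count a p" using 2 by simp
      hence "m \<le> count a p" using p by (intro dvd_imp_le) simp_all
      thus ?thesis using ded[of p] pQ rep by blast
    next
      case 3
      define j where "j = count a p0"
      have "V j \<subseteq># a"
      proof (rule mset_subset_eqI_on[OF setV])
        fix x assume x: "x \<in> insert p0 Q"
        show "count (V j) x \<le> count a x"
        proof (cases "x = p0")
          case False
          hence "m dvd count a x + j" using x Za Zc by (auto simp: j_def)
          moreover have "0 < count a x + j" using 3(1) unfolding j_def by linarith
          ultimately have "m \<le> count a x + j" by (rule dvd_imp_le)
          thus ?thesis using False x by (auto simp: cV)
        qed (simp add: cV j_def)
      qed
      hence aV: "a = V j" using zatom_eqI[OF a] ZV[of j] Vn[of j] 3 by (auto simp: j_def)
      have "size (V j) = j + s * (m - j)" using Q by (simp add: V_def)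
      moreover have "count (V j) p1 = m - j" using p1 p10 by (simp add: cV)
      moreover obtain e where "s = Suc e" using Q(3) by (metis Suc_le_D numeral_2_eq_2)
      moreover obtain k where "m = j + k" using 3 less_imp_add_positive unfolding j_def by blast
      ultimately have "int (size a) - int (s - 1) * int (count a p1) = int m"
        unfolding aV by (simp add: algebra_simps)
      thus ?thesis by simp
    qed
  qed
  show "(LEAST d. d \<in> zdistances Z) = s - 1" "zdistances Z \<noteq> {}"
    using least_distanceI[of "s - 1" m "1 + 1" "V 1 + V (m - 1)"
        "\<lambda>A. int (size A) - int (s - 1) * int (count A p1)", OF _ _ l2 l1 _ _ dv]
      Q zlengths_Z[OF l2] by (auto simp: algebra_simps)
qed

text \<open>The letters are \<open>g\<close> and \<open>-2 g\<close> with \<open>g\<close> of order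
  \<open>m\<close>. The \<open>d + 2\<close> atoms \<open>V 2 1\<close> have the same product as
  \<open>V m 0\<close> and \<open>V 1 (d + 2)\<close>; the only other atom is
  \<open>V 0 m\<close>.\<close>

lemma least_distance_odd:
  assumes "p \<noteq> q" "0 < d" "m = 2 * d + 3"
    and Zc: "\<And>A. Z A \<longleftrightarrow> set_mset A \<subseteq> {p, q} \<and> int m dvd int (count A p) - 2 * int (count A q)"
  shows "(LEAST d. d \<in> zdistances Z) = d" "zdistances Z \<noteq> {}"
proof -
  define V where "V = (\<lambda>x y. replicate_mset x p + replicate_mset y q)"
  have cV: "count (V x y) p = x" "count (V x y) q = y" for x y using assms(1) by (auto simp: V_def)
  have sV: "set_mset (V x y) \<subseteq> {p, q}" for x y by (auto simp: V_def)
  have ZV: "Z (V x y) \<longleftrightarrow> int m dvd int x - 2 * int y" for x y using Zc sV cV by simp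
  have Vle: "V x y \<subseteq># A \<longleftrightarrow> x \<le> count A p \<and> y \<le> count A q" for x y A
  proof
    assume "V x y \<subseteq># A"
    thus "x \<le> count A p \<and> y \<le> count A q"
      using mset_subset_eq_count[of "V x y" A p] mset_subset_eq_count[of "V x y" A q] cV by simp
  next
    assume "x \<le> count A p \<and> y \<le> count A q"
    thus "V x y \<subseteq># A" by (intro mset_subset_eqI_on[OF sV]) (auto simp: cV)
  qed
  have Vn: "V x y \<noteq> {#}" if "0 < x + y" for x y using that by (auto simp: V_def)
  have at: "zatom Z (V x y)" if "int m dvd int x - 2 * int y" "0 < x + y"
    and "\<And>b c. b \<le> x \<Longrightarrow> c \<le> y \<Longrightarrow> int m dvd int b - 2 * int c \<Longrightarrow> 0 < b + c \<Longrightarrow> x \<le> b \<and> y \<le> c" for x y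
  proof (rule zatomI[of Z "V x y"])
    show "Z (V x y)" "V x y \<noteq> {#}" using ZV Vn that by auto
    fix B assume B: "B \<subseteq># V x y" "Z B" "B \<noteq> {#}"
    obtain z where "z \<in># B" using B by blast
    moreover from this have "z \<in> {p, q}" using B(2) Zc by blast
    ultimately have "0 < count B p + count B q" by (auto simp: Suc_le_eq)
    moreover have "count B p \<le> x" "count B q \<le> y"
      using mset_subset_eq_count[OF B(1), of p] mset_subset_eq_count[OF B(1), of q] cV by auto
    moreover have "int m dvd int (count B p) - 2 * int (count B q)" using B(2) Zc by blast
    ultimately show "V x y \<subseteq># B" unfolding Vle by (intro that(3))
  qed
  have at20: "zatom Z (V m 0)"
  proof (rule at)
    show "0 < m + 0" using assms by simp
    fix b c :: nat assume bc: "b \<le> m" "c \<le> 0" "int m dvd int b - 2 * int c" "0 < b + c"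
    hence "m dvd b" "0 < b" by simp_all
    thus "m \<le> b \<and> 0 \<le> c" by (simp add: dvd_imp_le)
  qed simp
  have at21: "zatom Z (V 2 1)"
  proof (rule at)
    fix b c :: nat assume bc: "b \<le> 2" "c \<le> 1" "int m dvd int b - 2 * int c" "0 < b + c"
    have "int b - 2 * int c = 0" using bc assms by (intro dvd_small_imp_0[OF bc(3)]) auto
    thus "2 \<le> b \<and> 1 \<le> c" using bc(4) by presburger
  qed auto
  have at1: "zatom Z (V 1 (d + 2))"
  proof (rule at)
    have "int 1 - 2 * int (d + 2) = - int m" using assms by simp
    thus "int m dvd int 1 - 2 * int (d + 2)" by simp
    fix b c :: nat assume bc: "b \<le> 1" "c \<le> d + 2" "int m dvd int b - 2 * int c" "0 < b + c"
    have "\<not> (int b - 2 * int c = 0)" using bc(1,4) by presburger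
    hence "\<not> - int m < int b - 2 * int c" using bc assms dvd_small_imp_0[OF bc(3)] by force
    moreover have "int m dvd int b - 2 * int c + int m" using bc(3) by simp
    ultimately have "int b - 2 * int c + int m = 0" using bc(2) assms(3) by (intro dvd_small_imp_0[of "int m"]) auto
    thus "1 \<le> b \<and> d + 2 \<le> c" using bc(1,2) assms(3) by presburger
  qed auto
  have l1: "1 + 1 \<in> zlengths Z (V m 0 + V 1 (d + 2))" by (intro zlengths_add zlengths_zatom at20 at1)
  have "V m 0 + V 1 (d + 2) = repeat_mset (d + 2) (V 2 1)"
    using assms by (intro multiset_eqI) (auto simp: V_def)
  moreover have "(d + 2) * 1 \<in> zlengths Z (repeat_mset (d + 2) (V 2 1))" by (intro zlengths_repeat zlengths_zatom at21)
  ultimately have l2: "1 + 1 + d \<in> zlengths Z (V m 0 + V 1 (d + 2))" by (simp add: add.commute)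
  \<comment> \<open>The coefficients \<open>1\<close> and \<open>m - 2\<close> are the least
    positive residues of \<open>1\<close> and \<open>-2\<close> modulo \<open>m\<close>, so the
    functional is divisible by \<open>m\<close> on every relation. Its quotients by \<open>m\<close>
    on \<open>V m 0\<close>, \<open>V 2 1\<close>, \<open>V 1 (d + 2)\<close>, \<open>V 0 m\<close>
    are \<open>1\<close>, \<open>1\<close>, \<open>d + 1\<close>, \<open>2 * d + 1\<close>.\<close>
  have dv: "int (m * d) dvd int (count a p) + (int m - 2) * int (count a q) - int m" if a: "zatom Z a" for a
  proof -
    have Za: "set_mset a \<subseteq> {p, q}" "int m dvd int (count a p) - 2 * int (count a q)" using zatomD[OF a] Zc by simp_all
    have ded: "a = V x y" if "x \<le> count a p" "y \<le> count a q" "int m dvd int x - 2 * int y" "0 < x + y" for x y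
    proof (rule zatom_eqI[OF a])
      show "V x y \<subseteq># a" "Z (V x y)" "V x y \<noteq> {#}" using that Vle ZV Vn by simp_all
    qed
    obtain z where "z \<in># a" using a by (auto simp: zatom_def)
    moreover from this have "z \<in> {p, q}" using Za(1) by blast
    ultimately have pos: "0 < count a p + count a q" by (auto simp: Suc_le_eq)
    have f: ?thesis if "a = V x y" "int x + (int m - 2) * int y - int m = int (m * d) * k" for x y k
      using that cV by simp
    consider "count a q = 0" | "2 \<le> count a p" "1 \<le> count a q" | "count a p = 0" | "count a p = 1" "1 \<le> count a q" by linarith
    thus ?thesis
    proof cases
      case 1
      hence "m dvd count a p" "0 < count a p" using Za(2) pos by auto
      hence "a = V m 0" using ded[of m 0] assms by (auto dest: dvd_imp_le)
      thus ?thesis using f[of m 0 0] by simp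
    next
      case 2
      hence "a = V 2 1" using ded[of 2 1] by simp
      thus ?thesis using f[of 2 1 0] by simp
    next
      case 3
      have "int m dvd 2 * int (count a q)" using Za(2) 3 by simp
      hence "m dvd 2 * count a q" by (metis int_dvd_int_iff of_nat_mult of_nat_numeral)
      moreover have "coprime m 2" using assms by simp
      ultimately have "m dvd count a q" using coprime_dvd_mult_right_iff by blast
      moreover have "0 < count a q" using pos 3 by simp
      ultimately have "m \<le> count a q" by (rule dvd_imp_le)
      moreover have "int m dvd int 0 - 2 * int m" by simp
      ultimately have "a = V 0 m" using \<open>m = 2 * d + 3\<close> by (intro ded) linarith+
      moreover have "int 0 + (int m - 2) * int m - int m = int (m * d) * 2" using assms by (simp add: algebra_simps)
      ultimately show ?thesis by (rule f)
    next
      case 4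
      have "\<not> - int m < int (count a p) - 2 * int (count a q)"
      proof
        assume "- int m < int (count a p) - 2 * int (count a q)"
        hence "int (count a p) - 2 * int (count a q) = 0"
          using 4 assms(3) by (intro dvd_small_imp_0[OF Za(2)]) linarith+
        thus False using 4(1) by presburger
      qed
      hence "d + 2 \<le> count a q" using 4(1) assms(3) by linarith
      moreover have "int m dvd int 1 - 2 * int (d + 2)" using at1 zatomD ZV by blast
      ultimately have "a = V 1 (d + 2)" using 4 by (intro ded) auto
      moreover have "int 1 + (int m - 2) * int (d + 2) - int m = int (m * d) * 1" using assms by (simp add: algebra_simps)
      ultimately show ?thesis by (rule f)
    qed
  qed
  show "(LEAST d. d \<in> zdistances Z) = d" "zdistances Z \<noteq> {}"
    using least_distanceI[of d m "1 + 1" "V m 0 + V 1 (d + 2)"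
        "\<lambda>A. int (count A p) + (int m - 2) * int (count A q)", OF _ _ l1 l2 _ _ dv]
      assms zlengths_Z[OF l1] by (auto simp: algebra_simps)
qed

text \<open>The letters are \<open>g\<close>, \<open>- g\<close> and \<open>(m / 2) g\<close> with
  \<open>g\<close> of order \<open>m\<close>, and \<open>d + 1 = m / 2\<close>. The product of
  \<open>V (d + 1) 0 1\<close> and \<open>V 0 (d + 1) 1\<close> equals that of \<open>d + 1\<close>
  atoms \<open>V 1 1 0\<close> and one \<open>V 0 0 2\<close>.\<close>

lemma least_distance_even:
  assumes dist: "p \<noteq> q" "p \<noteq> t" "q \<noteq> t" and d: "0 < d" "m = 2 * d + 2"
    and Zc: "\<And>A. Z A \<longleftrightarrow> set_mset A \<subseteq> {p, q, t} \<and>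
      int m dvd int (count A p) - int (count A q) + int (d + 1) * int (count A t)"
  shows "(LEAST d. d \<in> zdistances Z) = d" "zdistances Z \<noteq> {}"
proof -
  define V where "V = (\<lambda>x y w. replicate_mset x p + replicate_mset y q + replicate_mset w t)"
  define h where "h = (\<lambda>x y w. int x - int y + int (d + 1) * int w)"
  have m0: "0 < m" using d by simp
  have Zh: "Z A \<longleftrightarrow> set_mset A \<subseteq> {p, q, t} \<and> int m dvd h (count A p) (count A q) (count A t)" for A
    unfolding Zc h_def ..
  have cV: "count (V x y w) p = x" "count (V x y w) q = y" "count (V x y w) t = w" for x y w
    using dist by (auto simp: V_def)
  have sV: "set_mset (V x y w) \<subseteq> {p, q, t}" for x y w by (auto simp: V_def)
  have ZV: "Z (V x y w) \<longleftrightarrow> int m dvd h x y w" for x y w using Zh sV cV by simp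
  have Vle: "V x y w \<subseteq># A \<longleftrightarrow> x \<le> count A p \<and> y \<le> count A q \<and> w \<le> count A t" for x y w A
  proof
    assume "V x y w \<subseteq># A"
    thus "x \<le> count A p \<and> y \<le> count A q \<and> w \<le> count A t"
      using mset_subset_eq_count[of "V x y w" A p] mset_subset_eq_count[of "V x y w" A q]
        mset_subset_eq_count[of "V x y w" A t] cV by simp
  next
    assume "x \<le> count A p \<and> y \<le> count A q \<and> w \<le> count A t"
    thus "V x y w \<subseteq># A" by (intro mset_subset_eqI_on[OF sV]) (auto simp: cV)
  qed
  have Vn: "V x y w \<noteq> {#}" if "0 < x + y + w" for x y w using that by (auto simp: V_def)
  have at: "zatom Z (V x y w)" if "int m dvd h x y w" "0 < x + y + w"
    and "\<And>b c e. b \<le> x \<Longrightarrow> c \<le> y \<Longrightarrow> e \<le> w \<Longrightarrow> int m dvd h b c e \<Longrightarrow> 0 < b + c + e \<Longrightarrow>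
      x \<le> b \<and> y \<le> c \<and> w \<le> e" for x y w
  proof (rule zatomI[of Z "V x y w"])
    show "Z (V x y w)" "V x y w \<noteq> {#}" using ZV Vn that by auto
    fix B assume B: "B \<subseteq># V x y w" "Z B" "B \<noteq> {#}"
    obtain z where "z \<in># B" using B by blast
    moreover from this have "z \<in> {p, q, t}" using B(2) Zh by blast
    ultimately have "0 < count B p + count B q + count B t" by auto
    moreover have "count B p \<le> x" "count B q \<le> y" "count B t \<le> w"
      using mset_subset_eq_count[OF B(1), of p] mset_subset_eq_count[OF B(1), of q]
        mset_subset_eq_count[OF B(1), of t] cV by auto
    moreover have "int m dvd h (count B p) (count B q) (count B t)" using B(2) Zh by blast
    ultimately show "V x y w \<subseteq># B" unfolding Vle by (intro that(3))
  qed
  have at110: "zatom Z (V 1 1 0)"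
  proof (rule at)
    fix b c e :: nat assume bc: "b \<le> 1" "c \<le> 1" "e \<le> 0" "int m dvd h b c e" "0 < b + c + e"
    have "h b c e = 0" using bc d by (intro dvd_small_imp_0[OF bc(4)]) (auto simp: h_def)
    thus "1 \<le> b \<and> 1 \<le> c \<and> 0 \<le> e" using bc by (auto simp: h_def)
  qed (auto simp: h_def)
  have at002: "zatom Z (V 0 0 2)"
  proof (rule at)
    show "int m dvd h 0 0 2" using d by (simp add: h_def mult.commute)
    fix b c e :: nat assume bc: "b \<le> 0" "c \<le> 0" "e \<le> 2" "int m dvd h b c e" "0 < b + c + e"
    have "e \<noteq> 1"
    proof
      assume "e = 1"
      hence "h b c e = 0" using bc d by (intro dvd_small_imp_0[OF bc(4)]) (auto simp: h_def)
      thus False using \<open>e = 1\<close> bc by (simp add: h_def)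
    qed
    thus "0 \<le> b \<and> 0 \<le> c \<and> 2 \<le> e" using bc by linarith
  qed auto
  have ha: "int m dvd h (d + 1) 0 1" "int m dvd h 0 (d + 1) 1" using d by (simp_all add: h_def mult.commute)
  have atp: "zatom Z (V (d + 1) 0 1)"
  proof (rule at)
    fix b c e :: nat assume bc: "b \<le> d + 1" "c \<le> 0" "e \<le> 1" "int m dvd h b c e" "0 < b + c + e"
    have hh: "h b c e = int (b + (d + 1) * e)" using bc by (simp add: h_def algebra_simps)
    have "0 < b + (d + 1) * e" using bc by auto
    hence "m \<le> b + (d + 1) * e" using bc(4) unfolding hh by (auto dest: dvd_imp_le simp: int_dvd_int_iff simp del: of_nat_add of_nat_mult)
    moreover have "e = 0 \<or> e = 1" using bc by linarith
    ultimately show "d + 1 \<le> b \<and> 0 \<le> c \<and> 1 \<le> e" using bc d by auto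
  qed (use ha in auto)
  have atq: "zatom Z (V 0 (d + 1) 1)"
  proof (rule at)
    fix b c e :: nat assume bc: "b \<le> 0" "c \<le> d + 1" "e \<le> 1" "int m dvd h b c e" "0 < b + c + e"
    have e: "e = 0 \<or> e = 1" using bc by linarith
    have "h b c e = 0" using bc d e by (intro dvd_small_imp_0[OF bc(4)]) (auto simp: h_def)
    thus "0 \<le> b \<and> d + 1 \<le> c \<and> 1 \<le> e" using bc e by (auto simp: h_def)
  qed (use ha in auto)
  define T where "T = V (d + 1) 0 1 + V 0 (d + 1) 1"
  have l1: "1 + 1 \<in> zlengths Z T" unfolding T_def by (intro zlengths_add zlengths_zatom atp atq)
  have "T = repeat_mset (d + 1) (V 1 1 0) + V 0 0 2"
    unfolding T_def by (intro multiset_eqI) (auto simp: V_def)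
  moreover have "(d + 1) * 1 + 1 \<in> zlengths Z (repeat_mset (d + 1) (V 1 1 0) + V 0 0 2)"
    by (intro zlengths_add zlengths_repeat zlengths_zatom at110 at002)
  ultimately have l2: "1 + 1 + d \<in> zlengths Z T" by (simp add: add.commute)
  \<comment> \<open>As for odd \<open>m\<close>, the coefficients \<open>1\<close>,
    \<open>m - 1\<close> and \<open>d + 1\<close> are the least positive residues of the three
    multiples of \<open>g\<close>.\<close>
  define f where "f = (\<lambda>x y w. int x + (int m - 1) * int y + int (d + 1) * int w)"
  have dv: "int (m * d) dvd f (count a p) (count a q) (count a t) - int m" if a: "zatom Z a" for a
  proof -
    have Za: "set_mset a \<subseteq> {p, q, t}" "int m dvd h (count a p) (count a q) (count a t)" using zatomD[OF a] Zh by simp_all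
    have ded: "a = V x y w" if "x \<le> count a p" "y \<le> count a q" "w \<le> count a t" "int m dvd h x y w" "0 < x + y + w" for x y w
    proof (rule zatom_eqI[OF a])
      show "V x y w \<subseteq># a" "Z (V x y w)" "V x y w \<noteq> {#}" using that Vle ZV Vn by simp_all
    qed
    obtain z where "z \<in># a" using a by (auto simp: zatom_def)
    moreover from this have "z \<in> {p, q, t}" using Za(1) by blast
    ultimately have pos: "0 < count a p + count a q + count a t" by auto
    have fV: ?thesis if "a = V x y w" "f x y w - int m = int (m * d) * k" for x y w k
      using that cV by simp
    consider (11) "1 \<le> count a p" "1 \<le> count a q" | (2) "2 \<le> count a t"
      | (p0) "count a q = 0" "count a t = 0" | (q0) "count a p = 0" "count a t = 0"
      | (p1) "count a q = 0" "count a t = 1" | (q1) "count a p = 0" "count a t = 1" by linarith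
    thus ?thesis
    proof cases
      case 11
      hence "a = V 1 1 0" by (intro ded) (auto simp: h_def)
      thus ?thesis using fV[of 1 1 0 0] by (simp add: f_def)
    next
      case 2
      hence "a = V 0 0 2" using d by (intro ded) (auto simp: h_def mult.commute)
      thus ?thesis using fV[of 0 0 2 0] d by (simp add: f_def)
    next
      case p0
      hence "m dvd count a p" "0 < count a p" using Za(2) pos by (auto simp: h_def)
      moreover have "int m dvd h m 0 0" by (simp add: h_def)
      ultimately have "a = V m 0 0" using m0 by (intro ded) (auto dest: dvd_imp_le)
      thus ?thesis using fV[of m 0 0 0] by (simp add: f_def)
    next
      case q0
      hence "m dvd count a q" "0 < count a q" using Za(2) pos by (auto simp: h_def)
      moreover have "int m dvd h 0 m 0" by (simp add: h_def)
      ultimately have "a = V 0 m 0" using m0 by (intro ded) (auto dest: dvd_imp_le)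
      thus ?thesis using fV[of 0 m 0 2] d by (simp add: f_def algebra_simps)
    next
      case p1
      have "h (count a p) (count a q) (count a t) = int (count a p + (d + 1))" using p1 by (simp add: h_def)
      hence "m dvd count a p + (d + 1)" using Za(2) by (simp only: int_dvd_int_iff)
      hence "m \<le> count a p + (d + 1)" by (rule dvd_imp_le) simp
      hence "a = V (d + 1) 0 1" using d p1 ha by (intro ded) auto
      thus ?thesis using fV[of "d + 1" 0 1 0] d by (simp add: f_def)
    next
      case q1
      have "d + 1 \<le> count a q"
      proof (rule ccontr)
        assume "\<not> d + 1 \<le> count a q"
        hence "h (count a p) (count a q) (count a t) = 0" using q1 d
          by (intro dvd_small_imp_0[OF Za(2)]) (auto simp: h_def)
        thus False using q1 \<open>\<not> d + 1 \<le> count a q\<close> by (simp add: h_def)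
      qed
      hence "a = V 0 (d + 1) 1" using d q1 ha by (intro ded) auto
      thus ?thesis using fV[of 0 "d + 1" 1 1] d by (simp add: f_def algebra_simps)
    qed
  qed
  show "(LEAST d. d \<in> zdistances Z) = d" "zdistances Z \<noteq> {}"
    using least_distanceI[of d m "1 + 1" T "\<lambda>A. f (count A p) (count A q) (count A t)", OF _ _ l1 l2 _ _ dv]
      d zlengths_Z[OF l1] by (auto simp: f_def algebra_simps)
qed

text \<open>The letters are \<open>g\<close>, \<open>- g\<close>, \<open>2 g\<close> and
  \<open>- 2 g\<close> with \<open>g\<close> of order \<open>m\<close>. Regrouping the two atoms
  \<open>{#s, q, q#}\<close> and \<open>{#t, p, p#}\<close> gives the three atoms
  \<open>{#s, t#}\<close>, \<open>{#p, q#}\<close>, \<open>{#p, q#}\<close>, and lengths that differ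
  by \<open>1\<close> settle the minimum.\<close>

lemma least_distance_one:
  assumes dist: "distinct [p, q, s, t]" and m: "5 \<le> m"
    and Zc: "\<And>A. Z A \<longleftrightarrow> set_mset A \<subseteq> {p, q, s, t} \<and>
      int m dvd int (count A p) - int (count A q) + 2 * int (count A s) - 2 * int (count A t)"
  shows "(LEAST d. d \<in> zdistances Z) = 1" "zdistances Z \<noteq> {}"
proof -
  have at: "zatom Z A" if A: "set_mset A \<subseteq> {p, q, s, t}" "A \<noteq> {#}"
      "int (count A p) - int (count A q) + 2 * int (count A s) - 2 * int (count A t) = 0"
      "int (count A p) + 2 * int (count A s) \<le> 2" "int (count A q) + 2 * int (count A t) \<le> 2"
      "count A p + count A s = 1 \<or> count A q + count A t = 1" for A
  proof (rule zatomI)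
    show "Z A" "A \<noteq> {#}" using A Zc by auto
    fix B assume B: "B \<subseteq># A" "Z B" "B \<noteq> {#}"
    have le: "count B x \<le> count A x" for x using B(1) by (rule mset_subset_eq_count)
    define h where "h = int (count B p) - int (count B q) + 2 * int (count B s) - 2 * int (count B t)"
    have hd: "int m dvd h" and Bs: "set_mset B \<subseteq> {p, q, s, t}" using B Zc by (auto simp: h_def)
    \<comment> \<open>Both sides of the relation are at most \<open>2 < m\<close>, so the congruence
      is an equation of integers. As one side of \<open>A\<close> is a single letter, a nonempty
      \<open>B\<close> has to contain it and then everything.\<close>
    have h0: "h = 0"
      using le[of p] le[of q] le[of s] le[of t] A(4,5) m
      by (intro dvd_small_imp_0[OF hd]) (auto simp: h_def)
    obtain z where "z \<in># B" using B by blast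
    moreover from this have "z \<in> {p, q, s, t}" using Bs by blast
    ultimately have pos: "0 < count B p + count B q + count B s + count B t" by auto
    show "A \<subseteq># B"
    proof (rule mset_subset_eqI_on[OF A(1)])
      fix x assume "x \<in> {p, q, s, t}"
      moreover have "count A p \<le> count B p \<and> count A q \<le> count B q \<and> count A s \<le> count B s \<and> count A t \<le> count B t"
        using A(6)
      proof
        assume one: "count A p + count A s = 1"
        hence "count B p + count B s \<noteq> 0" using h0 pos unfolding h_def by linarith
        hence "count B p = count A p" "count B s = count A s" using one le[of p] le[of s] by linarith+
        moreover from this have "count B q = count A q" "count B t = count A t"
          using h0 A(3) le[of q] le[of t] unfolding h_def by linarith+
        ultimately show ?thesis by simp
      next
        assume one: "count A q + count A t = 1"
        hence "count B q + count B t \<noteq> 0" using h0 pos unfolding h_def by linarith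
        hence "count B q = count A q" "count B t = count A t" using one le[of q] le[of t] by linarith+
        moreover from this have "count B p = count A p" "count B s = count A s"
          using h0 A(3) le[of p] le[of s] unfolding h_def by linarith+
        ultimately show ?thesis by simp
      qed
      ultimately show "count A x \<le> count B x" by auto
    qed
  qed
  have a1: "zatom Z {#s, q, q#}" "zatom Z {#t, p, p#}" "zatom Z {#s, t#}" "zatom Z {#p, q#}"
    using dist by (intro at; auto)+
  have l1: "1 + 1 \<in> zlengths Z ({#s, q, q#} + {#t, p, p#})" by (intro zlengths_add zlengths_zatom a1)
  have "1 + (1 + 1) \<in> zlengths Z ({#s, t#} + ({#p, q#} + {#p, q#}))" by (intro zlengths_add zlengths_zatom a1)
  moreover have "{#s, t#} + ({#p, q#} + {#p, q#}) = {#s, q, q#} + {#t, p, p#}" by simp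
  ultimately have l2: "1 + 1 + 1 \<in> zlengths Z ({#s, q, q#} + {#t, p, p#})" by (simp only: add.assoc)
  show "(LEAST d. d \<in> zdistances Z) = 1" "zdistances Z \<noteq> {}"
    using least_distanceI[of 1 1 "1 + 1" _ "\<lambda>_. 0", OF _ _ l1 l2] zlengths_Z[OF l1] by auto
qed

end

section \<open>Divisor-closed submonoids and sets of primes\<close>

lemma lookup_frag_of_mset: "Poly_Mapping.lookup (frag_of_mset A) p = int (count A p)"
  by (induction A) (auto simp: frag_of_mset_def lookup_add lookup_frag_of)

lemma inj_frag_of_mset: "frag_of_mset A = frag_of_mset B \<Longrightarrow> A = B"
  by (rule multiset_eqI) (metis lookup_frag_of_mset of_nat_eq_iff)

lemma frag_of_mset_simps [simp]:
  "frag_of_mset {#} = 0" "frag_of_mset (A + B) = frag_of_mset A + frag_of_mset B"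
  "frag_of_mset (add_mset p A) = frag_of p + frag_of_mset A"
  by (simp_all add: frag_of_mset_def)

lemma frag_of_mset_replicate [simp]: "frag_of_mset (replicate_mset k p) = frag_cmul (int k) (frag_of p)"
  by (induction k) (simp_all add: frag_cmul_distrib)

locale divisor_hom = comm_monoid_cancel H for H :: "('a, 'b) monoid_scheme" (structure) +
  fixes P :: "'p set" and \<phi> :: "'a \<Rightarrow> 'p multiset"
  assumes divisor_hom: "divisor_homomorphism H P \<phi>"
begin

text \<open>The classes of the primes in \<open>A\<close>, counted with multiplicity, sum to zero in
  the class group.\<close>

definition zero_class :: "'p set \<Rightarrow> 'p multiset \<Rightarrow> bool" where
  "zero_class Q A \<longleftrightarrow> set_mset A \<subseteq> Q \<and> frag_of_mset A \<in> principal_quotients H \<phi>"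

definition supported :: "'p set \<Rightarrow> 'a set" where
  "supported Q = {a \<in> carrier H. set_mset (\<phi> a) \<subseteq> Q}"

lemma phi_mult: "a \<in> carrier H \<Longrightarrow> b \<in> carrier H \<Longrightarrow> \<phi> (a \<otimes> b) = \<phi> a + \<phi> b"
  using divisor_hom by (auto simp: divisor_homomorphism_def hom_def free_comm_monoid_def)

lemma phi_one: "\<phi> \<one> = {#}"
  using divisor_hom by (auto simp: divisor_homomorphism_def free_comm_monoid_def)

lemma phi_closed: "a \<in> carrier H \<Longrightarrow> set_mset (\<phi> a) \<subseteq> P"
  using divisor_hom by (auto simp: divisor_homomorphism_def hom_def free_comm_monoid_def)

lemma divides_iff:
  assumes "a \<in> carrier H" "b \<in> carrier H"
  shows "a divides b \<longleftrightarrow> \<phi> a \<subseteq># \<phi> b"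
proof -
  have "a divides b \<longleftrightarrow> \<phi> a divides\<^bsub>free_comm_monoid P\<^esub> \<phi> b"
    using divisor_hom assms by (auto simp: divisor_homomorphism_def)
  also have "\<dots> \<longleftrightarrow> \<phi> a \<subseteq># \<phi> b"
  proof
    assume "\<phi> a \<subseteq># \<phi> b"
    then obtain C where C: "\<phi> b = \<phi> a + C" by (metis subset_mset.le_iff_add)
    moreover have "set_mset C \<subseteq> P" using phi_closed[OF assms(2)] C by simp
    ultimately show "\<phi> a divides\<^bsub>free_comm_monoid P\<^esub> \<phi> b" by (auto simp: factor_def free_comm_monoid_def)
  qed (auto simp: factor_def free_comm_monoid_def)
  finally show ?thesis .
qed

text \<open>From \<open>A + \<phi> b = \<phi> a\<close> the divisor homomorphism reflects
  divisibility, so \<open>b\<close> divides \<open>a\<close>, and the quotient maps to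
  \<open>A\<close>.\<close>

lemma zero_class_imp_phi:
  assumes "zero_class P A"
  obtains a where "a \<in> carrier H" "\<phi> a = A"
proof -
  obtain a b where ab: "a \<in> carrier H" "b \<in> carrier H" "frag_of_mset A = frag_of_mset (\<phi> a) - frag_of_mset (\<phi> b)"
    using assms by (auto simp: zero_class_def principal_quotients_def)
  hence "frag_of_mset (A + \<phi> b) = frag_of_mset (\<phi> a)" by simp
  hence eq: "A + \<phi> b = \<phi> a" by (rule inj_frag_of_mset)
  hence "b divides a" using divides_iff[OF ab(2,1)] by (metis mset_subset_eq_add_right)
  then obtain c where c: "c \<in> carrier H" "a = b \<otimes> c" by (auto simp: factor_def)
  hence "\<phi> c = A" using eq ab phi_mult by (metis add.commute add_left_cancel)
  thus ?thesis using that c by blast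
qed

lemma zero_class_phi: "a \<in> supported Q \<Longrightarrow> zero_class Q (\<phi> a)"
proof -
  assume a: "a \<in> supported Q"
  have "frag_of_mset (\<phi> a) = frag_of_mset (\<phi> a) - frag_of_mset (\<phi> \<one>)" by (simp add: phi_one)
  thus ?thesis using a unfolding zero_class_def supported_def principal_quotients_def by blast
qed

lemma zero_classE:
  assumes "zero_class Q A" "Q \<subseteq> P"
  obtains a where "a \<in> supported Q" "\<phi> a = A"
proof -
  have "zero_class P A" using assms by (auto simp: zero_class_def)
  then obtain a where "a \<in> carrier H" "\<phi> a = A" by (rule zero_class_imp_phi)
  thus ?thesis using that assms by (auto simp: supported_def zero_class_def)
qed

lemma phi_eq:
  assumes "a \<in> carrier H" "b \<in> carrier H" "\<phi> a = \<phi> b"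
  obtains u where "u \<in> carrier H" "\<phi> u = {#}" "a = b \<otimes> u"
proof -
  have "b divides a" using divides_iff[OF assms(2,1)] assms(3) by simp
  then obtain u where u: "u \<in> carrier H" "a = b \<otimes> u" by (auto simp: factor_def)
  moreover have "\<phi> u = {#}" using phi_mult[OF assms(2) u(1)] u assms by simp
  ultimately show ?thesis using that by blast
qed

lemma Units_supported: "Units (H\<lparr>carrier := supported Q\<rparr>) = {a \<in> carrier H. \<phi> a = {#}}"
proof (intro equalityI subsetI)
  fix a assume "a \<in> Units (H\<lparr>carrier := supported Q\<rparr>)"
  then obtain y where "a \<in> carrier H" "y \<in> carrier H" "a \<otimes> y = \<one>" by (auto simp: Units_def supported_def)
  thus "a \<in> {a \<in> carrier H. \<phi> a = {#}}" using phi_mult[of a y] phi_one by simp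
next
  fix a assume a: "a \<in> {a \<in> carrier H. \<phi> a = {#}}"
  hence "a divides \<one>" using divides_iff[of a \<one>] phi_one by simp
  then obtain c where c: "c \<in> carrier H" "\<one> = a \<otimes> c" by (auto simp: factor_def)
  hence "\<phi> c = {#}" using phi_mult[of a c] a phi_one by simp
  thus "a \<in> Units (H\<lparr>carrier := supported Q\<rparr>)"
    using a c m_comm[of a c] by (auto simp: Units_def supported_def intro!: bexI[of _ c])
qed

lemma atom_supported:
  assumes "Q \<subseteq> P"
  shows "atom (H\<lparr>carrier := supported Q\<rparr>) u \<longleftrightarrow> u \<in> supported Q \<and> zatom (zero_class Q) (\<phi> u)"
proof (intro iffI conjI)
  assume at: "atom (H\<lparr>carrier := supported Q\<rparr>) u"
  show u: "u \<in> supported Q" using at by (auto simp: atom_def)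
  have uc: "u \<in> carrier H" using u by (simp add: supported_def)
  have un: "\<phi> u \<noteq> {#}" using at uc by (auto simp: atom_def Units_supported)
  show "zatom (zero_class Q) (\<phi> u)"
    unfolding zatom_def
  proof (intro conjI allI impI un)
    show "zero_class Q (\<phi> u)" by (rule zero_class_phi[OF u])
    fix B assume B: "B \<subseteq># \<phi> u" "zero_class Q B"
    show "B = {#} \<or> B = \<phi> u"
    proof (rule ccontr)
      assume nB: "\<not> (B = {#} \<or> B = \<phi> u)"
      obtain b where b: "b \<in> supported Q" "\<phi> b = B" using zero_classE[OF B(2) assms] .
      have bc: "b \<in> carrier H" using b by (simp add: supported_def)
      hence "b divides u" using divides_iff[OF bc uc] b B by simp
      then obtain c where c: "c \<in> carrier H" "u = b \<otimes> c" by (auto simp: factor_def)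
      hence pc: "\<phi> u = B + \<phi> c" using phi_mult[OF bc c(1)] b by simp
      hence "c \<in> supported Q" using c u by (auto simp: supported_def)
      moreover have "\<phi> c \<noteq> {#}" using pc nB by auto
      ultimately show False using at b bc c nB by (auto simp: atom_def Units_supported)
    qed
  qed
next
  assume u: "u \<in> supported Q \<and> zatom (zero_class Q) (\<phi> u)"
  show "atom (H\<lparr>carrier := supported Q\<rparr>) u"
    unfolding atom_def
  proof (intro conjI notI)
    show "u \<in> carrier (H\<lparr>carrier := supported Q\<rparr>) - Units (H\<lparr>carrier := supported Q\<rparr>)"
      using u by (auto simp: Units_supported zatom_def)
    assume "\<exists>b\<in>carrier (H\<lparr>carrier := supported Q\<rparr>) - Units (H\<lparr>carrier := supported Q\<rparr>).
      \<exists>c\<in>carrier (H\<lparr>carrier := supported Q\<rparr>) - Units (H\<lparr>carrier := supported Q\<rparr>).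
        u = b \<otimes>\<^bsub>H\<lparr>carrier := supported Q\<rparr>\<^esub> c"
    then obtain b c where bc: "b \<in> supported Q" "c \<in> supported Q" "u = b \<otimes> c" "\<phi> b \<noteq> {#}" "\<phi> c \<noteq> {#}"
      unfolding Units_supported by (auto simp: supported_def)
    hence "\<phi> u = \<phi> b + \<phi> c" using phi_mult by (simp add: supported_def)
    moreover from this have "\<phi> b = \<phi> u" using zatom_eqI[of "zero_class Q" "\<phi> u" "\<phi> b"] u bc zero_class_phi by simp
    ultimately show False using bc by simp
  qed
qed

lemma foldr_closed: "set us \<subseteq> carrier H \<Longrightarrow> foldr (\<otimes>) us \<one> \<in> carrier H"
  by (induction us) auto

lemma phi_foldr: "set us \<subseteq> carrier H \<Longrightarrow> \<phi> (foldr (\<otimes>) us \<one>) = \<Sum>\<^sub># (mset (map \<phi> us))"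
  by (induction us) (auto simp: phi_one phi_mult foldr_closed)

lemma lengths_supported:
  assumes Q: "Q \<subseteq> P" and a: "a \<in> supported Q"
  shows "lengths (H\<lparr>carrier := supported Q\<rparr>) a = zlengths (zero_class Q) (\<phi> a)"
proof (cases "\<phi> a = {#}")
  case True
  have "M = {#}" if "\<forall>a\<in>#M. zatom (zero_class Q) a" "\<Sum>\<^sub># M = {#}" for M
    using that by (cases M) (auto simp: zatom_def)
  hence "zlengths (zero_class Q) (\<phi> a) = {0}"
    using zlengths_empty[of "zero_class Q"] True by (force simp: zlengths_def)
  moreover have "a \<in> Units (H\<lparr>carrier := supported Q\<rparr>)"
    unfolding Units_supported using True a by (simp add: supported_def)
  ultimately show ?thesis by (simp add: lengths_def)
next
  case False
  have ac: "a \<in> carrier H" using a by (simp add: supported_def)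
  have len: "lengths (H\<lparr>carrier := supported Q\<rparr>) a =
    {l. 1 \<le> l \<and> (\<exists>us. length us = l \<and> (\<forall>u\<in>set us. u \<in> supported Q \<and> zatom (zero_class Q) (\<phi> u)) \<and>
      foldr (\<otimes>) us \<one> = a)}"
    using False by (simp add: lengths_def Units_supported atom_supported[OF Q])
  show ?thesis
    unfolding len
  proof (intro equalityI subsetI)
    fix l assume "l \<in> {l. 1 \<le> l \<and> (\<exists>us. length us = l \<and> (\<forall>u\<in>set us. u \<in> supported Q \<and> zatom (zero_class Q) (\<phi> u)) \<and>
      foldr (\<otimes>) us \<one> = a)}"
    then obtain us where us: "length us = l" "\<forall>u\<in>set us. u \<in> supported Q \<and> zatom (zero_class Q) (\<phi> u)"
      "foldr (\<otimes>) us \<one> = a" by blast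
    have "set us \<subseteq> carrier H" using us by (auto simp: supported_def)
    hence "\<Sum>\<^sub># (mset (map \<phi> us)) = \<phi> a" using phi_foldr us by metis
    thus "l \<in> zlengths (zero_class Q) (\<phi> a)" unfolding zlengths_def using us
      by (intro CollectI exI[of _ "mset (map \<phi> us)"]) auto
  next
    fix l assume "l \<in> zlengths (zero_class Q) (\<phi> a)"
    then obtain M where M: "\<forall>b\<in>#M. zatom (zero_class Q) b" "\<Sum>\<^sub># M = \<phi> a" "size M = l" by (rule zlengthsE)
    obtain ms where ms: "mset ms = M" using ex_mset by blast
    have "\<forall>m\<in>set ms. \<exists>g. g \<in> supported Q \<and> \<phi> g = m"
    proof
      fix m assume "m \<in> set ms"
      hence "zero_class Q m" using M ms by (auto simp: zatom_def)
      then obtain g where "g \<in> supported Q" "\<phi> g = m" by (rule zero_classE[OF _ Q])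
      thus "\<exists>g. g \<in> supported Q \<and> \<phi> g = m" by blast
    qed
    then obtain g where g: "\<forall>m\<in>set ms. g m \<in> supported Q \<and> \<phi> (g m) = m" by (rule bchoice[THEN exE])
    define us where "us = map g ms"
    have usc: "set us \<subseteq> carrier H" using g by (auto simp: us_def supported_def)
    have "map \<phi> us = ms" using g by (auto simp: us_def intro: map_idI)
    hence "\<phi> (foldr (\<otimes>) us \<one>) = \<phi> a" using phi_foldr[OF usc] M ms by simp
    \<comment> \<open>The lifted atoms multiply to \<open>a\<close> only up to a unit
      \<open>e\<close>; the unit is absorbed into the first factor, which exists as
      \<open>\<phi> a\<close> is nonempty.\<close>
    then obtain e where e: "e \<in> carrier H" "\<phi> e = {#}" "a = foldr (\<otimes>) us \<one> \<otimes> e"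
      using phi_eq[OF ac foldr_closed[OF usc]] by metis
    have "M \<noteq> {#}" using M False by auto
    then obtain v vs where us: "us = v # vs" using ms by (cases us) (auto simp: us_def)
    define ws where "ws = (v \<otimes> e) # vs"
    have vc: "v \<in> carrier H" "set vs \<subseteq> carrier H" using usc us by auto
    have "foldr (\<otimes>) ws \<one> = a"
      using e vc foldr_closed[OF vc(2)] by (simp add: ws_def us m_ac)
    moreover have "length ws = l" using M(3) ms us by (metis length_Cons length_map size_mset us_def ws_def)
    moreover have "\<forall>u\<in>set ws. u \<in> supported Q \<and> zatom (zero_class Q) (\<phi> u)"
    proof -
      have usat: "\<forall>u\<in>set us. u \<in> supported Q \<and> zatom (zero_class Q) (\<phi> u)"
        using g M(1) ms by (auto simp: us_def)
      have "\<phi> (v \<otimes> e) = \<phi> v" using vc e phi_mult by simp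
      thus ?thesis using usat vc e by (auto simp: ws_def us supported_def)
    qed
    moreover have "1 \<le> l" using M(3) \<open>M \<noteq> {#}\<close> by (simp add: Suc_le_eq nonempty_has_size[symmetric] flip: M(3))
    ultimately show "l \<in> {l. 1 \<le> l \<and> (\<exists>us. length us = l \<and> (\<forall>u\<in>set us. u \<in> supported Q \<and> zatom (zero_class Q) (\<phi> u)) \<and>
      foldr (\<otimes>) us \<one> = a)}" by blast
  qed
qed

lemma distances_supported:
  assumes Q: "Q \<subseteq> P"
  shows "distances (H\<lparr>carrier := supported Q\<rparr>) = zdistances (zero_class Q)"
proof -
  have "{lengths (H\<lparr>carrier := supported Q\<rparr>) a | a. a \<in> supported Q} = {zlengths (zero_class Q) A | A. zero_class Q A}"
    (is "?L = ?R")
  proof (intro equalityI subsetI)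
    fix x assume "x \<in> ?L"
    thus "x \<in> ?R" using lengths_supported[OF Q] zero_class_phi by auto
  next
    fix x assume "x \<in> ?R"
    then obtain A where A: "zero_class Q A" "x = zlengths (zero_class Q) A" by blast
    obtain a where "a \<in> supported Q" "\<phi> a = A" using zero_classE[OF A(1) Q] .
    thus "x \<in> ?L" using lengths_supported[OF Q] A by blast
  qed
  hence "\<Union> (distances_of_set ` ?L) = \<Union> (distances_of_set ` ?R)" by simp
  thus ?thesis unfolding distances_def zdistances_def by (simp add: setcompr_eq_image image_image)
qed

lemma divisor_closed_supported: "divisor_closed_submonoid (supported Q) H"
  unfolding divisor_closed_submonoid_def
proof (intro conjI ballI impI)
  show "submonoid (supported Q) H"
    by unfold_locales (auto simp: supported_def phi_one phi_mult)
  fix a b assume "a \<in> supported Q" "b \<in> carrier H" "b divides a"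
  moreover from this have "\<phi> b \<subseteq># \<phi> a" using divides_iff by (auto simp: supported_def)
  ultimately show "b \<in> supported Q" using set_mset_mono by (fastforce simp: supported_def)
qed

text \<open>Every multiset of primes that occur in \<open>S\<close> divides \<open>\<phi> b\<close>
  for a product \<open>b\<close> of elements of \<open>S\<close>, and \<open>S\<close> is closed
  under divisors.\<close>

lemma divisor_closed_eq_supported:
  assumes S: "divisor_closed_submonoid S H"
  shows "S = supported (\<Union>a\<in>S. set_mset (\<phi> a))"
proof (intro equalityI subsetI)
  interpret S: submonoid S H using S by (simp add: divisor_closed_submonoid_def)
  show "a \<in> supported (\<Union>a\<in>S. set_mset (\<phi> a))" if "a \<in> S" for a
    using that S.subset by (auto simp: supported_def)
  fix a assume a: "a \<in> supported (\<Union>a\<in>S. set_mset (\<phi> a))"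
  have "\<exists>b\<in>S. A \<subseteq># \<phi> b" if "set_mset A \<subseteq> (\<Union>a\<in>S. set_mset (\<phi> a))" for A
    using that
  proof (induction A)
    case empty show ?case by (rule bexI[OF _ S.one_closed]) simp
  next
    case (add p A)
    then obtain b c where bc: "b \<in> S" "A \<subseteq># \<phi> b" "c \<in> S" "p \<in># \<phi> c" by auto
    have "{#p#} + A \<subseteq># \<phi> c + \<phi> b" using bc by (intro subset_mset.add_mono) auto
    moreover have "\<phi> (c \<otimes> b) = \<phi> c + \<phi> b" using bc S.subset phi_mult by blast
    ultimately show ?case using bc S.m_closed by (intro bexI[of _ "c \<otimes> b"]) auto
  qed
  moreover have ac: "a \<in> carrier H" "set_mset (\<phi> a) \<subseteq> (\<Union>a\<in>S. set_mset (\<phi> a))"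
    using a unfolding supported_def by blast+
  ultimately obtain b where b: "b \<in> S" "\<phi> a \<subseteq># \<phi> b" by blast
  hence "a divides b" using ac divides_iff[of a b] S.subset by blast
  thus "a \<in> S" using S ac b unfolding divisor_closed_submonoid_def by blast
qed

lemma minimal_distances_eq:
  "minimal_distances H =
    {int (LEAST d. d \<in> zdistances (zero_class Q)) | Q. Q \<subseteq> P \<and> zdistances (zero_class Q) \<noteq> {}}"
proof (intro equalityI subsetI)
  fix x assume "x \<in> minimal_distances H"
  then obtain S where S: "divisor_closed_submonoid S H" "distances (H\<lparr>carrier := S\<rparr>) \<noteq> {}"
    "x = int (LEAST d. d \<in> distances (H\<lparr>carrier := S\<rparr>))" by (auto simp: minimal_distances_def)
  define Q where "Q = (\<Union>a\<in>S. set_mset (\<phi> a))"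
  have "S \<subseteq> carrier H" using S(1) by (simp add: divisor_closed_submonoid_def submonoid.subset)
  hence Q: "Q \<subseteq> P" using phi_closed by (auto simp: Q_def)
  have "distances (H\<lparr>carrier := S\<rparr>) = zdistances (zero_class Q)"
    using distances_supported[OF Q] divisor_closed_eq_supported[OF S(1)] by (simp add: Q_def)
  thus "x \<in> {int (LEAST d. d \<in> zdistances (zero_class Q)) | Q. Q \<subseteq> P \<and> zdistances (zero_class Q) \<noteq> {}}"
    using S Q by auto
next
  fix x assume "x \<in> {int (LEAST d. d \<in> zdistances (zero_class Q)) | Q. Q \<subseteq> P \<and> zdistances (zero_class Q) \<noteq> {}}"
  then obtain Q where "Q \<subseteq> P" "zdistances (zero_class Q) \<noteq> {}" "x = int (LEAST d. d \<in> zdistances (zero_class Q))" by blast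
  thus "x \<in> minimal_distances H" unfolding minimal_distances_def
    using distances_supported[of Q] divisor_closed_supported[of Q] by (intro CollectI exI[of _ "supported Q"]) auto
qed

lemma principal_quotients_zero: "0 \<in> principal_quotients H \<phi>"
  unfolding principal_quotients_def by (intro CollectI exI[of _ \<one>]) auto

lemma principal_quotients_diff:
  assumes "x \<in> principal_quotients H \<phi>" "y \<in> principal_quotients H \<phi>"
  shows "x - y \<in> principal_quotients H \<phi>"
proof -
  obtain a b c e where "a \<in> carrier H" "b \<in> carrier H" "x = frag_of_mset (\<phi> a) - frag_of_mset (\<phi> b)"
    "c \<in> carrier H" "e \<in> carrier H" "y = frag_of_mset (\<phi> c) - frag_of_mset (\<phi> e)"
    using assms by (auto simp: principal_quotients_def)
  thus ?thesis unfolding principal_quotients_def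
    by (intro CollectI exI[of _ "a \<otimes> e"] exI[of _ "b \<otimes> c"]) (auto simp: phi_mult)
qed

lemma principal_quotients_keys: "x \<in> principal_quotients H \<phi> \<Longrightarrow> Poly_Mapping.keys x \<subseteq> P"
proof
  fix p assume x: "x \<in> principal_quotients H \<phi>" and p: "p \<in> Poly_Mapping.keys x"
  obtain a b where "a \<in> carrier H" "b \<in> carrier H" "x = frag_of_mset (\<phi> a) - frag_of_mset (\<phi> b)"
    using x by (auto simp: principal_quotients_def)
  moreover from this have "count (\<phi> a) p \<noteq> count (\<phi> b) p"
    using p by (auto simp: in_keys_iff lookup_minus lookup_frag_of_mset)
  hence "p \<in># \<phi> a \<or> p \<in># \<phi> b" by (metis not_in_iff)
  ultimately show "p \<in> P" using phi_closed by blast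
qed

lemma block_monoid_zero_class:
  assumes "0 < n" "\<And>p. p \<in> P \<Longrightarrow> frag_cmul (int n) (frag_of p) \<in> principal_quotients H \<phi>" "Q \<subseteq> P"
  shows "block_monoid (zero_class Q) n"
proof
  have neg: "- y \<in> principal_quotients H \<phi>" if "y \<in> principal_quotients H \<phi>" for y
    using principal_quotients_diff[OF principal_quotients_zero that] by simp
  show "zero_class Q {#}" by (simp add: zero_class_def principal_quotients_zero)
  show "zero_class Q (A + B)" if "zero_class Q A" "zero_class Q B" for A B
    using that principal_quotients_diff[OF _ neg, of "frag_of_mset A" "frag_of_mset B"] by (simp add: zero_class_def)
  show "zero_class Q B" if "zero_class Q A" "zero_class Q (A + B)" for A B
    using that principal_quotients_diff[of "frag_of_mset (A + B)" "frag_of_mset A"] by (simp add: zero_class_def)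
  show "0 < n" by fact
  show "zero_class Q (replicate_mset n p)" if "zero_class Q A" "p \<in># A" for A p
    using that assms by (auto simp: zero_class_def)
qed

end

section \<open>Finite abelian groups as quotients of lattices\<close>

interpretation frag: Modules.module "frag_cmul :: int \<Rightarrow> ('p \<Rightarrow>\<^sub>0 int) \<Rightarrow> _"
  by unfold_locales (auto simp: frag_cmul_distrib frag_cmul_distrib2)

text \<open>Gaussian elimination with cross-multiplication instead of division, so that the
  coefficients stay integral.\<close>

lemma ex_linear_relation:
  fixes m :: "'e \<Rightarrow> nat \<Rightarrow> int"
  shows "finite E \<Longrightarrow> r < card E \<Longrightarrow> \<exists>a. (\<exists>e\<in>E. a e \<noteq> 0) \<and> (\<forall>i<r. (\<Sum>e\<in>E. a e * m e i) = 0)"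
proof (induction r arbitrary: E m)
  case 0
  hence "E \<noteq> {}" by auto
  thus ?case by (intro exI[of _ "\<lambda>_. 1"]) auto
next
  case (Suc r)
  show ?case
  proof (cases "\<forall>e\<in>E. m e r = 0")
    case True
    obtain a where "\<exists>e\<in>E. a e \<noteq> 0" "\<forall>i<r. (\<Sum>e\<in>E. a e * m e i) = 0"
      using Suc.IH[of E m] Suc.prems by auto
    moreover have "(\<Sum>e\<in>E. a e * m e r) = 0" using True by (intro sum.neutral) auto
    ultimately show ?thesis by (intro exI[of _ a]) (auto simp: less_Suc_eq)
  next
    case False
    then obtain f where f: "f \<in> E" "m f r \<noteq> 0" by blast
    define E' where "E' = E - {f}"
    have E': "finite E'" "r < card E'" "E = insert f E'" "f \<notin> E'" using Suc.prems f by (auto simp: E'_def)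
    obtain a where a: "\<exists>e\<in>E'. a e \<noteq> 0"
      and rel: "\<And>i. i < r \<Longrightarrow> (\<Sum>e\<in>E'. a e * (m e i * m f r - m e r * m f i)) = 0"
      using Suc.IH[of E' "\<lambda>e i. m e i * m f r - m e r * m f i"] E' by auto
    define s where "s = (\<Sum>e\<in>E'. a e * m e r)"
    \<comment> \<open>The coefficient of the pivot \<open>f\<close> is chosen to kill equation
      \<open>r\<close>; the others are scaled by the pivot entry \<open>m f r\<close>.\<close>
    define b where "b = (\<lambda>e. if e = f then - s else a e * m f r)"
    have sum_b: "(\<Sum>e\<in>E. b e * m e i) = (\<Sum>e\<in>E'. a e * (m e i * m f r - m e r * m f i))" for i
    proof -
      have "(\<Sum>e\<in>E. b e * m e i) = - s * m f i + (\<Sum>e\<in>E'. b e * m e i)"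
        using E' by (simp add: b_def)
      also have "(\<Sum>e\<in>E'. b e * m e i) = (\<Sum>e\<in>E'. a e * m e i * m f r)"
        using E' by (intro sum.cong) (auto simp: b_def)
      also have "- s * m f i = - (\<Sum>e\<in>E'. a e * m e r * m f i)" by (simp add: s_def sum_distrib_right)
      finally show ?thesis by (simp add: algebra_simps sum_subtractf)
    qed
    have "(\<Sum>e\<in>E. b e * m e r) = 0" unfolding sum_b by simp
    hence "\<forall>i<Suc r. (\<Sum>e\<in>E. b e * m e i) = 0" using rel sum_b by (auto simp: less_Suc_eq)
    moreover have "\<exists>e\<in>E. b e \<noteq> 0" using a f E' by (auto simp: b_def)
    ultimately show ?thesis by blast
  qed
qed

text \<open>Dividing an integer relation by the gcd of its coefficients leaves coefficients without
  a common non-unit factor.\<close>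

lemma ex_relation_not_dvd:
  fixes m :: "'e \<Rightarrow> nat \<Rightarrow> int"
  assumes "finite E" "r < card E" "q \<noteq> 0" "\<not> is_unit q"
  shows "\<exists>a. (\<exists>e\<in>E. \<not> q dvd a e) \<and> (\<forall>i<r. (\<Sum>e\<in>E. a e * m e i) = 0)"
proof -
  obtain a where a: "\<exists>e\<in>E. a e \<noteq> 0" "\<forall>i<r. (\<Sum>e\<in>E. a e * m e i) = 0"
    using ex_linear_relation[OF assms(1,2)] by blast
  define g where "g = Gcd (a ` E)"
  have g0: "g \<noteq> 0" using a(1) by (auto simp: g_def Gcd_0_iff)
  have gd: "a e = g * (a e div g)" if "e \<in> E" for e using that by (simp add: g_def)
  have "\<exists>e\<in>E. \<not> q dvd a e div g"
  proof (rule ccontr)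
    assume all: "\<not> ?thesis"
    have "g * q dvd Gcd (a ` E)"
    proof (rule Gcd_greatest)
      fix x assume "x \<in> a ` E"
      then obtain e where e: "e \<in> E" "x = a e" by blast
      hence "g * q dvd g * (a e div g)" using all by (intro mult_dvd_mono) auto
      thus "g * q dvd x" using gd[OF e(1)] e by simp
    qed
    hence "g * q dvd g * 1" by (simp add: g_def)
    hence "q dvd 1" using g0 by (simp only: dvd_mult_cancel_left)  simp
    thus False using assms by simp
  qed
  moreover have "(\<Sum>e\<in>E. a e div g * m e i) = 0" if "i < r" for i
  proof -
    have "g * (\<Sum>e\<in>E. a e div g * m e i) = (\<Sum>e\<in>E. a e * m e i)"
      unfolding sum_distrib_left by (rule sum.cong) (simp_all add: mult.assoc[symmetric] gd[symmetric])
    thus ?thesis using a(2) that g0 by simp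
  qed
  ultimately show ?thesis by (intro exI[of _ "\<lambda>e. a e div g"]) auto
qed

text \<open>Finite abelian groups are represented as quotients \<open>V / L\<close> of subgroups of a free abelian
  group.\<close>

definition lin_comb :: "nat \<Rightarrow> (nat \<Rightarrow> int) \<Rightarrow> (nat \<Rightarrow> 'p \<Rightarrow>\<^sub>0 int) \<Rightarrow> 'p \<Rightarrow>\<^sub>0 int" where
  "lin_comb r c x = (\<Sum>i<r. frag_cmul (c i) (x i))"

text \<open>Independence and exact orders in one: modulo \<open>L\<close> the \<open>x i\<close>
  span a direct sum of cyclic groups of orders \<open>ns ! i\<close>.\<close>

definition independent_mod :: "('p \<Rightarrow>\<^sub>0 int) set \<Rightarrow> nat list \<Rightarrow> (nat \<Rightarrow> 'p \<Rightarrow>\<^sub>0 int) \<Rightarrow> bool" where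
  "independent_mod L ns x \<longleftrightarrow>
     (\<forall>c. lin_comb (length ns) c x \<in> L \<longleftrightarrow> (\<forall>i<length ns. int (ns ! i) dvd c i))"

definition generating_mod :: "('p \<Rightarrow>\<^sub>0 int) set \<Rightarrow> ('p \<Rightarrow>\<^sub>0 int) set \<Rightarrow> nat \<Rightarrow> (nat \<Rightarrow> 'p \<Rightarrow>\<^sub>0 int) \<Rightarrow> bool" where
  "generating_mod V L r x \<longleftrightarrow> (\<forall>i<r. x i \<in> V) \<and> (\<forall>v\<in>V. \<exists>c. v - lin_comb r c x \<in> L)"

lemma lin_comb_add: "lin_comb r (\<lambda>i. c i + c' i) x = lin_comb r c x + lin_comb r c' x"
  by (simp add: lin_comb_def frag_cmul_distrib sum.distrib)

lemma lin_comb_diff: "lin_comb r (\<lambda>i. c i - c' i) x = lin_comb r c x - lin_comb r c' x"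
  by (simp add: lin_comb_def frag.scale_left_diff_distrib sum_subtractf)

lemma lin_comb_in: "frag.subspace V \<Longrightarrow> (\<And>i. i < r \<Longrightarrow> x i \<in> V) \<Longrightarrow> lin_comb r c x \<in> V"
  unfolding lin_comb_def by (intro frag.subspace_sum frag.subspace_scale) auto

text \<open>Expressing the \<open>v e\<close> through \<open>r\<close> generators gives
  \<open>r\<close> equations in more than \<open>r\<close> unknowns. Used with \<open>q\<close>
  prime for the rank condition and with \<open>q = n\<close> to bound \<open>k\<close> by the
  rank.\<close>

lemma ex_relation_mod:
  assumes L: "frag.subspace L" and gen: "generating_mod V L r x"
    and E: "finite E" "r < card E" "\<And>e. e \<in> E \<Longrightarrow> v e \<in> V" and q: "q \<noteq> 0" "\<not> is_unit q"
  shows "\<exists>a. (\<exists>e\<in>E. \<not> q dvd a e) \<and> (\<Sum>e\<in>E. frag_cmul (a e) (v e)) \<in> L"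
proof -
  have "\<forall>e\<in>E. \<exists>c. v e - lin_comb r c x \<in> L" using gen E(3) by (auto simp: generating_mod_def)
  then obtain m where m: "\<forall>e\<in>E. v e - lin_comb r (m e) x \<in> L" by (rule bchoice[THEN exE])
  obtain a where a: "\<exists>e\<in>E. \<not> q dvd a e" "\<forall>i<r. (\<Sum>e\<in>E. a e * m e i) = 0"
    using ex_relation_not_dvd[OF E(1,2) q] by blast
  have "(\<Sum>e\<in>E. frag_cmul (a e) (v e - lin_comb r (m e) x)) \<in> L"
    using m by (intro frag.subspace_sum[OF L] frag.subspace_scale[OF L]) auto
  moreover have "(\<Sum>e\<in>E. frag_cmul (a e) (lin_comb r (m e) x)) = 0"
  proof -
    have "(\<Sum>e\<in>E. frag_cmul (a e) (lin_comb r (m e) x)) = (\<Sum>i<r. \<Sum>e\<in>E. frag_cmul (a e * m e i) (x i))"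
      unfolding lin_comb_def frag.scale_sum_right by (subst sum.swap) simp
    also have "\<dots> = (\<Sum>i<r. frag_cmul (\<Sum>e\<in>E. a e * m e i) (x i))" by (simp add: frag.scale_sum_left)
    also have "\<dots> = 0" using a(2) by (intro sum.neutral) auto
    finally show ?thesis .
  qed
  ultimately have "(\<Sum>e\<in>E. frag_cmul (a e) (v e)) \<in> L"
    by (simp add: frag.scale_right_diff_distrib sum_subtractf)
  thus ?thesis using a by blast
qed

section \<open>Cosets, orders and complements modulo a subgroup\<close>

definition coset_of :: "('p \<Rightarrow>\<^sub>0 int) set \<Rightarrow> ('p \<Rightarrow>\<^sub>0 int) \<Rightarrow> ('p \<Rightarrow>\<^sub>0 int) set" where
  "coset_of L x = (\<lambda>h. h + x) ` L"

lemma coset_of_eq_iff: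
  assumes L: "frag.subspace L" shows "coset_of L x = coset_of L y \<longleftrightarrow> x - y \<in> L"
proof
  assume "coset_of L x = coset_of L y"
  moreover have "x \<in> coset_of L x" using frag.subspace_0[OF L] by (auto simp: coset_of_def image_iff)
  ultimately obtain h where "h \<in> L" "x = h + y" by (auto simp: coset_of_def)
  thus "x - y \<in> L" by simp
next
  have *: "coset_of L x \<subseteq> coset_of L y" if "x - y \<in> L" for x y
  proof
    fix z assume "z \<in> coset_of L x"
    then obtain h where "h \<in> L" "z = h + x" by (auto simp: coset_of_def)
    thus "z \<in> coset_of L y" using frag.subspace_add[OF L, of h "x - y"] that
      by (auto simp: coset_of_def image_iff intro!: bexI[of _ "h + (x - y)"])
  qed
  assume xy: "x - y \<in> L"
  hence "y - x \<in> L" using frag.subspace_neg[OF L] by fastforce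
  thus "coset_of L x = coset_of L y" using * xy by blast
qed

lemma coset_of_eq_L: "frag.subspace L \<Longrightarrow> coset_of L x = L \<longleftrightarrow> x \<in> L"
  using coset_of_eq_iff[of L x 0] by (simp add: coset_of_def)

definition order_mod :: "('p \<Rightarrow>\<^sub>0 int) set \<Rightarrow> ('p \<Rightarrow>\<^sub>0 int) \<Rightarrow> nat \<Rightarrow> bool" where
  "order_mod L x k \<longleftrightarrow> 0 < k \<and> (\<forall>j. frag_cmul j x \<in> L \<longleftrightarrow> int k dvd j)"

lemma order_modI_least:
  assumes L: "frag.subspace L" and k: "0 < k" "frag_cmul (int k) x \<in> L"
  obtains k' where "order_mod L x k'" "k' \<le> k"
proof -
  define m where "m = (LEAST m. 0 < m \<and> frag_cmul (int m) x \<in> L)"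
  have m: "0 < m \<and> frag_cmul (int m) x \<in> L" unfolding m_def
    using k by (rule LeastI[where P = "\<lambda>m. 0 < m \<and> frag_cmul (int m) x \<in> L", OF conjI])
  have least: "m \<le> i" if "0 < i" "frag_cmul (int i) x \<in> L" for i unfolding m_def
    using that by (rule Least_le[where P = "\<lambda>m. 0 < m \<and> frag_cmul (int m) x \<in> L", OF conjI])
  have "int m dvd j" if j: "frag_cmul j x \<in> L" for j
  proof (rule ccontr)
    assume nd: "\<not> int m dvd j"
    have "frag_cmul (j mod int m) x = frag_cmul j x - frag_cmul (j div int m) (frag_cmul (int m) x)"
      by (simp add: frag.scale_left_diff_distrib[symmetric] minus_div_mult_eq_mod)
    moreover have "frag_cmul (j div int m) (frag_cmul (int m) x) \<in> L" by (rule frag.subspace_scale[OF L conjunct2[OF m]])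
    ultimately have "frag_cmul (j mod int m) x \<in> L" using j frag.subspace_diff[OF L] by metis
    moreover have "0 \<le> j mod int m" "j mod int m < int m" "j mod int m \<noteq> 0" using m nd by (auto simp: dvd_eq_mod_eq_0)
    ultimately show False using least[of "nat (j mod int m)"] by auto
  qed
  moreover have "frag_cmul j x \<in> L" if dj: "int m dvd j" for j
  proof -
    obtain t where "j = t * int m" using dj by (metis dvdE mult.commute)
    thus ?thesis using frag.subspace_scale[OF L, of "frag_cmul (int m) x" t] m by simp
  qed
  ultimately have "order_mod L x m" using m by (auto simp: order_mod_def)
  thus ?thesis using that least k by blast
qed

lemma order_mod_mult:
  assumes "order_mod L x (j * k)" shows "order_mod L (frag_cmul (int j) x) k"
  using assms by (auto simp: order_mod_def mult.commute)

lemma order_mod_coprime_add: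
  assumes L: "frag.subspace L" and x: "order_mod L x a" and y: "order_mod L y b" and ab: "coprime a b"
  shows "order_mod L (x + y) (a * b)"
proof -
  have dvd: "int a dvd j" if L: "frag.subspace L" "order_mod L x a" "order_mod L y b" "coprime a b"
    "frag_cmul j (x + y) \<in> L" for x y a b j
  proof -
    have "frag_cmul (int b) (frag_cmul j (x + y)) \<in> L" by (rule frag.subspace_scale[OF L(1) that(5)])
    moreover have "frag_cmul (int b * j) y \<in> L" using that(3) by (simp add: order_mod_def)
    ultimately have "frag_cmul (int b * j) (x + y) - frag_cmul (int b * j) y \<in> L" using L(1) by (simp add: frag.subspace_diff)
    hence "frag_cmul (int b * j) x \<in> L" by (simp add: frag_cmul_distrib2)
    hence "int a dvd int b * j" using that by (simp add: order_mod_def)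
    thus ?thesis using that(4) coprime_dvd_mult_right_iff[of "int a" "int b" j] by simp
  qed
  have "int (a * b) dvd j" if "frag_cmul j (x + y) \<in> L" for j
    using dvd[OF L x y ab that] dvd[OF L y x, of j] ab that
    by (simp add: add.commute coprime_commute divides_mult)
  moreover have "frag_cmul j (x + y) \<in> L" if "int (a * b) dvd j" for j
  proof -
    have "int a dvd j" "int b dvd j" using that by (auto intro: dvd_mult_left dvd_mult_right)
    thus ?thesis using x y by (auto simp: order_mod_def frag_cmul_distrib2 intro!: frag.subspace_add[OF L])
  qed
  ultimately show ?thesis using x y by (auto simp: order_mod_def)
qed

lemma ex_order_mod:
  assumes L: "frag.subspace L" and V: "frag.subspace V" and fin: "finite (coset_of L ` V)" and x: "x \<in> V"
  obtains k where "order_mod L x k" "k \<le> card (coset_of L ` V)"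
proof -
  define N where "N = card (coset_of L ` V)"
  have "(\<lambda>i. coset_of L (frag_cmul (int i) x)) ` {..N} \<subseteq> coset_of L ` V"
    using frag.subspace_scale[OF V x] by blast
  hence "card ((\<lambda>i. coset_of L (frag_cmul (int i) x)) ` {..N}) \<le> N"
    unfolding N_def by (rule card_mono[OF fin])
  hence "card ((\<lambda>i. coset_of L (frag_cmul (int i) x)) ` {..N}) < card {..N}" by simp
  then obtain i j where "i \<le> N" "j \<le> N" "i \<noteq> j" "coset_of L (frag_cmul (int i) x) = coset_of L (frag_cmul (int j) x)"
    using pigeonhole[of "\<lambda>i. coset_of L (frag_cmul (int i) x)" "{..N}"] by (auto simp: inj_on_def)
  then obtain i j where ij: "j < i" "i \<le> N" "coset_of L (frag_cmul (int i) x) = coset_of L (frag_cmul (int j) x)"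
    by (metis linorder_neqE_nat)
  hence "frag_cmul (int (i - j)) x \<in> L"
    using coset_of_eq_iff[OF L] by (simp add: frag.scale_left_diff_distrib of_nat_diff)
  then obtain k where "order_mod L x k" "k \<le> i - j" using order_modI_least[OF L, of "i - j" x] ij by auto
  thus ?thesis using that ij by (simp add: N_def)
qed

lemma ex_greatest_nat:
  assumes "\<exists>k::nat. P k" "\<forall>k. P k \<longrightarrow> k \<le> b"
  obtains m where "P m" "\<forall>k. P k \<longrightarrow> k \<le> m"
  using assms GreatestI_ex_nat[of P b] Greatest_le_nat[of P _ b] by blast

text \<open>An element of maximal order realizes the exponent: if a prime \<open>p\<close> had a
  higher power in the order of \<open>v\<close> than in \<open>n\<close>, the
  prime-to-\<open>p\<close> part of \<open>g\<close> and the \<open>p\<close>-part of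
  \<open>v\<close> would combine to a larger order.\<close>

lemma ex_max_order_mod:
  assumes L: "frag.subspace L" and V: "frag.subspace V" and fin: "finite (coset_of L ` V)"
  obtains g n where "g \<in> V" "order_mod L g n" "\<And>v. v \<in> V \<Longrightarrow> frag_cmul (int n) v \<in> L"
proof -
  define P where "P = (\<lambda>k. \<exists>v\<in>V. order_mod L v k)"
  have uniq: "k = k'" if "order_mod L v k" "order_mod L v k'" for v k k'
    using that unfolding order_mod_def by (metis dvd_antisym dvd_refl int_dvd_int_iff)
  have bound: "\<forall>k. P k \<longrightarrow> k \<le> card (coset_of L ` V)"
  proof (intro allI impI)
    fix k assume "P k"
    then obtain v where v: "v \<in> V" "order_mod L v k" by (auto simp: P_def)
    obtain k' where "order_mod L v k'" "k' \<le> card (coset_of L ` V)" using ex_order_mod[OF L V fin v(1)] .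
    thus "k \<le> card (coset_of L ` V)" using uniq v by blast
  qed
  have "\<exists>k. P k" using ex_order_mod[OF L V fin frag.subspace_0[OF V]] frag.subspace_0[OF V] unfolding P_def by metis
  then obtain n where n: "P n" and max: "\<forall>k. P k \<longrightarrow> k \<le> n"
    using bound by (rule ex_greatest_nat)
  obtain g where g: "g \<in> V" "order_mod L g n" using n by (auto simp: P_def)
  have "frag_cmul (int n) v \<in> L" if v: "v \<in> V" for v
  proof -
    obtain k where k: "order_mod L v k" using ex_order_mod[OF L V fin v] .
    have "k dvd n"
    proof (rule ccontr)
      assume nd: "\<not> k dvd n"
      have pos: "0 < k" "0 < n" using k g by (auto simp: order_mod_def)
      obtain p where p: "Factorial_Ring.prime p" "multiplicity p n < multiplicity p k"
        using nd multiplicity_le_imp_dvd[of k n] pos by (metis linorder_not_less not_gr_zero)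
      have nu: "\<not> is_unit p" using p by (simp add: prime_nat_iff)
      obtain n' where n': "n = p ^ multiplicity p n * n'" "\<not> p dvd n'"
        using multiplicity_decompose'[of n p] pos nu by auto
      obtain k' where k': "k = p ^ multiplicity p k * k'" "\<not> p dvd k'"
        using multiplicity_decompose'[of k p] pos nu by auto
      have o1: "order_mod L (frag_cmul (int (p ^ multiplicity p n)) g) n'"
        by (rule order_mod_mult) (use g n' in simp)
      have o2: "order_mod L (frag_cmul (int k') v) (p ^ multiplicity p k)"
        by (rule order_mod_mult) (use k k' in \<open>simp add: mult.commute\<close>)
      have "coprime n' (p ^ multiplicity p k)" 
        using prime_imp_coprime[OF p(1) n'(2)] by (simp add: coprime_commute)
      hence "order_mod L (frag_cmul (int (p ^ multiplicity p n)) g + frag_cmul (int k') v) (n' * p ^ multiplicity p k)"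
        by (rule order_mod_coprime_add[OF L o1 o2])
      moreover have "frag_cmul (int (p ^ multiplicity p n)) g + frag_cmul (int k') v \<in> V"
        using g v by (intro frag.subspace_add[OF V] frag.subspace_scale[OF V])
      ultimately have "n' * p ^ multiplicity p k \<le> n" using max by (auto simp: P_def)
      moreover have "n' * p ^ multiplicity p n < n' * p ^ multiplicity p k"
        using p n' pos prime_gt_1_nat[OF p(1)] by (metis mult_less_cancel1 n'(1) nat_0_less_mult_iff power_strict_increasing)
      moreover have "n' * p ^ multiplicity p n = n" using n'(1) by (metis mult.commute)
      ultimately show False by linarith
    qed
    thus ?thesis using k by (simp add: order_mod_def)
  qed
  thus ?thesis using that g by blast
qed

lemma subspace_add_multiples:
  assumes K: "frag.subspace K" shows "frag.subspace {k + frag_cmul j x | k j. k \<in> K}"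
proof (rule frag.subspaceI)
  show "0 \<in> {k + frag_cmul j x | k j. k \<in> K}"
    using frag.subspace_0[OF K] by (intro CollectI exI[of _ 0]) auto
  fix y z assume "y \<in> {k + frag_cmul j x | k j. k \<in> K}" "z \<in> {k + frag_cmul j x | k j. k \<in> K}"
  then obtain k j k' j' where "k \<in> K" "k' \<in> K" "y = k + frag_cmul j x" "z = k' + frag_cmul j' x" by blast
  thus "y + z \<in> {k + frag_cmul j x | k j. k \<in> K}"
    by (intro CollectI exI[of _ "k + k'"] exI[of _ "j + j'"]) (auto simp: frag_cmul_distrib frag.subspace_add[OF K])
next
  fix c y assume "y \<in> {k + frag_cmul j x | k j. k \<in> K}"
  then obtain k j where "k \<in> K" "y = k + frag_cmul j x" by blast
  thus "frag_cmul c y \<in> {k + frag_cmul j x | k j. k \<in> K}"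
    by (intro CollectI exI[of _ "frag_cmul c k"] exI[of _ "c * j"]) (auto simp: frag_cmul_distrib2 frag.subspace_scale[OF K])
qed

lemma coset_of_mono_strict:
  assumes L: "frag.subspace L" and K: "frag.subspace K" "L \<subseteq> K" and "K \<subset> K'"
  shows "coset_of L ` K \<subset> coset_of L ` K'"
proof -
  obtain x where x: "x \<in> K'" "x \<notin> K" using assms by blast
  have "coset_of L x \<notin> coset_of L ` K"
  proof
    assume "coset_of L x \<in> coset_of L ` K"
    then obtain y where y: "y \<in> K" "x - y \<in> L" using coset_of_eq_iff[OF L] by auto
    hence "y + (x - y) \<in> K" using K by (intro frag.subspace_add) auto
    thus False using x by simp
  qed
  thus ?thesis using x assms(4) by blast
qed

text \<open>A cyclic subgroup of maximal order is a direct summand: any subgroup \<open>K\<close> maximal subject to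
  \<open>K \<inter> \<langle>g\<rangle> = 0\<close> is a complement.\<close>

lemma ex_complement_mod:
  assumes L: "frag.subspace L" and V: "frag.subspace V" "L \<subseteq> V" and fin: "finite (coset_of L ` V)"
    and g: "g \<in> V" "order_mod L g n" and kill: "\<And>v. v \<in> V \<Longrightarrow> frag_cmul (int n) v \<in> L"
  obtains K where "frag.subspace K" "L \<subseteq> K" "K \<subseteq> V" "\<And>j. frag_cmul j g \<in> K \<Longrightarrow> frag_cmul j g \<in> L"
    "V = {k + frag_cmul j g | k j. k \<in> K}"
proof -
  define F where "F = (\<lambda>K. frag.subspace K \<and> L \<subseteq> K \<and> K \<subseteq> V \<and> (\<forall>j. frag_cmul j g \<in> K \<longrightarrow> frag_cmul j g \<in> L))"
  \<comment> \<open>Finiteness of \<open>V / L\<close> lets a maximal \<open>K\<close> be chosen by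
    counting its cosets.\<close>
  define c where "c = (\<lambda>K. card (coset_of L ` K))"
  have "F L" using L V by (simp add: F_def)
  have "c K \<le> c V" if "F K" for K unfolding c_def using that by (intro card_mono[OF fin] image_mono) (simp add: F_def)
  hence bd: "\<forall>y. (\<exists>K. F K \<and> c K = y) \<longrightarrow> y \<le> c V" by blast
  have ex: "\<exists>y K. F K \<and> c K = y" using \<open>F L\<close> by blast
  from ex bd obtain m where "\<exists>K. F K \<and> c K = m" "\<forall>y. (\<exists>K. F K \<and> c K = y) \<longrightarrow> y \<le> m"
    by (rule ex_greatest_nat[of "\<lambda>y. \<exists>K. F K \<and> c K = y"])
  then obtain K where FK: "F K" and maxK: "\<And>K'. F K' \<Longrightarrow> c K' \<le> c K" by blast
  have K: "frag.subspace K" "L \<subseteq> K" "K \<subseteq> V" and Kg: "\<And>j. frag_cmul j g \<in> K \<Longrightarrow> frag_cmul j g \<in> L"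
    using FK by (auto simp: F_def)
  define W where "W = {k + frag_cmul j g | k j. k \<in> K}"
  have W: "frag.subspace W" unfolding W_def by (rule subspace_add_multiples[OF K(1)])
  have KW: "K \<subseteq> W"
  proof
    fix k assume "k \<in> K" thus "k \<in> W" unfolding W_def by (intro CollectI exI[of _ k] exI[of _ 0]) simp
  qed
  have gW: "frag_cmul j g \<in> W" for j
    unfolding W_def using frag.subspace_0[OF K(1)] by (intro CollectI exI[of _ 0] exI[of _ j]) simp
  have WV: "W \<subseteq> V"
  proof
    fix w assume "w \<in> W"
    then obtain k j where "k \<in> K" "w = k + frag_cmul j g" unfolding W_def by blast
    thus "w \<in> V" using K(3) g(1) frag.subspace_add[OF V(1)] frag.subspace_scale[OF V(1)] by blast
  qed
  have n0: "0 < n" using g by (simp add: order_mod_def)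
  have "V \<subseteq> W"
  proof (rule ccontr)
    assume "\<not> V \<subseteq> W"
    then obtain x0 where x0: "x0 \<in> V" "x0 \<notin> W" by blast
    have "frag_cmul (int n) x0 \<in> W" using kill[OF x0(1)] K KW by blast
    then obtain k0 where k0: "order_mod W x0 k0" by (rule order_modI_least[OF W n0])
    have "k0 \<noteq> 1"
    proof
      assume "k0 = 1"
      moreover have "frag_cmul 1 x0 \<in> W \<longleftrightarrow> int k0 dvd 1" using k0 unfolding order_mod_def by blast
      ultimately show False using x0 by simp
    qed
    \<comment> \<open>Replacing \<open>x0\<close> by a multiple gives \<open>x\<close> outside
      \<open>W\<close> whose order modulo \<open>W\<close> is a prime \<open>p\<close>.\<close>
    then obtain p where p: "Factorial_Ring.prime p" "p dvd k0" using prime_factor_nat by blast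
    then obtain t where t: "k0 = t * p" by (metis dvdE mult.commute)
    have "int k0 dvd int n" using k0 \<open>frag_cmul (int n) x0 \<in> W\<close> by (simp add: order_mod_def)
    hence "p dvd n" using p(2) by (metis dvd_trans int_dvd_int_iff)
    then obtain n' where n': "n = p * n'" by blast
    define x where "x = frag_cmul (int t) x0"
    have xp: "order_mod W x p" unfolding x_def using k0 t by (intro order_mod_mult) simp
    have xV: "x \<in> V" unfolding x_def using x0 by (intro frag.subspace_scale[OF V(1)])
    have "frag_cmul (int p) x \<in> W" using xp by (simp add: order_mod_def)
    then obtain k a where ka: "k \<in> K" "frag_cmul (int p) x = k + frag_cmul a g" unfolding W_def by blast
    have "frag_cmul (int n') (frag_cmul (int p) x) \<in> L" using kill[OF xV] by (simp add: n' mult.commute)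
    hence "frag_cmul (int n') k + frag_cmul (int n' * a) g \<in> K" using K(2) ka by (auto simp: frag_cmul_distrib2)
    moreover have "frag_cmul (int n') k \<in> K" by (rule frag.subspace_scale[OF K(1) ka(1)])
    ultimately have "frag_cmul (int n') k + frag_cmul (int n' * a) g - frag_cmul (int n') k \<in> K"
      by (rule frag.subspace_diff[OF K(1)])
    \<comment> \<open>This is where the maximal order of \<open>g\<close> enters:
      \<open>n = p * n'\<close> kills \<open>x\<close>, so \<open>n\<close> divides
      \<open>n' * a\<close> and \<open>p\<close> divides \<open>a\<close>. Subtracting a multiple of
      \<open>g\<close> from \<open>x\<close> then gives \<open>x'\<close> with \<open>p\<close>
      times \<open>x'\<close> in \<open>K\<close>.\<close>
    hence "frag_cmul (int n' * a) g \<in> L" using Kg by simp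
    hence "int n dvd int n' * a" using g by (simp add: order_mod_def)
    hence "int n' * int p dvd int n' * a" by (simp add: n' mult.commute)
    hence "int p dvd a" using n' n0 by simp
    then obtain b where b: "a = int p * b" by blast
    define x' where "x' = x - frag_cmul b g"
    have px': "frag_cmul (int p) x' = k"
      unfolding x'_def frag.scale_right_diff_distrib using ka b by simp
    have x'W: "x' \<notin> W"
    proof
      assume "x' \<in> W"
      hence "x' + frag_cmul b g \<in> W" by (rule frag.subspace_add[OF W _ gW])
      hence "frag_cmul 1 x \<in> W" by (simp add: x'_def)
      hence "int p dvd 1" using xp unfolding order_mod_def by blast
      thus False using p(1) by (simp add: prime_nat_iff)
    qed
    define K' where "K' = {k + frag_cmul j x' | k j. k \<in> K}"
    have K'K: "K \<subseteq> K'"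
    proof
      fix k assume "k \<in> K" thus "k \<in> K'" unfolding K'_def by (intro CollectI exI[of _ k] exI[of _ 0]) simp
    qed
    have "x' \<in> K'" unfolding K'_def using frag.subspace_0[OF K(1)] by (intro CollectI exI[of _ 0] exI[of _ 1]) simp
    hence KK': "K \<subset> K'" using K'K KW x'W by blast
    have "F K'"
      unfolding F_def
    proof (intro conjI allI impI)
      show "frag.subspace K'" unfolding K'_def by (rule subspace_add_multiples[OF K(1)])
      show "L \<subseteq> K'" using K K'K by blast
      have x'V: "x' \<in> V" unfolding x'_def using xV g by (intro frag.subspace_diff[OF V(1)] frag.subspace_scale[OF V(1)])
      show "K' \<subseteq> V"
      proof
        fix w assume "w \<in> K'"
        then obtain k j where "k \<in> K" "w = k + frag_cmul j x'" unfolding K'_def by blast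
        thus "w \<in> V" using K(3) x'V frag.subspace_add[OF V(1)] frag.subspace_scale[OF V(1)] by blast
      qed
      fix i assume "frag_cmul i g \<in> K'"
      then obtain l j where lj: "l \<in> K" "frag_cmul i g = l + frag_cmul j x'" unfolding K'_def by blast
      \<comment> \<open>Otherwise Bezout writes \<open>x'\<close> through \<open>p\<close> times
        \<open>x'\<close> and \<open>j\<close> times \<open>x'\<close>, both of which lie in
        \<open>W\<close>.\<close>
      have "int p dvd j"
      proof (rule ccontr)
        assume "\<not> int p dvd j"
        hence "coprime (int p) j" using p(1) by (intro prime_imp_coprime) simp_all
        then obtain u v where "u * int p + v * j = 1" using bezout_int[of "int p" j] by auto
        hence "x' = frag_cmul (u * int p + v * j) x'" by simp
        also have "\<dots> = frag_cmul u k + frag_cmul v (frag_cmul i g - l)"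
          using lj px' by (simp add: frag_cmul_distrib frag_cmul_cmul[symmetric] del: frag_cmul_cmul frag.scale_scale)
        also have "\<dots> \<in> W"
        proof -
          have kW: "k \<in> W" and lW: "l \<in> W" using ka(1) lj(1) KW by auto
          show ?thesis
            by (rule frag.subspace_add[OF W frag.subspace_scale[OF W kW]
              frag.subspace_scale[OF W frag.subspace_diff[OF W gW lW]]])
        qed
        finally show False using x'W by blast
      qed
      then obtain s where "j = s * int p" by (metis dvdE mult.commute)
      hence "frag_cmul j x' = frag_cmul s (frag_cmul (int p) x')" by simp
      hence "frag_cmul j x' = frag_cmul s k" unfolding px' .
      hence "frag_cmul i g \<in> K" using lj ka(1) frag.subspace_add[OF K(1)] frag.subspace_scale[OF K(1)] by simp
      thus "frag_cmul i g \<in> L" by (rule Kg)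
    qed
    hence "coset_of L ` K' \<subseteq> coset_of L ` V" by (intro image_mono) (simp add: F_def)
    hence "finite (coset_of L ` K')" using fin by (rule finite_subset)
    hence "c K < c K'" unfolding c_def
      by (rule psubset_card_mono[OF _ coset_of_mono_strict[OF L K(1,2) KK']])
    thus False using maxK[OF \<open>F K'\<close>] by simp
  qed
  hence "V = W" using WV by blast
  thus ?thesis using that K Kg unfolding W_def by blast
qed

text \<open>A cyclic summand of maximal order is split off, and the complement is treated by
  induction. All orders found there divide \<open>n\<close> because \<open>n\<close> kills
  \<open>V\<close>, so \<open>n\<close> goes to the end of the list.\<close>

theorem ex_invariant_factor_basis:
  assumes L: "frag.subspace L" and V: "frag.subspace V" "L \<subseteq> V" and fin: "finite (coset_of L ` V)"
  shows "\<exists>ns x. (\<forall>n\<in>set ns. 1 < n) \<and> sorted_wrt (dvd) ns \<and> generating_mod V L (length ns) x \<and> independent_mod L ns x"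
  using V fin
proof (induction "card (coset_of L ` V)" arbitrary: V rule: less_induct)
  case less
  obtain g n where g: "g \<in> V" "order_mod L g n" and kill: "\<And>v. v \<in> V \<Longrightarrow> frag_cmul (int n) v \<in> L"
    using ex_max_order_mod[OF L less.prems(1,3)] by blast
  show ?case
  proof (cases "n = 1")
    case True
    hence "v \<in> L" if "v \<in> V" for v using kill[OF that] by simp
    thus ?thesis using frag.subspace_0[OF L]
      by (intro exI[of _ "[]"]) (auto simp: generating_mod_def independent_mod_def lin_comb_def)
  next
    case False
    hence n: "1 < n" using g by (auto simp: order_mod_def)
    obtain K where K: "frag.subspace K" "L \<subseteq> K" "K \<subseteq> V" "\<And>j. frag_cmul j g \<in> K \<Longrightarrow> frag_cmul j g \<in> L"
      and VK: "V = {k + frag_cmul j g | k j. k \<in> K}"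
      using ex_complement_mod[OF L less.prems g kill] by blast
    have "g \<notin> K"
    proof
      assume "g \<in> K"
      hence "frag_cmul 1 g \<in> L" using K(4)[of 1] by simp
      hence "int n dvd 1" using g unfolding order_mod_def by blast
      thus False using n by simp
    qed
    hence "K \<subset> V" using K(3) g(1) by blast
    hence "card (coset_of L ` K) < card (coset_of L ` V)"
      using less.prems(3) by (intro psubset_card_mono coset_of_mono_strict[OF L K(1,2)])
    moreover have "finite (coset_of L ` K)" using less.prems(3) K(3) by (meson finite_subset image_mono)
    ultimately obtain ns x where ns: "\<forall>n\<in>set ns. 1 < n" "sorted_wrt (dvd) ns"
      and gen: "generating_mod K L (length ns) x" and ind: "independent_mod L ns x"
      using less.hyps[of K] K(1,2) by blast
    define r where "r = length ns"
    define y where "y = x(r := g)"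
    have lc: "lin_comb (Suc r) c y = lin_comb r c x + frag_cmul (c r) g" for c
      by (simp add: lin_comb_def y_def)
    have xK: "x i \<in> K" if "i < r" for i using gen that by (simp add: generating_mod_def r_def)
    have "m dvd n" if "m \<in> set ns" for m
    proof -
      obtain i where i: "i < r" "m = ns ! i" using \<open>m \<in> set ns\<close> by (metis in_set_conv_nth r_def)
      have "lin_comb r (\<lambda>j. if j = i then int n else 0) x = (\<Sum>j<r. if j = i then frag_cmul (int n) (x i) else 0)"
        unfolding lin_comb_def by (intro sum.cong) auto
      also have "\<dots> = frag_cmul (int n) (x i)" using i by simp
      also have "\<dots> \<in> L" using kill xK[OF i(1)] K(3) by blast
      finally have "\<forall>j<r. int (ns ! j) dvd (if j = i then int n else 0)"
        using ind by (simp add: independent_mod_def r_def)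
      thus ?thesis using i by auto
    qed
    hence "sorted_wrt (dvd) (ns @ [n])" using ns(2) by (simp add: sorted_wrt_append)
    moreover have "\<forall>m\<in>set (ns @ [n]). 1 < m" using ns n by simp
    moreover have "generating_mod V L (length (ns @ [n])) y"
      unfolding generating_mod_def
    proof (intro conjI allI impI ballI)
      fix i assume "i < length (ns @ [n])"
      thus "y i \<in> V" using xK[of i] K(3) g(1) by (auto simp: y_def r_def less_Suc_eq)
    next
      fix v assume "v \<in> V"
      then obtain k j where k: "k \<in> K" "v = k + frag_cmul j g" using VK by blast
      then obtain c where c: "k - lin_comb r c x \<in> L" using gen by (auto simp: generating_mod_def r_def)
      have "lin_comb r (c(r := j)) x = lin_comb r c x" unfolding lin_comb_def by (intro sum.cong) auto
      hence "v - lin_comb (Suc r) (c(r := j)) y = k - lin_comb r c x" using k by (simp add: lc)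
      thus "\<exists>c. v - lin_comb (length (ns @ [n])) c y \<in> L" using c by (auto simp: r_def intro!: exI[of _ "c(r := j)"])
    qed
    moreover have "independent_mod L (ns @ [n]) y"
      unfolding independent_mod_def
    proof (intro allI)
      fix c
      have lK: "lin_comb r c x \<in> K" using xK by (intro lin_comb_in[OF K(1)])
      have "lin_comb r c x + frag_cmul (c r) g \<in> L \<longleftrightarrow> lin_comb r c x \<in> L \<and> frag_cmul (c r) g \<in> L"
      proof
        assume l: "lin_comb r c x + frag_cmul (c r) g \<in> L"
        hence "lin_comb r c x + frag_cmul (c r) g - lin_comb r c x \<in> K"
          using lK K(2) by (intro frag.subspace_diff[OF K(1)]) auto
        hence g': "frag_cmul (c r) g \<in> L" using K(4) by simp
        hence "lin_comb r c x + frag_cmul (c r) g - frag_cmul (c r) g \<in> L" using l by (intro frag.subspace_diff[OF L])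
        thus "lin_comb r c x \<in> L \<and> frag_cmul (c r) g \<in> L" using g' by simp
      qed (auto intro: frag.subspace_add[OF L])
      also have "\<dots> \<longleftrightarrow> (\<forall>i<Suc r. int ((ns @ [n]) ! i) dvd c i)"
        using ind g(2) by (auto simp: independent_mod_def order_mod_def r_def less_Suc_eq nth_append)
      finally show "lin_comb (length (ns @ [n])) c y \<in> L \<longleftrightarrow> (\<forall>i<length (ns @ [n]). int ((ns @ [n]) ! i) dvd c i)"
        by (simp add: lc[unfolded r_def] r_def)
    qed
    ultimately show ?thesis by blast
  qed
qed

section \<open>Sums of cyclic groups as subgroups of the quotient \<open>V / L\<close>\<close>

lemma group_cyclic_sum: "group (cyclic_sum ns)"
  unfolding cyclic_sum_def by (intro product_group) simp

lemma carrier_cyclic_sum: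
  "(\<And>i. i < length ns \<Longrightarrow> 0 < ns ! i) \<Longrightarrow> carrier (cyclic_sum ns) = (\<Pi>\<^sub>E i\<in>{..<length ns}. {0..<int (ns ! i)})"
  unfolding cyclic_sum_def carrier_product_group by (intro PiE_cong) (simp add: carrier_integer_mod_group)

lemma card_cyclic_sum:
  "(\<And>i. i < length ns \<Longrightarrow> 0 < ns ! i) \<Longrightarrow> card (carrier (cyclic_sum ns)) = (\<Prod>i<length ns. ns ! i)"
  by (simp add: carrier_cyclic_sum card_PiE)

locale free_abelian_quotient =
  fixes P :: "'p set" and L :: "('p \<Rightarrow>\<^sub>0 int) set"
  assumes L: "frag.subspace L" and L_keys: "x \<in> L \<Longrightarrow> Poly_Mapping.keys x \<subseteq> P"
begin

abbreviation "V \<equiv> carrier (free_Abelian_group P)"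
abbreviation "Q \<equiv> free_Abelian_group P Mod L"

lemma V: "frag.subspace V"
proof (rule frag.subspaceI)
  show "0 \<in> V" by simp
  show "x + y \<in> V" if "x \<in> V" "y \<in> V" for x y
    using that keys_add[of x y] by auto
  show "frag_cmul c x \<in> V" if "x \<in> V" for c x
    using that keys_cmul[of c x] by auto
qed

lemma LV: "L \<subseteq> V" using L_keys by auto

lemma carrier_quotient: "carrier Q = coset_of L ` V"
  by (auto simp: FactGroup_def RCOSETS_def r_coset_def coset_of_def)

lemma one_quotient: "\<one>\<^bsub>Q\<^esub> = L"
  by (simp add: FactGroup_def)

lemma mult_quotient: "coset_of L x \<otimes>\<^bsub>Q\<^esub> coset_of L y = coset_of L (x + y)"
proof -
  have "coset_of L x \<otimes>\<^bsub>Q\<^esub> coset_of L y = {a + x + (b + y) | a b. a \<in> L \<and> b \<in> L}"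
    by (auto simp: FactGroup_def set_mult_def coset_of_def)
  also have "\<dots> = coset_of L (x + y)"
  proof (intro equalityI subsetI)
    fix z assume "z \<in> {a + x + (b + y) | a b. a \<in> L \<and> b \<in> L}"
    then obtain a b where "a \<in> L" "b \<in> L" "z = a + b + (x + y)" by (auto simp: ac_simps)
    thus "z \<in> coset_of L (x + y)" unfolding coset_of_def using frag.subspace_add[OF L] by blast
  next
    fix z assume "z \<in> coset_of L (x + y)"
    then obtain a where "a \<in> L" "z = a + x + (0 + y)" by (auto simp: coset_of_def ac_simps)
    thus "z \<in> {a + x + (b + y) | a b. a \<in> L \<and> b \<in> L}" using frag.subspace_0[OF L] by blast
  qed
  finally show ?thesis .
qed

lemma group_quotient: "group Q"
proof -
  have "subgroup L (free_Abelian_group P)"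
    by unfold_locales (use LV frag.subspace_0[OF L] frag.subspace_add[OF L] frag.subspace_neg[OF L] L_keys in auto)
  hence "L \<lhd> free_Abelian_group P"
    using comm_group.subgroup_imp_normal[OF abelian_free_Abelian_group] by blast
  thus ?thesis by (rule normal.factorgroup_is_group)
qed

text \<open>Coefficients are sent to the coset of their linear combination; independence makes this
  injective, and a homomorphism despite the reduction modulo \<open>ns ! i\<close>. The last clause
  covers the whole quotient.\<close>

lemma subgroup_iso_cyclic_sum:
  assumes pos: "\<And>i. i < length ns \<Longrightarrow> 0 < ns ! i" and x: "\<And>i. i < length ns \<Longrightarrow> x i \<in> V"
    and ind: "independent_mod L ns x"
  obtains U where "subgroup U Q" "Q\<lparr>carrier := U\<rparr> \<cong> cyclic_sum ns"
    "generating_mod V L (length ns) x \<Longrightarrow> U = carrier Q"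
proof -
  define r where "r = length ns"
  have carr: "carrier (cyclic_sum ns) = (\<Pi>\<^sub>E i\<in>{..<r}. {0..<int (ns ! i)})"
    unfolding r_def by (rule carrier_cyclic_sum) (rule pos)
  define f where "f = (\<lambda>c. coset_of L (lin_comb r c x))"
  interpret C: group "cyclic_sum ns" by (rule group_cyclic_sum)
  interpret Q: group Q by (rule group_quotient)
  have xV: "lin_comb r c x \<in> V" for c using x by (intro lin_comb_in[OF V]) (simp add: r_def)
  have inL: "lin_comb r c x \<in> L \<longleftrightarrow> (\<forall>i<r. int (ns ! i) dvd c i)" for c
    using ind by (simp add: independent_mod_def r_def)
  have hom: "f \<in> hom (cyclic_sum ns) Q"
  proof (rule homI)
    show "f c \<in> carrier Q" for c unfolding carrier_quotient f_def using xV by blast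
    fix c c' assume "c \<in> carrier (cyclic_sum ns)" "c' \<in> carrier (cyclic_sum ns)"
    have "lin_comb r (\<lambda>i. (c \<otimes>\<^bsub>cyclic_sum ns\<^esub> c') i - (c i + c' i)) x \<in> L"
      unfolding inL by (auto simp: cyclic_sum_def r_def minus_mod_eq_mult_div mod_eq_dvd_iff[symmetric])
    hence "lin_comb r (c \<otimes>\<^bsub>cyclic_sum ns\<^esub> c') x - (lin_comb r c x + lin_comb r c' x) \<in> L"
      by (simp add: lin_comb_diff lin_comb_add)
    thus "f (c \<otimes>\<^bsub>cyclic_sum ns\<^esub> c') = f c \<otimes>\<^bsub>Q\<^esub> f c'"
      unfolding f_def mult_quotient coset_of_eq_iff[OF L] .
  qed
  interpret f: group_hom "cyclic_sum ns" Q f by unfold_locales (rule hom)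
  have inj: "inj_on f (carrier (cyclic_sum ns))"
  proof (rule inj_onI)
    fix c c' assume c: "c \<in> carrier (cyclic_sum ns)" "c' \<in> carrier (cyclic_sum ns)" "f c = f c'"
    have "lin_comb r (\<lambda>i. c i - c' i) x \<in> L"
      using c(3) unfolding f_def coset_of_eq_iff[OF L] lin_comb_diff .
    hence d: "int (ns ! i) dvd c i - c' i" if "i < r" for i unfolding inL using that by simp
    show "c = c'"
    proof (rule PiE_ext[of c "{..<r}" "\<lambda>i. {0..<int (ns ! i)}"])
      show "c \<in> (\<Pi>\<^sub>E i\<in>{..<r}. {0..<int (ns ! i)})" "c' \<in> (\<Pi>\<^sub>E i\<in>{..<r}. {0..<int (ns ! i)})"
        using c(1,2) carr by (simp_all add: r_def)
      fix i assume "i \<in> {..<r}"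
      hence i: "i < r" by simp
      have "c i \<in> {0..<int (ns ! i)}" "c' i \<in> {0..<int (ns ! i)}"
        using c(1,2) carr i by (auto simp: r_def)
      hence "c i - c' i = 0" by (intro dvd_small_imp_0[OF d[OF i]]) auto
      thus "c i = c' i" by simp
    qed
  qed
  define U where "U = f ` carrier (cyclic_sum ns)"
  have "subgroup U Q" unfolding U_def by (rule f.img_is_subgroup)
  moreover have "f \<in> iso (cyclic_sum ns) (Q\<lparr>carrier := U\<rparr>)"
    using hom inj by (auto simp: iso_def hom_def U_def bij_betw_def)
  hence "cyclic_sum ns \<cong> Q\<lparr>carrier := U\<rparr>" by (auto simp: is_iso_def)
  hence "Q\<lparr>carrier := U\<rparr> \<cong> cyclic_sum ns" by (rule C.iso_sym)
  moreover have "U = carrier Q" if gen: "generating_mod V L (length ns) x"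
  proof
    show "U \<subseteq> carrier Q" unfolding U_def by auto
    show "carrier Q \<subseteq> U"
    proof
      fix a assume "a \<in> carrier Q"
      then obtain v where v: "v \<in> V" "a = coset_of L v" by (auto simp: carrier_quotient)
      then obtain c where c: "v - lin_comb r c x \<in> L" using gen unfolding generating_mod_def r_def by blast
      define c' where "c' = (\<lambda>i\<in>{..<r}. c i mod int (ns ! i))"
      have "c' \<in> carrier (cyclic_sum ns)" unfolding carr using pos by (auto simp: c'_def r_def)
      moreover have "lin_comb r (\<lambda>i. c i - c' i) x \<in> L" unfolding inL by (auto simp: c'_def minus_mod_eq_mult_div)
      hence "v - lin_comb r c x + (lin_comb r c x - lin_comb r c' x) \<in> L"
        using c by (intro frag.subspace_add[OF L]) (simp_all add: lin_comb_diff)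
      hence "a = f c'" using v by (simp add: f_def coset_of_eq_iff[OF L])
      ultimately show "a \<in> U" by (simp add: U_def)
    qed
  qed
  ultimately show ?thesis using that by blast
qed

text \<open>Representatives of the images of the unit vectors form the independent family.\<close>

lemma independent_of_subgroup_iso:
  assumes pos: "\<And>i. i < length ns \<Longrightarrow> 0 < ns ! i" and U: "subgroup U Q" "Q\<lparr>carrier := U\<rparr> \<cong> cyclic_sum ns"
  obtains x where "\<And>i. i < length ns \<Longrightarrow> x i \<in> V" "independent_mod L ns x"
    "U = carrier Q \<Longrightarrow> generating_mod V L (length ns) x"
proof -
  define r where "r = length ns"
  have carr: "carrier (cyclic_sum ns) = (\<Pi>\<^sub>E i\<in>{..<r}. {0..<int (ns ! i)})"
    unfolding r_def by (rule carrier_cyclic_sum) (rule pos)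
  interpret C: group "cyclic_sum ns" by (rule group_cyclic_sum)
  interpret Q: group Q by (rule group_quotient)
  have gU: "group (Q\<lparr>carrier := U\<rparr>)" using U(1) Q.subgroup_imp_group by blast
  obtain h where h: "h \<in> iso (cyclic_sum ns) (Q\<lparr>carrier := U\<rparr>)"
    using group.iso_sym[OF gU U(2)] by (auto simp: is_iso_def)
  have Usub: "U \<subseteq> carrier Q" using U(1) by (rule subgroup.subset)
  \<comment> \<open>Reduction extends the isomorphism \<open>h\<close> to an additive map
    \<open>F\<close> on all integer coefficient vectors, so that it can be evaluated by
    linearity.\<close>
  define red where "red = (\<lambda>c. \<lambda>i\<in>{..<r}. c i mod int (ns ! i))"
  define F where "F = (\<lambda>c. h (red c))"
  have redc: "red c \<in> carrier (cyclic_sum ns)" for c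
    unfolding carr using pos by (auto simp: red_def r_def)
  have red_add: "red (\<lambda>i. c i + c' i) = red c \<otimes>\<^bsub>cyclic_sum ns\<^esub> red c'" for c c'
    by (auto simp: red_def cyclic_sum_def r_def mod_simps restrict_def)
  have hm: "h (a \<otimes>\<^bsub>cyclic_sum ns\<^esub> b) = h a \<otimes>\<^bsub>Q\<^esub> h b" if "a \<in> carrier (cyclic_sum ns)" "b \<in> carrier (cyclic_sum ns)" for a b
    using h that by (auto simp: iso_def hom_def)
  have F_add: "F (\<lambda>i. c i + c' i) = F c \<otimes>\<^bsub>Q\<^esub> F c'" for c c'
    unfolding F_def red_add by (rule hm[OF redc redc])
  have FU: "F c \<in> U" for c using h redc[of c] by (auto simp: F_def iso_def bij_betw_def)
  have FQ: "F c \<in> carrier Q" for c using FU Usub by blast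
  have F0: "F (\<lambda>_. 0) = \<one>\<^bsub>Q\<^esub>"
  proof -
    have "F (\<lambda>_. 0) \<otimes>\<^bsub>Q\<^esub> F (\<lambda>_. 0) = F (\<lambda>_. 0)" using F_add[of "\<lambda>_. 0" "\<lambda>_. 0"] by (simp only: add_0_left)
    thus ?thesis using Q.l_cancel_one[OF FQ FQ] by blast
  qed
  define e where "e = (\<lambda>(k::nat) (j::int) i. if i = k then j else 0)"
  have "\<forall>k. \<exists>v. v \<in> V \<and> coset_of L v = F (e k 1)"
  proof
    fix k
    have "F (e k 1) \<in> coset_of L ` V" using FQ unfolding carrier_quotient .
    thus "\<exists>v. v \<in> V \<and> coset_of L v = F (e k 1)" by blast
  qed
  then obtain x where "\<forall>k. x k \<in> V \<and> coset_of L (x k) = F (e k 1)" using choice[of "\<lambda>k v. v \<in> V \<and> coset_of L v = F (e k 1)"] by blast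
  hence xV: "x k \<in> V" and Fx: "coset_of L (x k) = F (e k 1)" for k by blast+
  have e_add: "(\<lambda>i. e k a i + e k b i) = e k (a + b)" for k a b by (auto simp: e_def)
  have cosQ: "coset_of L v \<in> carrier Q" if "v \<in> V" for v using that carrier_quotient by blast
  have Fe: "F (e k j) = coset_of L (frag_cmul j (x k))" for k j
  proof (induction j rule: int_induct[where k = 0])
    case base
    have "e k 0 = (\<lambda>_. 0)" by (auto simp: e_def)
    thus ?case using F0 coset_of_eq_L[OF L, of 0] frag.subspace_0[OF L] by (simp add: one_quotient)
  next
    case (step1 i)
    have "F (e k (i + 1)) = F (e k i) \<otimes>\<^bsub>Q\<^esub> F (e k 1)" using F_add e_add by metis
    also have "\<dots> = coset_of L (frag_cmul i (x k)) \<otimes>\<^bsub>Q\<^esub> coset_of L (x k)" using step1 Fx by simp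
    also have "\<dots> = coset_of L (frag_cmul (i + 1) (x k))" by (simp only: mult_quotient frag_cmul_distrib frag_cmul_one)
    finally show ?case .
  next
    case (step2 i)
    have "F (e k (i - 1)) \<otimes>\<^bsub>Q\<^esub> F (e k 1) = F (e k (i - 1 + 1))" using F_add e_add by metis
    also have "\<dots> = coset_of L (frag_cmul (i - 1 + 1) (x k))" using step2 by simp
    also have "\<dots> = coset_of L (frag_cmul (i - 1) (x k)) \<otimes>\<^bsub>Q\<^esub> F (e k 1)"
      unfolding Fx[symmetric] mult_quotient frag_cmul_distrib frag_cmul_one ..
    finally show ?case
      using Q.r_cancel[of "F (e k (i - 1))" "F (e k 1)" "coset_of L (frag_cmul (i - 1) (x k))"]
        FQ cosQ[OF frag.subspace_scale[OF V xV]] by simp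
  qed
  have Fsum: "F (\<lambda>i. if i < m then c i else 0) = coset_of L (lin_comb m c x)" for m c
  proof (induction m)
    case 0 thus ?case using F0 coset_of_eq_L[OF L, of 0] frag.subspace_0[OF L] by (simp add: one_quotient lin_comb_def)
  next
    case (Suc m)
    have "(\<lambda>i. if i < Suc m then c i else 0) = (\<lambda>i. (if i < m then c i else 0) + e m (c m) i)"
      by (auto simp: e_def less_Suc_eq)
    hence "F (\<lambda>i. if i < Suc m then c i else 0) = coset_of L (lin_comb m c x) \<otimes>\<^bsub>Q\<^esub> coset_of L (frag_cmul (c m) (x m))"
      using F_add Fe Suc by metis
    thus ?case unfolding mult_quotient by (simp add: lin_comb_def)
  qed
  have F: "F c = coset_of L (lin_comb r c x)" for c
  proof -
    have "red c = red (\<lambda>i. if i < r then c i else 0)" by (auto simp: red_def restrict_def)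
    thus ?thesis using Fsum[of r c] by (simp add: F_def)
  qed
  have "lin_comb r c x \<in> L \<longleftrightarrow> (\<forall>i<r. int (ns ! i) dvd c i)" for c
  proof -
    have "lin_comb r c x \<in> L \<longleftrightarrow> F c = F (\<lambda>_. 0)"
      using F coset_of_eq_L[OF L] F0 one_quotient by metis
    also have "\<dots> \<longleftrightarrow> red c = red (\<lambda>_. 0)"
      using h redc unfolding F_def iso_def bij_betw_def by (auto dest: inj_onD)
    also have "\<dots> \<longleftrightarrow> (\<forall>i<r. int (ns ! i) dvd c i)"
      by (auto simp: red_def restrict_def fun_eq_iff dvd_eq_mod_eq_0)
    finally show ?thesis .
  qed
  hence "independent_mod L ns x" by (simp add: independent_mod_def r_def)
  moreover have "generating_mod V L (length ns) x" if UQ: "U = carrier Q"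
    unfolding generating_mod_def
  proof (intro conjI allI impI ballI xV)
    fix v assume vV: "v \<in> V"
    have img: "h ` carrier (cyclic_sum ns) = carrier Q"
      using h unfolding iso_def bij_betw_def UQ by simp
    have "coset_of L v \<in> h ` carrier (cyclic_sum ns)" unfolding img by (rule cosQ[OF vV])
    then obtain c where c: "c \<in> carrier (cyclic_sum ns)" "coset_of L v = h c" by (elim imageE) simp
    have "red c = c"
    proof
      fix i
      have "c i \<in> {0..<int (ns ! i)}" if "i < r" using PiE_mem[OF c(1)[unfolded carr], of i] that by blast
      moreover have "c i = undefined" if "\<not> i < r" using PiE_arb[OF c(1)[unfolded carr], of i] that by blast
      ultimately show "red c i = c i" by (cases "i < r") (auto simp: red_def)
    qed
    hence "coset_of L v = coset_of L (lin_comb r c x)" using c F[of c] by (simp add: F_def)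
    hence "v - lin_comb (length ns) c x \<in> L" unfolding coset_of_eq_iff[OF L] r_def .
    thus "\<exists>c. v - lin_comb (length ns) c x \<in> L" by (rule exI[of _ c])
  qed
  ultimately show ?thesis using that xV by blast
qed

end

section \<open>Krull monoids with finite class group\<close>

lemma lin_comb_cong: "(\<And>i. i < r \<Longrightarrow> frag_cmul (c i) (x i) = frag_cmul (c' i) (x' i)) \<Longrightarrow> lin_comb r c x = lin_comb r c' x'"
  unfolding lin_comb_def by (rule sum.cong) auto

lemma lin_comb_Suc: "lin_comb (Suc r) c x = lin_comb r c x + frag_cmul (c r) (x r)"
  by (simp add: lin_comb_def)

lemma frag_cmul_lin_comb: "frag_cmul a (lin_comb r c x) = lin_comb r (\<lambda>i. a * c i) x"
  by (simp add: lin_comb_def frag.scale_sum_right)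

lemma independent_mod_prefix:
  assumes "independent_mod L (replicate k n) y" "t \<le> k"
  shows "independent_mod L (replicate t n) y"
  unfolding independent_mod_def
proof
  fix c
  have "lin_comb k (\<lambda>i. if i < t then c i else 0) y = lin_comb t c y"
    unfolding lin_comb_def using assms(2)
    by (intro sum.mono_neutral_cong_right) auto
  moreover have "(\<forall>i<k. int n dvd (if i < t then c i else 0)) \<longleftrightarrow> (\<forall>i<t. int n dvd c i)"
    using assms(2) by auto
  ultimately show "lin_comb (length (replicate t n)) c y \<in> L \<longleftrightarrow> (\<forall>i<length (replicate t n). int (replicate t n ! i) dvd c i)"
    using assms(1) by (auto simp: independent_mod_def) (metis (no_types, lifting))+
qed

lemma frag_of_mset_eq_sum:
  assumes "finite S" "set_mset A \<subseteq> S"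
  shows "frag_of_mset A = (\<Sum>p\<in>S. frag_cmul (int (count A p)) (frag_of p))"
  using assms(2)
proof (induction A)
  case (add q A)
  have "(\<Sum>p\<in>S. frag_cmul (int (count (add_mset q A) p)) (frag_of p))
    = (\<Sum>p\<in>S. (if p = q then frag_of q else 0) + frag_cmul (int (count A p)) (frag_of p))"
    by (intro sum.cong) (auto simp: frag_cmul_distrib)
  also have "\<dots> = frag_of q + frag_of_mset A" using add assms(1) by (simp add: sum.distrib)
  finally show ?case by simp
qed simp

lemma (in divisor_hom) subspace_principal_quotients:
  "frag.subspace (principal_quotients H \<phi>)"
proof (rule frag.subspaceI)
  show "0 \<in> principal_quotients H \<phi>" by (rule principal_quotients_zero)
  have neg: "- v \<in> principal_quotients H \<phi>" if "v \<in> principal_quotients H \<phi>" for v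
    using principal_quotients_diff[OF principal_quotients_zero that] by simp
  show add: "v + w \<in> principal_quotients H \<phi>" if "v \<in> principal_quotients H \<phi>" "w \<in> principal_quotients H \<phi>" for v w
    using principal_quotients_diff[OF that(1) neg[OF that(2)]] by simp
  show "frag_cmul c v \<in> principal_quotients H \<phi>" if v: "v \<in> principal_quotients H \<phi>" for c v
  proof (induction c rule: int_induct[where k = 0])
    case base thus ?case by (simp add: principal_quotients_zero)
  next
    case (step1 i) thus ?case using add[OF _ v] by (simp add: frag_cmul_distrib)
  next
    case (step2 i) thus ?case using principal_quotients_diff[OF _ v] by (simp add: frag.scale_left_diff_distrib)
  qed
qed

text \<open>Classes enter through representatives \<open>v\<close>, and \<open>x\<close> is a basis
  of the class group adapted to the invariant factors \<open>ns\<close>.\<close>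

locale krull_finite_class_group = divisor_hom H P \<phi>
  for H :: "('a, 'b) monoid_scheme" (structure) and P :: "'p set" and \<phi> :: "'a \<Rightarrow> 'p multiset" +
  fixes ns :: "nat list" and x :: "nat \<Rightarrow> 'p \<Rightarrow>\<^sub>0 int"
  assumes prime_in_class: "Poly_Mapping.keys v \<subseteq> P \<Longrightarrow> \<exists>p\<in>P. frag_of p - v \<in> principal_quotients H \<phi>"
    and ns: "ns \<noteq> []" "\<And>m. m \<in> set ns \<Longrightarrow> 1 < m" "sorted_wrt (dvd) ns"
    and gen: "generating_mod (carrier (free_Abelian_group P)) (principal_quotients H \<phi>) (length ns) x"
    and ind: "independent_mod (principal_quotients H \<phi>) ns x"
begin

abbreviation "L \<equiv> principal_quotients H \<phi>"

lemmas L_subspace = subspace_principal_quotients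

sublocale quot: free_abelian_quotient P L
  by unfold_locales (rule L_subspace, rule principal_quotients_keys)

definition n :: nat where "n = last ns"
definition r :: nat where "r = length ns"

lemma n_gt_1: "1 < n" using ns by (simp add: n_def)

lemma nth_dvd_n: "i < r \<Longrightarrow> ns ! i dvd n"
  using sorted_wrt_nth_less[OF ns(3), of i "r - 1"] ns(1)
  by (cases "i = r - 1") (auto simp: r_def n_def last_conv_nth)

lemma hd_dvd_nth: "i < r \<Longrightarrow> ns ! 0 dvd ns ! i"
  using sorted_wrt_nth_less[OF ns(3), of 0 i] by (cases "i = 0") (auto simp: r_def)

lemma kill:
  assumes "v \<in> quot.V" shows "frag_cmul (int n) v \<in> L"
proof -
  obtain c where c: "v - lin_comb r c x \<in> L" using gen assms unfolding generating_mod_def r_def by blast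
  have "lin_comb r (\<lambda>i. int n * c i) x \<in> L"
    using ind nth_dvd_n by (auto simp: independent_mod_def r_def intro!: dvd_mult2)
  hence "frag_cmul (int n) (lin_comb r c x) \<in> L" by (simp add: frag_cmul_lin_comb)
  from frag.subspace_add[OF L_subspace frag.subspace_scale[OF L_subspace c, of "int n"] this]
  show ?thesis by (simp add: frag.scale_right_diff_distrib)
qed

lemma block_monoid: "Q \<subseteq> P \<Longrightarrow> block_monoid (zero_class Q) n"
  using n_gt_1 kill by (intro block_monoid_zero_class) auto

text \<open>Turns an integer combination of primes into a multiset of the same class; negative
  coefficients disappear because \<open>n\<close> kills the class group.\<close>

definition reduced_mset :: "'p set \<Rightarrow> ('p \<Rightarrow> int) \<Rightarrow> 'p multiset" where
  "reduced_mset E c = (\<Sum>e\<in>E. replicate_mset (nat (c e mod int n)) e)"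

lemma reduced_mset:
  assumes E: "finite E" "E \<subseteq> P"
  shows count_reduced: "e \<in> E \<Longrightarrow> int (count (reduced_mset E c) e) = c e mod int n"
    and set_reduced: "set_mset (reduced_mset E c) \<subseteq> E"
    and reduced_in: "(\<Sum>e\<in>E. frag_cmul (c e) (frag_of e)) \<in> L \<Longrightarrow> frag_of_mset (reduced_mset E c) \<in> L"
proof -
  have cnt: "count (reduced_mset E c) e = (if e \<in> E then nat (c e mod int n) else 0)" for e
    using E by (simp add: reduced_mset_def count_sum)
  show "e \<in> E \<Longrightarrow> int (count (reduced_mset E c) e) = c e mod int n" using n_gt_1 by (simp add: cnt)
  show sub: "set_mset (reduced_mset E c) \<subseteq> E"
  proof
    fix e assume "e \<in># reduced_mset E c"
    hence "0 < count (reduced_mset E c) e" by simp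
    thus "e \<in> E" by (simp add: cnt split: if_splits)
  qed
  assume s: "(\<Sum>e\<in>E. frag_cmul (c e) (frag_of e)) \<in> L"
  have "frag_of_mset (reduced_mset E c) = (\<Sum>e\<in>E. frag_cmul (c e mod int n) (frag_of e))"
    unfolding frag_of_mset_eq_sum[OF E(1) sub] using n_gt_1 by (intro sum.cong) (auto simp: cnt)
  also have "\<dots> = (\<Sum>e\<in>E. frag_cmul (c e) (frag_of e) - frag_cmul (c e div int n) (frag_cmul (int n) (frag_of e)))"
    by (intro sum.cong) (auto simp: minus_div_mult_eq_mod[symmetric] frag.scale_left_diff_distrib)
  also have "\<dots> = (\<Sum>e\<in>E. frag_cmul (c e) (frag_of e)) - (\<Sum>e\<in>E. frag_cmul (c e div int n) (frag_cmul (int n) (frag_of e)))"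
    by (rule sum_subtractf)
  also have "\<dots> \<in> L"
  proof (rule frag.subspace_diff[OF L_subspace s], rule frag.subspace_sum[OF L_subspace])
    fix e assume "e \<in> E"
    hence "frag_cmul (int n) (frag_of e) \<in> L" using kill[of "frag_of e"] E by auto
    thus "frag_cmul (c e div int n) (frag_cmul (int n) (frag_of e)) \<in> L" by (rule frag.subspace_scale[OF L_subspace])
  qed
  finally show "frag_of_mset (reduced_mset E c) \<in> L" .
qed

section \<open>Upper bound for the class group\<close>

lemma independent_length_le:
  assumes "\<And>i. i < k \<Longrightarrow> y i \<in> quot.V" "independent_mod L (replicate k n) y"
  shows "k \<le> r"
proof (rule ccontr)
  assume "\<not> k \<le> r"
  then obtain a where a: "\<exists>e\<in>{..<k}. \<not> int n dvd a e" "(\<Sum>e<k. frag_cmul (a e) (y e)) \<in> L"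
    using ex_relation_mod[OF L_subspace gen[folded r_def], of "{..<k}" y "int n"] assms(1) n_gt_1 by auto
  thus False using assms(2) by (auto simp: independent_mod_def lin_comb_def)
qed

lemma minimal_distances_upper:
  assumes max: "\<And>j. 1 \<le> j \<Longrightarrow> has_subgroup_iso quot.Q (cyclic_power n j) \<Longrightarrow> j \<le> k"
    and D: "D \<in> minimal_distances H"
  shows "D \<in> {1..max (int r - 1) (int n div 2 - 1)} \<union> {max 1 (int n - int k - 1)..int n - 2}"
proof -
  obtain Q where Q: "Q \<subseteq> P" "zdistances (zero_class Q) \<noteq> {}" and Dd: "D = int (LEAST d. d \<in> zdistances (zero_class Q))"
    using D unfolding minimal_distances_eq by blast
  define d where "d = (LEAST d. d \<in> zdistances (zero_class Q))"
  interpret block_monoid "zero_class Q" n by (rule block_monoid[OF Q(1)])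
  note ld = least_distance[OF Q(2), folded d_def]
  interpret distance_divisor "zero_class Q" n d
    by unfold_locales (use ld(1,2) zlengths_Z in blast)+
  have suppQ: "supp \<subseteq> Q" using n_pos by (auto simp: supp_def zero_class_def)
  \<comment> \<open>The outcomes are a light atom with \<open>d \<ge> \<lfloor>n/2\<rfloor>\<close>,
    a \<open>d\<close> below \<open>\<lfloor>n/2\<rfloor>\<close>, or a set of large cross number,
    whose bound \<open>2 * d + 3 \<le> n\<close> is absorbed by the second.\<close>
  have "(d + 2 \<le> n \<and> n \<le> k + d + 1) \<or> 2 * d + 2 \<le> n \<or> d + 1 \<le> r"
  proof (cases "\<exists>U. zatom (zero_class Q) U \<and> wt U < n")
    case True
    then obtain U where U: "zatom (zero_class Q) U" "wt U < n" by blast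
    show ?thesis
    proof (cases "n \<le> 2 * d + 1")
      case half: True
      have d2: "d + 2 \<le> n" by (rule light_atom_wt(2)[OF U half])
      obtain E where E: "E \<subseteq> supp" "finite E" "card E = n - d - 1"
        and Ei: "\<And>A p. zero_class Q A \<Longrightarrow> set_mset A \<subseteq> E \<Longrightarrow> n dvd count A p"
        using light_atom_independent[OF U half] by blast
      have EP: "E \<subseteq> P" using E suppQ Q by blast
      define s where "s = n - d - 1"
      obtain f where f: "bij_betw f {..<s} E"
        using ex_bij_betw_nat_finite[OF E(2)] E(3) by (auto simp: s_def atLeast0LessThan)
      define y where "y = (\<lambda>i. frag_of (f i))"
      have fE: "f i \<in> E" if "i < s" for i using f that by (auto simp: bij_betw_def)
      have yV: "y i \<in> quot.V" if "i < s" for i using fE[OF that] EP by (auto simp: y_def)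
      have ind_y: "independent_mod L (replicate s n) y"
        unfolding independent_mod_def
      proof
        fix c :: "nat \<Rightarrow> int"
        \<comment> \<open>Coefficients are moved from indices to primes and then reduced modulo
          \<open>n\<close>, so that the statement on multisets over \<open>E\<close>
          applies.\<close>
        define c' where "c' = (\<lambda>e. c (the_inv_into {..<s} f e))"
        have c'f: "c' (f i) = c i" if "i < s" for i
          using f that by (simp add: c'_def the_inv_into_f_f bij_betw_def)
        have lc: "lin_comb s c y = (\<Sum>e\<in>E. frag_cmul (c' e) (frag_of e))"
          unfolding lin_comb_def y_def using f c'f by (intro sum.reindex_bij_betw[OF f, THEN trans[rotated]] sum.cong) auto
        have "lin_comb s c y \<in> L \<longleftrightarrow> (\<forall>i<s. int n dvd c i)"
        proof
          assume "lin_comb s c y \<in> L"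
          hence "frag_of_mset (reduced_mset E c') \<in> L" unfolding lc by (rule reduced_in[OF E(2) EP])
          hence zc: "zero_class Q (reduced_mset E c')"
            using set_reduced[OF E(2) EP] E suppQ by (auto simp: zero_class_def)
          show "\<forall>i<s. int n dvd c i"
          proof (intro allI impI)
            fix i assume i: "i < s"
            have "n dvd count (reduced_mset E c') (f i)" by (rule Ei[OF zc set_reduced[OF E(2) EP]])
            hence "int n dvd c' (f i) mod int n" unfolding count_reduced[OF E(2) EP fE[OF i], symmetric] by simp
            thus "int n dvd c i" using c'f[OF i] by (simp add: dvd_mod_iff)
          qed
        next
          assume dv: "\<forall>i<s. int n dvd c i"
          show "lin_comb s c y \<in> L" unfolding lin_comb_def
          proof (rule frag.subspace_sum[OF L_subspace])
            fix i assume i: "i \<in> {..<s}"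
            then obtain t where "c i = t * int n" using dv by (metis dvdE lessThan_iff mult.commute)
            thus "frag_cmul (c i) (y i) \<in> L"
              using frag.subspace_scale[OF L_subspace kill[OF yV[of i]], of t] i by simp
          qed
        qed
        thus "lin_comb (length (replicate s n)) c y \<in> L \<longleftrightarrow> (\<forall>i<length (replicate s n). int (replicate s n ! i) dvd c i)"
          by auto
      qed
      have "has_subgroup_iso quot.Q (cyclic_power n s)"
      proof (rule quot.subgroup_iso_cyclic_sum[of "replicate s n" y])
        show "0 < replicate s n ! i" if "i < length (replicate s n)" for i using that n_pos by simp
        show "y i \<in> quot.V" if "i < length (replicate s n)" for i using that yV by simp
        show "independent_mod L (replicate s n) y" by (rule ind_y)
      qed (auto simp: has_subgroup_iso_def cyclic_power_def)
      hence "s \<le> k" using max[of s] d2 by (simp add: s_def)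
      hence "n \<le> k + d + 1" unfolding s_def by arith
      thus ?thesis using d2 by simp
    qed simp
  next
    case False
    have "d + 1 \<le> r \<or> 2 * d + 3 \<le> n"
    proof (rule large_cross_number_bound)
      show "n \<le> wt a" if "zatom (zero_class Q) a" for a using False that by (metis not_le)
      obtain A l where "l \<in> zlengths (zero_class Q) A" "l + d \<in> zlengths (zero_class Q) A" using ld(3) by blast
      thus "\<exists>a. zatom (zero_class Q) a \<and> wt a \<noteq> n" using not_half_factorial d_pos by (metis less_add_same_cancel1 less_irrefl)
      fix E q assume E: "E \<subseteq> supp" "finite E" "card E = Suc r" and q: "Factorial_Ring.prime q" "q dvd n"
      have EP: "E \<subseteq> P" using E suppQ Q by blast
      have q': "int q \<noteq> 0" "\<not> is_unit (int q)" using q(1) by (auto simp: prime_nat_iff)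
      obtain a where a: "\<exists>e\<in>E. \<not> int q dvd a e" "(\<Sum>e\<in>E. frag_cmul (a e) (frag_of e)) \<in> L"
        using ex_relation_mod[OF L_subspace gen[folded r_def] E(2) _ _ q', of frag_of] E(3) EP by auto
      then obtain e where e: "e \<in> E" "\<not> int q dvd a e" by blast
      have "zero_class Q (reduced_mset E a)"
        using reduced_in[OF E(2) EP a(2)] set_reduced[OF E(2) EP] E suppQ by (auto simp: zero_class_def)
      \<comment> \<open>Since \<open>q\<close> divides \<open>n\<close>, reducing coefficients
        modulo \<open>n\<close> preserves divisibility by \<open>q\<close>.\<close>
      moreover have "\<not> q dvd count (reduced_mset E a) e"
      proof
        assume "q dvd count (reduced_mset E a) e"
        hence "int q dvd a e mod int n" unfolding count_reduced[OF E(2) EP e(1), symmetric] by simp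
        moreover have "int q dvd int n" using q(2) by simp
        ultimately show False using e(2) by (metis dvd_mod_iff)
      qed
      ultimately show "\<exists>A. zero_class Q A \<and> set_mset A \<subseteq> E \<and> (\<exists>e\<in>E. \<not> q dvd count A e)"
        using set_reduced[OF E(2) EP] e(1) by blast
    qed
    thus ?thesis by auto
  qed
  thus ?thesis using d_pos unfolding Dd d_def[symmetric] by auto
qed

section \<open>Primes in prescribed classes and the distances they realize\<close>

definition prime_of :: "('p \<Rightarrow>\<^sub>0 int) \<Rightarrow> 'p" where
  "prime_of v = (SOME p. p \<in> P \<and> frag_of p - v \<in> L)"

lemma prime_of: "v \<in> quot.V \<Longrightarrow> prime_of v \<in> P" "v \<in> quot.V \<Longrightarrow> frag_of (prime_of v) - v \<in> L"
  using prime_in_class[of v] someI_ex[of "\<lambda>p. p \<in> P \<and> frag_of p - v \<in> L"] by (auto simp: prime_of_def)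

lemma prime_of_eqD:
  assumes "v \<in> quot.V" "w \<in> quot.V" "prime_of v = prime_of w" shows "v - w \<in> L"
proof -
  have "(frag_of (prime_of w) - w) - (frag_of (prime_of v) - v) \<in> L"
    by (rule frag.subspace_diff[OF L_subspace prime_of(2)[OF assms(2)] prime_of(2)[OF assms(1)]])
  thus ?thesis using assms(3) by simp
qed

lemma inj_prime_of:
  fixes s :: nat
  assumes "\<And>i. i < s \<Longrightarrow> z i \<in> quot.V" "\<And>i j. i < j \<Longrightarrow> j < s \<Longrightarrow> z i - z j \<notin> L"
  shows "inj_on (\<lambda>i. prime_of (z i)) {..<s}"
proof (rule inj_onI)
  fix i j assume ij: "i \<in> {..<s}" "j \<in> {..<s}" "prime_of (z i) = prime_of (z j)"
  have "\<not> i < j" using prime_of_eqD[of "z i" "z j"] ij assms by auto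
  moreover have "\<not> j < i" using prime_of_eqD[of "z j" "z i"] ij assms by auto
  ultimately show "i = j" by simp
qed

text \<open>Replacing each prime by the representative \<open>z i\<close> of its class changes the
  formal sum by an element of \<open>L\<close>.\<close>

lemma zero_class_prime_of:
  assumes z: "\<And>i. i < s \<Longrightarrow> z i \<in> quot.V" and inj: "inj_on (\<lambda>i. prime_of (z i)) {..<s}"
  shows "zero_class ((\<lambda>i. prime_of (z i)) ` {..<s}) A \<longleftrightarrow>
    set_mset A \<subseteq> (\<lambda>i. prime_of (z i)) ` {..<s} \<and> lin_comb s (\<lambda>i. int (count A (prime_of (z i)))) z \<in> L"
proof -
  have "frag_of_mset A \<in> L \<longleftrightarrow> lin_comb s (\<lambda>i. int (count A (prime_of (z i)))) z \<in> L"
    if A: "set_mset A \<subseteq> (\<lambda>i. prime_of (z i)) ` {..<s}"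
  proof -
    have "frag_of_mset A = lin_comb s (\<lambda>i. int (count A (prime_of (z i)))) (\<lambda>i. frag_of (prime_of (z i)))"
      unfolding frag_of_mset_eq_sum[OF finite_imageI[OF finite_lessThan] A] lin_comb_def
      by (simp add: sum.reindex[OF inj])
    hence "frag_of_mset A - lin_comb s (\<lambda>i. int (count A (prime_of (z i)))) z =
      (\<Sum>i<s. frag_cmul (int (count A (prime_of (z i)))) (frag_of (prime_of (z i)) - z i))"
      by (simp add: lin_comb_def frag.scale_right_diff_distrib sum_subtractf)
    also have "\<dots> \<in> L"
      using prime_of(2) z by (intro frag.subspace_sum[OF L_subspace] frag.subspace_scale[OF L_subspace]) auto
    finally have d: "frag_of_mset A - lin_comb s (\<lambda>i. int (count A (prime_of (z i)))) z \<in> L" .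
    show ?thesis
    proof
      assume "frag_of_mset A \<in> L"
      from frag.subspace_diff[OF L_subspace this d] show "lin_comb s (\<lambda>i. int (count A (prime_of (z i)))) z \<in> L" by simp
    next
      assume "lin_comb s (\<lambda>i. int (count A (prime_of (z i)))) z \<in> L"
      from frag.subspace_add[OF L_subspace d this] show "frag_of_mset A \<in> L" by simp
    qed
  qed
  thus ?thesis by (auto simp: zero_class_def)
qed

lemma minimal_distancesI:
  assumes "Q \<subseteq> P" "(LEAST d. d \<in> zdistances (zero_class Q)) = d" "zdistances (zero_class Q) \<noteq> {}"
  shows "int d \<in> minimal_distances H"
  unfolding minimal_distances_eq using assms by blast

lemma independent_lin_comb_iff:
  "independent_mod L (replicate t q) y \<Longrightarrow> lin_comb t c y \<in> L \<longleftrightarrow> (\<forall>i<t. int q dvd c i)"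
  by (auto simp: independent_mod_def)

text \<open>The family \<open>e\<^sub>1, \<dots>, e\<^sub>t, a (e\<^sub>1 + \<dots> + e\<^sub>t)\<close> with \<open>a = 1\<close> or \<open>a = - 1\<close>; the side conditions exclude
  coincidences between its members.\<close>

lemma sum_extended:
  assumes y: "\<And>i. i < t \<Longrightarrow> y i \<in> quot.V" and ind: "independent_mod L (replicate t q) y"
    and q: "2 \<le> q" and a: "a = 1 \<and> 2 \<le> t \<or> a = -1 \<and> 3 \<le> q \<and> 1 \<le> t"
    and z_def: "z = (\<lambda>i. if i < t then y i else lin_comb t (\<lambda>_. a) y)"
  shows "i < Suc t \<Longrightarrow> z i \<in> quot.V" "inj_on (\<lambda>i. prime_of (z i)) {..<Suc t}"
    and "lin_comb (Suc t) c z \<in> L \<longleftrightarrow> (\<forall>i<t. int q dvd c i + a * c t)"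
proof -
  show zV: "z i \<in> quot.V" if "i < Suc t" for i
    using y lin_comb_in[OF quot.V, of t y "\<lambda>_. a"] by (auto simp: z_def)
  have lz: "lin_comb (Suc t) c z = lin_comb t (\<lambda>i. c i + a * c t) y" for c
  proof -
    have "lin_comb t c z = lin_comb t c y" by (rule lin_comb_cong) (simp add: z_def)
    moreover have "frag_cmul (c t) (z t) = lin_comb t (\<lambda>i. a * c t) y"
      by (simp add: z_def frag_cmul_lin_comb mult.commute)
    ultimately show ?thesis by (simp add: lin_comb_Suc lin_comb_add)
  qed
  show zL: "lin_comb (Suc t) c z \<in> L \<longleftrightarrow> (\<forall>i<t. int q dvd c i + a * c t)" for c
    unfolding lz by (rule independent_lin_comb_iff[OF ind])
  show "inj_on (\<lambda>i. prime_of (z i)) {..<Suc t}"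
  proof (rule inj_prime_of[OF zV])
    fix i j assume ij: "i < j" "j < Suc t"
    define c where "c = (\<lambda>l. if l = i then 1 else if l = j then -1 else (0::int))"
    have "z i - z j = lin_comb (Suc t) c z"
    proof -
      have "lin_comb (Suc t) c z = (\<Sum>l<Suc t. (if l = i then z i else 0) + (if l = j then - z j else 0))"
        unfolding lin_comb_def using ij by (intro sum.cong) (auto simp: c_def)
      also have "\<dots> = z i - z j" unfolding sum.distrib using ij by simp
      finally show ?thesis ..
    qed
    moreover have "lin_comb (Suc t) c z \<notin> L"
    proof
      assume "lin_comb (Suc t) c z \<in> L"
      hence dv: "int q dvd c l + a * c t" if "l < t" for l using zL that by blast
      show False
      proof (cases "j = t")
        case False
        hence "c t = 0" "c i = 1" using ij by (auto simp: c_def)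
        hence "int q dvd 1" using dv[of i] ij by simp
        thus False using q by simp
      next
        case True
        hence ct: "c t = -1" "c i = 1" using ij by (auto simp: c_def)
        \<comment> \<open>Coincidence of \<open>y i\<close> with the extra member: for
          \<open>a = 1\<close> another index \<open>l\<close> yields that \<open>q\<close> divides
          \<open>1\<close>, for \<open>a = - 1\<close> the index \<open>i\<close> itself yields that
          \<open>q\<close> divides \<open>2\<close>.\<close>
        show False
        proof (cases "a = 1")
          case True
          hence t: "2 \<le> t" using a by simp
          define l where "l = (if i = 0 then 1 else 0 :: nat)"
          have "l < t" "l \<noteq> i" "l \<noteq> t" using t by (auto simp: l_def)
          hence "int q dvd 1" using dv[of l] ct \<open>a = 1\<close> \<open>j = t\<close> by (auto simp: c_def)
          thus False using q by simp
        next
          case False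
          hence "int q dvd 2" using dv[of i] ct a ij True by auto
          hence "int q \<le> 2" by (rule zdvd_imp_le) simp
          thus False using a False by simp
        qed
      qed
    qed
    ultimately show "z i - z j \<notin> L" by simp
  qed
qed

text \<open>\<open>s\<close> counts the letters: \<open>s - 1\<close> independent elements of order
  \<open>n\<close> and the negative of their sum. As \<open>s \<le> k + 1\<close>, the distances
  start at \<open>n - k - 1\<close>.\<close>

lemma minimal_distances_simplex:
  assumes y: "\<And>i. i < k \<Longrightarrow> y i \<in> quot.V" "independent_mod L (replicate k n) y" and s: "2 \<le> s" "s \<le> k + 1" "s < n"
  shows "int (n - s) \<in> minimal_distances H"
proof -
  define t where "t = s - 1"
  have t: "s = Suc t" "1 \<le> t" "t \<le> k" "3 \<le> n" using s by (auto simp: t_def)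
  define z where "z = (\<lambda>i. if i < t then y i else lin_comb t (\<lambda>_. -1) y)"
  have yt: "\<And>i. i < t \<Longrightarrow> y i \<in> quot.V" using y(1) t by simp
  have q: "2 \<le> n" and a: "(-1::int) = 1 \<and> 2 \<le> t \<or> (-1::int) = -1 \<and> 3 \<le> n \<and> 1 \<le> t" using t by auto
  have ext1: "i < Suc t \<Longrightarrow> z i \<in> quot.V" for i by (rule sum_extended(1)[OF yt independent_mod_prefix[OF y(2) t(3)] q a z_def])
  have ext2: "inj_on (\<lambda>i. prime_of (z i)) {..<Suc t}" by (rule sum_extended(2)[OF yt independent_mod_prefix[OF y(2) t(3)] q a z_def])
  have ext3: "lin_comb (Suc t) c z \<in> L \<longleftrightarrow> (\<forall>i<t. int n dvd c i + (-1) * c t)" for c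
    by (rule sum_extended(3)[OF yt independent_mod_prefix[OF y(2) t(3)] q a z_def])
  define Q where "Q = (\<lambda>i. prime_of (z i)) ` {..<s}"
  have QP: "Q \<subseteq> P" using ext1 prime_of(1) t(1) by (auto simp: Q_def)
  interpret block_monoid "zero_class Q" n by (rule block_monoid[OF QP])
  have zc: "zero_class Q A \<longleftrightarrow> set_mset A \<subseteq> Q \<and> (\<forall>p\<in>Q. \<forall>p'\<in>Q. count A p mod n = count A p' mod n)" for A
  proof -
    have e1: "zero_class ((\<lambda>i. prime_of (z i)) ` {..<Suc t}) A \<longleftrightarrow> set_mset A \<subseteq> (\<lambda>i. prime_of (z i)) ` {..<Suc t} \<and>
      lin_comb (Suc t) (\<lambda>i. int (count A (prime_of (z i)))) z \<in> L"
      by (rule zero_class_prime_of[of "Suc t" z A, OF ext1 ext2])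
    have "zero_class Q A \<longleftrightarrow> set_mset A \<subseteq> Q \<and>
      (\<forall>i<t. int n dvd int (count A (prime_of (z i))) + (-1) * int (count A (prime_of (z t))))"
      using e1 unfolding ext3 Q_def t(1) .
    also have "\<dots> \<longleftrightarrow> set_mset A \<subseteq> Q \<and> (\<forall>i<t. count A (prime_of (z i)) mod n = count A (prime_of (z t)) mod n)"
      by (simp add: mod_eq_dvd_iff[symmetric] zmod_int[symmetric])
    also have "\<dots> \<longleftrightarrow> set_mset A \<subseteq> Q \<and> (\<forall>i<s. \<forall>j<s. count A (prime_of (z i)) mod n = count A (prime_of (z j)) mod n)"
      unfolding t(1) by (metis less_Suc_eq)
    also have "\<dots> \<longleftrightarrow> set_mset A \<subseteq> Q \<and>
      (\<forall>i\<in>{..<s}. \<forall>j\<in>{..<s}. count A (prime_of (z i)) mod n = count A (prime_of (z j)) mod n)"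
      by (simp add: Ball_def)
    finally show ?thesis by (simp add: Q_def)
  qed
  have "card Q = s" unfolding Q_def using card_image[OF ext2] t(1) by simp
  thus ?thesis using least_distance_simplex[OF _ _ s(1,3) zc] QP
    by (intro minimal_distancesI[of Q]) (auto simp: Q_def)
qed

text \<open>Distances up to \<open>r - 1\<close> call for as many as \<open>r\<close> independent
  elements of one common order. The basis elements provide them after being multiplied down to order
  \<open>ns ! 0\<close>, which divides every other invariant factor.\<close>

lemma minimal_distances_star:
  assumes t: "2 \<le> t" "t \<le> r"
  shows "int (t - 1) \<in> minimal_distances H"
proof -
  define q where "q = ns ! 0"
  have r0: "0 < r" using ns(1) by (simp add: r_def)
  have q2: "2 \<le> q" using ns(2)[of q] r0 by (simp add: q_def r_def Suc_le_eq)
  define y where "y = (\<lambda>i. frag_cmul (int (ns ! i div q)) (x i))"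
  have yV: "y i \<in> quot.V" if "i < t" for i
    unfolding y_def using gen that t by (intro frag.subspace_scale[OF quot.V]) (auto simp: generating_mod_def r_def)
  have "independent_mod L (replicate t q) y"
    unfolding independent_mod_def
  proof
    fix c :: "nat \<Rightarrow> int"
    have "lin_comb t c y = lin_comb r (\<lambda>i. if i < t then c i * int (ns ! i div q) else 0) x"
      unfolding lin_comb_def using t(2) by (intro sum.mono_neutral_cong_left) (auto simp: y_def)
    hence "lin_comb t c y \<in> L \<longleftrightarrow> (\<forall>i<r. int (ns ! i) dvd (if i < t then c i * int (ns ! i div q) else 0))"
      using ind by (simp add: independent_mod_def r_def)
    also have "\<dots> \<longleftrightarrow> (\<forall>i<t. int (ns ! i) dvd c i * int (ns ! i div q))" using t(2) by auto
    also have "\<dots> \<longleftrightarrow> (\<forall>i<t. int q dvd c i)"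
    proof -
      have "int (ns ! i) dvd c i * int (ns ! i div q) \<longleftrightarrow> int q dvd c i" if i: "i < t" for i
      proof -
        have "q dvd ns ! i" using hd_dvd_nth[of i] i t by (simp add: q_def)
        then obtain w where w: "ns ! i = q * w" by blast
        moreover have "0 < ns ! i" using ns(2)[of "ns ! i"] i t by (simp add: r_def)
        ultimately have "0 < w" "ns ! i div q = w" using q2 by auto
        thus ?thesis using w by simp
      qed
      thus ?thesis by simp
    qed
    finally show "lin_comb (length (replicate t q)) c y \<in> L \<longleftrightarrow> (\<forall>i<length (replicate t q). int (replicate t q ! i) dvd c i)"
      by auto
  qed
  note indy = this
  define z where "z = (\<lambda>i. if i < t then y i else lin_comb t (\<lambda>_. 1) y)"
  have a: "(1::int) = 1 \<and> 2 \<le> t \<or> (1::int) = -1 \<and> 3 \<le> q \<and> 1 \<le> t" using t by auto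
  have ext1: "i < Suc t \<Longrightarrow> z i \<in> quot.V" for i by (rule sum_extended(1)[OF yV indy q2 a z_def])
  have ext2: "inj_on (\<lambda>i. prime_of (z i)) {..<Suc t}" by (rule sum_extended(2)[OF yV indy q2 a z_def])
  have ext3: "lin_comb (Suc t) c z \<in> L \<longleftrightarrow> (\<forall>i<t. int q dvd c i + 1 * c t)" for c
    by (rule sum_extended(3)[OF yV indy q2 a z_def])
  define Q' where "Q' = (\<lambda>i. prime_of (z i)) ` {..<t}"
  define Q where "Q = insert (prime_of (z t)) Q'"
  have Q: "Q = (\<lambda>i. prime_of (z i)) ` {..<Suc t}" by (auto simp: Q_def Q'_def less_Suc_eq)
  have QP: "Q \<subseteq> P" using ext1 prime_of(1) by (auto simp: Q)
  interpret block_monoid "zero_class Q" n by (rule block_monoid[OF QP])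
  have e1: "zero_class ((\<lambda>i. prime_of (z i)) ` {..<Suc t}) A \<longleftrightarrow> set_mset A \<subseteq> (\<lambda>i. prime_of (z i)) ` {..<Suc t} \<and>
      lin_comb (Suc t) (\<lambda>i. int (count A (prime_of (z i)))) z \<in> L" for A
    by (rule zero_class_prime_of[of "Suc t" z A, OF ext1 ext2])
  have "zero_class Q A \<longleftrightarrow> set_mset A \<subseteq> Q \<and>
      (\<forall>i<t. int q dvd int (count A (prime_of (z i))) + 1 * int (count A (prime_of (z t))))" for A
    using e1[of A] unfolding ext3 Q .
  hence "zero_class Q A \<longleftrightarrow> set_mset A \<subseteq> Q \<and>
      (\<forall>i\<in>{..<t}. q dvd count A (prime_of (z i)) + count A (prime_of (z t)))" for A
    by (simp add: int_dvd_int_iff Ball_def flip: of_nat_add)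
  hence zc: "zero_class Q A \<longleftrightarrow> set_mset A \<subseteq> insert (prime_of (z t)) Q' \<and> (\<forall>p\<in>Q'. q dvd count A p + count A (prime_of (z t)))" for A
    by (simp add: Q_def Q'_def)
  have "card Q' = t" unfolding Q'_def using card_image[OF inj_on_subset[OF ext2], of "{..<t}"] by auto
  moreover have "prime_of (z t) \<notin> Q'" using ext2 unfolding Q'_def by (auto dest: inj_onD)
  moreover have "finite Q'" by (simp add: Q'_def)
  ultimately show ?thesis using least_distance_star[OF _ _ t(1) q2 _ zc] QP
    by (intro minimal_distancesI[of Q]) auto
qed

text \<open>Reduces sets inside a cyclic group to lists of integers modulo \<open>n\<close>; the
  assumption on \<open>as\<close> keeps the chosen primes distinct.\<close>

lemma cyclic_primes:
  assumes y: "v \<in> quot.V" "order_mod L v n"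
    and as: "\<And>i j. i < j \<Longrightarrow> j < length as \<Longrightarrow> \<not> int n dvd as ! i - as ! j"
  obtains ps where "length ps = length as" "distinct ps" "set ps \<subseteq> P"
    "\<forall>A. zero_class (set ps) A \<longleftrightarrow> set_mset A \<subseteq> set ps \<and> int n dvd (\<Sum>i<length as. int (count A (ps ! i)) * as ! i)"
proof -
  define s where "s = length as"
  define z where "z = (\<lambda>i. frag_cmul (as ! i) v)"
  have zV: "z i \<in> quot.V" for i unfolding z_def by (rule frag.subspace_scale[OF quot.V y(1)])
  have inj: "inj_on (\<lambda>i. prime_of (z i)) {..<s}"
  proof (rule inj_prime_of[OF zV])
    fix i j assume "i < j" "j < s"
    hence "\<not> int n dvd as ! i - as ! j" using as by (simp add: s_def)
    hence "frag_cmul (as ! i - as ! j) v \<notin> L" using y(2) by (simp add: order_mod_def)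
    thus "z i - z j \<notin> L" by (simp add: z_def frag.scale_left_diff_distrib)
  qed
  define ps where "ps = map (\<lambda>i. prime_of (z i)) [0..<s]"
  have sps: "set ps = (\<lambda>i. prime_of (z i)) ` {..<s}" by (auto simp: ps_def)
  have "zero_class (set ps) A \<longleftrightarrow> set_mset A \<subseteq> set ps \<and> int n dvd (\<Sum>i<s. int (count A (ps ! i)) * as ! i)" for A
  proof -
    have "lin_comb s (\<lambda>i. int (count A (prime_of (z i)))) z = frag_cmul (\<Sum>i<s. int (count A (ps ! i)) * as ! i) v"
      unfolding lin_comb_def frag.scale_sum_left by (intro sum.cong) (auto simp: z_def ps_def)
    thus ?thesis unfolding sps zero_class_prime_of[of s z, OF zV inj] using y(2) by (simp add: order_mod_def)
  qed
  moreover have "set ps \<subseteq> P" using zV prime_of(1) by (auto simp: sps)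
  moreover have "distinct ps" unfolding ps_def using inj by (simp add: distinct_map atLeast0LessThan)
  ultimately show ?thesis using that[of ps] by (simp add: s_def ps_def)
qed

lemma minimal_distances_cyclic:
  assumes y: "v \<in> quot.V" "order_mod L v n"
  shows "4 \<le> n \<Longrightarrow> int (n div 2 - 1) \<in> minimal_distances H" "5 \<le> n \<Longrightarrow> 1 \<in> minimal_distances H"
proof -
  have nd: "\<not> int n dvd a" if "a \<noteq> 0" "- int n < a" "a < int n" for a
    using dvd_small_imp_0 that by blast
  show "int (n div 2 - 1) \<in> minimal_distances H" if n4: "4 \<le> n"
  proof (cases "even n")
    case True
    define d where "d = n div 2 - 1"
    have d: "n = 2 * d + 2" "0 < d" using True n4 by (auto simp: d_def)
    \<comment> \<open>The last entry is \<open>n / 2\<close>; \<open>4 \<le> n\<close> gives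
      \<open>d > 0\<close> and keeps the three multiples distinct.\<close>
    define as :: "int list" where "as = [1, -1, int (d + 1)]"
    have nas: "\<not> int n dvd as ! i - as ! j" if ij: "i < j" "j < length as" for i j
    proof -
      have "(i = 0 \<and> j = 1) \<or> (i = 0 \<and> j = 2) \<or> (i = 1 \<and> j = 2)" using ij by (auto simp: as_def)
      thus ?thesis using d by (intro nd) (auto simp: as_def numeral_2_eq_2 numeral_3_eq_3)
    qed
    obtain ps where ps: "length ps = length as" "distinct ps" "set ps \<subseteq> P"
      "\<forall>A. zero_class (set ps) A \<longleftrightarrow> set_mset A \<subseteq> set ps \<and> int n dvd (\<Sum>i<length as. int (count A (ps ! i)) * as ! i)"
      by (rule cyclic_primes[OF y nas])
    obtain p q t where pqt: "ps = [p, q, t]" using ps(1) by (auto simp: as_def length_Suc_conv)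
    interpret block_monoid "zero_class {p, q, t}" n by (rule block_monoid) (use ps(3) pqt in auto)
    have "zero_class {p, q, t} A \<longleftrightarrow> set_mset A \<subseteq> {p, q, t} \<and>
      int n dvd int (count A p) - int (count A q) + int (d + 1) * int (count A t)" for A
      using ps(4)[rule_format, of A] by (simp add: pqt as_def algebra_simps)
    from least_distance_even[OF _ _ _ d(2,1) this] show ?thesis
      using ps(2,3) pqt unfolding d_def[symmetric] by (intro minimal_distancesI[of "{p, q, t}"]) auto
  next
    case False
    define d where "d = n div 2 - 1"
    have d: "n = 2 * d + 3" "0 < d" using False n4 by (auto simp: d_def elim!: oddE)
    define as :: "int list" where "as = [1, -2]"
    have nas: "\<not> int n dvd as ! i - as ! j" if ij: "i < j" "j < length as" for i j
    proof -
      have "i = 0 \<and> j = 1" using ij by (auto simp: as_def)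
      thus ?thesis using d by (intro nd) (auto simp: as_def numeral_2_eq_2 numeral_3_eq_3)
    qed
    obtain ps where ps: "length ps = length as" "distinct ps" "set ps \<subseteq> P"
      "\<forall>A. zero_class (set ps) A \<longleftrightarrow> set_mset A \<subseteq> set ps \<and> int n dvd (\<Sum>i<length as. int (count A (ps ! i)) * as ! i)"
      by (rule cyclic_primes[OF y nas])
    obtain p q where pq: "ps = [p, q]" using ps(1) by (auto simp: as_def length_Suc_conv)
    interpret block_monoid "zero_class {p, q}" n by (rule block_monoid) (use ps(3) pq in auto)
    have "zero_class {p, q} A \<longleftrightarrow> set_mset A \<subseteq> {p, q} \<and> int n dvd int (count A p) - 2 * int (count A q)" for A
      using ps(4)[rule_format, of A] by (simp add: pq as_def algebra_simps)
    from least_distance_odd[OF _ d(2,1) this] show ?thesis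
      using ps(2,3) pq unfolding d_def[symmetric] by (intro minimal_distancesI[of "{p, q}"]) auto
  qed
  show "1 \<in> minimal_distances H" if n5: "5 \<le> n"
  proof -
    \<comment> \<open>These four integers are distinct modulo \<open>n\<close> exactly from
      \<open>n = 5\<close> on.\<close>
    define as :: "int list" where "as = [1, -1, 2, -2]"
    have nas: "\<not> int n dvd as ! i - as ! j" if ij: "i < j" "j < length as" for i j
    proof -
      have "(i = 0 \<and> j = 1) \<or> (i = 0 \<and> j = 2) \<or> (i = 0 \<and> j = 3) \<or> (i = 1 \<and> j = 2) \<or> (i = 1 \<and> j = 3) \<or> (i = 2 \<and> j = 3)" using ij by (auto simp: as_def)
      thus ?thesis using n5 by (intro nd) (auto simp: as_def numeral_2_eq_2 numeral_3_eq_3)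
    qed
    obtain ps where ps: "length ps = length as" "distinct ps" "set ps \<subseteq> P"
      "\<forall>A. zero_class (set ps) A \<longleftrightarrow> set_mset A \<subseteq> set ps \<and> int n dvd (\<Sum>i<length as. int (count A (ps ! i)) * as ! i)"
      by (rule cyclic_primes[OF y nas])
    obtain p q s t where pqt: "ps = [p, q, s, t]" using ps(1) by (auto simp: as_def length_Suc_conv)
    interpret block_monoid "zero_class {p, q, s, t}" n by (rule block_monoid) (use ps(3) pqt in auto)
    have "zero_class {p, q, s, t} A \<longleftrightarrow> set_mset A \<subseteq> {p, q, s, t} \<and>
      int n dvd int (count A p) - int (count A q) + 2 * int (count A s) - 2 * int (count A t)" for A
      using ps(4)[rule_format, of A] by (simp add: pqt as_def algebra_simps)
    from least_distance_one[OF _ n5 this] have "int 1 \<in> minimal_distances H"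
      using ps(2,3) pqt by (intro minimal_distancesI[of "{p, q, s, t}"]) auto
    thus ?thesis by simp
  qed
qed

end

text \<open>The bookkeeping with intervals once the distances are known; \<open>k \<le> r\<close> is
  the link between the two intervals.\<close>

lemma minimal_distances_arithmetic:
  fixes M :: "int set" and n r k :: nat
  assumes n: "2 \<le> n" and kr: "k \<le> r" and k1: "1 \<le> k" and one: "1 \<in> M"
    and star: "\<And>d. 1 \<le> d \<Longrightarrow> d + 1 \<le> r \<Longrightarrow> int d \<in> M"
    and simplex: "\<And>d. 1 \<le> d \<Longrightarrow> n \<le> d + k + 1 \<Longrightarrow> d + 2 \<le> n \<Longrightarrow> int d \<in> M"
    and half: "4 \<le> n \<Longrightarrow> int (n div 2 - 1) \<in> M"
    and upper: "\<And>x. x \<in> M \<Longrightarrow> x \<in> {1..max (int r - 1) (int n div 2 - 1)} \<union> {max 1 (int n - int k - 1)..int n - 2}"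
  defines "B \<equiv> {1..max (int r - 1) (int n div 2 - 1)} \<union> {max 1 (int n - int k - 1)..int n - 2}"
  shows "{1..int r - 1} \<union> {max 1 (int n div 2 - 1)} \<union> {max 1 (int n - int k - 1)..int n - 2} \<subseteq> M"
    and "M \<subseteq> B"
    and "int r \<ge> int n div 2 - 1 \<longrightarrow> M = B"
    and "integer_interval M \<longleftrightarrow> max 1 (int n - int k - 2) \<in> M"
    and "max 1 (int n - int k - 2) \<in> M \<longleftrightarrow> int n - int k - 2 \<le> max (int r - 1) (int n div 2 - 1)"
    and "int n - int k - 2 \<le> max (int r - 1) (int n div 2 - 1) \<longleftrightarrow>
      int r + int k \<ge> int n - 1 \<or> int r + int k = int n - 2 \<and> n = 2 * r + 2 \<and> k = r"
proof -
  have s1: "x \<in> M" if "1 \<le> x" "x \<le> int r - 1" for x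
    using star[of "nat x"] that by auto
  have s2: "max 1 (int n div 2 - 1) \<in> M"
  proof (cases "4 \<le> n")
    case True
    hence "int (n div 2 - 1) = max 1 (int n div 2 - 1)" by linarith
    thus ?thesis using half[OF True] by simp
  next
    case False
    hence "max 1 (int n div 2 - 1) = 1" by linarith
    thus ?thesis using one by simp
  qed
  have s3: "x \<in> M" if "max 1 (int n - int k - 1) \<le> x" "x \<le> int n - 2" for x
    using simplex[of "nat x"] that by auto
  show incl: "{1..int r - 1} \<union> {max 1 (int n div 2 - 1)} \<union> {max 1 (int n - int k - 1)..int n - 2} \<subseteq> M"
    using s1 s2 s3 by auto
  show MB: "M \<subseteq> B" using upper unfolding B_def by blast
  \<comment> \<open>Only the point \<open>\<lfloor>n/2\<rfloor> - 1\<close> can lie in the first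
    interval beyond \<open>r - 1\<close>, and it is covered separately.\<close>
  have full: "M = B" if rn: "int r \<ge> int n div 2 - 1"
  proof (rule equalityI[OF MB], rule subsetI)
    fix x assume "x \<in> B"
    then consider "1 \<le> x" "x \<le> int r - 1" | "1 \<le> x" "int r - 1 < x" "x \<le> int n div 2 - 1"
      | "max 1 (int n - int k - 1) \<le> x" "x \<le> int n - 2"
      unfolding B_def by fastforce
    thus "x \<in> M"
    proof cases
      case 2
      hence "x = max 1 (int n div 2 - 1)" using rn by linarith
      thus ?thesis using s2 by simp
    qed (use s1 s3 in auto)
  qed
  thus "int r \<ge> int n div 2 - 1 \<longrightarrow> M = B" by blast
  \<comment> \<open>Since \<open>k \<le> r\<close>, condition (c) forces the hypothesis of (1), so
    that \<open>M\<close> equals the upper bound.\<close>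
  have r_large: "int r \<ge> int n div 2 - 1" if "int n - int k - 2 \<le> max (int r - 1) (int n div 2 - 1)"
    using that kr by linarith
  have bc: "max 1 (int n - int k - 2) \<in> M \<longleftrightarrow> int n - int k - 2 \<le> max (int r - 1) (int n div 2 - 1)"
  proof
    assume e: "max 1 (int n - int k - 2) \<in> M"
    have "max 1 (int n - int k - 2) \<in> B" using MB e by blast
    thus "int n - int k - 2 \<le> max (int r - 1) (int n div 2 - 1)"
      unfolding B_def using n by (auto simp: max_def split: if_splits)
  next
    assume c: "int n - int k - 2 \<le> max (int r - 1) (int n div 2 - 1)"
    show "max 1 (int n - int k - 2) \<in> M"
    proof (cases "1 \<le> int n - int k - 2")
      case True
      hence "max 1 (int n - int k - 2) \<in> B" using c by (auto simp: B_def)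
      thus ?thesis using full[OF r_large[OF c]] by simp
    next
      case False
      thus ?thesis using one by (simp add: max_def)
    qed
  qed
  thus "max 1 (int n - int k - 2) \<in> M \<longleftrightarrow> int n - int k - 2 \<le> max (int r - 1) (int n div 2 - 1)" .
  show "integer_interval M \<longleftrightarrow> max 1 (int n - int k - 2) \<in> M"
  proof
    assume "integer_interval M"
    then obtain a b :: rat where ab: "M = {x. a \<le> of_int x \<and> of_int x \<le> b}" by (auto simp: integer_interval_def)
    show "max 1 (int n - int k - 2) \<in> M"
    proof (cases "1 \<le> int n - int k - 2")
      case True
      \<comment> \<open>\<open>1\<close> and \<open>n - 2\<close> are in \<open>M\<close>, the
        latter because \<open>k \<ge> 1\<close>, so an interval contains \<open>n - k - 2\<close>
        between them.\<close>
      hence "int n - 2 \<in> M" using s3[of "int n - 2"] k1 by auto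
      hence "a \<le> of_int 1" "of_int (int n - 2) \<le> b" using ab one by auto
      moreover have "(of_int 1 :: rat) \<le> of_int (int n - int k - 2)" "(of_int (int n - int k - 2) :: rat) \<le> of_int (int n - 2)"
        using True by (simp_all only: of_int_le_iff)
      ultimately have "a \<le> of_int (int n - int k - 2)" "of_int (int n - int k - 2) \<le> b" by (metis order_trans)+
      hence "int n - int k - 2 \<in> M" unfolding ab by simp
      thus ?thesis using True by (simp add: max_def)
    next
      case False
      thus ?thesis using one by (simp add: max_def)
    qed
  next
    assume "max 1 (int n - int k - 2) \<in> M"
    hence c: "int n - int k - 2 \<le> max (int r - 1) (int n div 2 - 1)" using bc by blast
    define N where "N = max (max (int r - 1) (int n div 2 - 1)) (int n - 2)"
    have "M = {1..N}"
    proof -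
      have "B = {1..N}"
      proof (rule Set.set_eqI)
        fix x
        show "x \<in> B \<longleftrightarrow> x \<in> {1..N}"
          unfolding B_def N_def Un_iff atLeastAtMost_iff using c n by (smt (verit))
      qed
      thus ?thesis using full[OF r_large[OF c]] by simp
    qed
    thus "integer_interval M" unfolding integer_interval_def
      by (intro exI[of _ 1] exI[of _ "of_int N"]) auto
  qed
  \<comment> \<open>If the bound is met through \<open>\<lfloor>n/2\<rfloor> - 1\<close>, then
    \<open>k\<close> and hence \<open>r\<close> are at least \<open>\<lceil>n/2\<rceil> - 1\<close>,
    so \<open>r + k \<ge> n - 2\<close>, with equality only for even \<open>n\<close> and
    \<open>k = r = n / 2 - 1\<close>.\<close>
  show "int n - int k - 2 \<le> max (int r - 1) (int n div 2 - 1) \<longleftrightarrow>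
      int r + int k \<ge> int n - 1 \<or> int r + int k = int n - 2 \<and> n = 2 * r + 2 \<and> k = r"
    using kr by linarith
qed

section \<open>Powers of cyclic groups inside the class group and the final assembly\<close>

context krull_finite_class_group begin

lemma quotient_iso: "quot.Q \<cong> cyclic_sum ns"
proof (rule quot.subgroup_iso_cyclic_sum[of ns x])
  show "0 < ns ! i" if "i < length ns" for i using ns(2)[of "ns ! i"] that by simp
  show "x i \<in> quot.V" if "i < length ns" for i using gen that by (simp add: generating_mod_def)
  show "independent_mod L ns x" by (rule ind)
  fix U assume U: "subgroup U quot.Q" "quot.Q\<lparr>carrier := U\<rparr> \<cong> cyclic_sum ns"
    "generating_mod quot.V L (length ns) x \<Longrightarrow> U = carrier quot.Q"
  thus "quot.Q \<cong> cyclic_sum ns" using gen by simp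
qed

lemma card_quotient: "card (carrier quot.Q) = (\<Prod>i<r. ns ! i)"
proof -
  have "card (carrier quot.Q) = card (carrier (cyclic_sum ns))" by (rule iso_same_card[OF quotient_iso])
  moreover have "0 < ns ! i" if "i < length ns" for i using ns(2)[OF nth_mem[OF that]] by simp
  ultimately show ?thesis by (simp add: card_cyclic_sum r_def)
qed

text \<open>By counting: the subgroup has \<open>n ^ r\<close> elements, and the order of the
  quotient is a product of \<open>r\<close> divisors of \<open>n\<close>.\<close>

lemma iso_cyclic_power_of_max_rank:
  assumes "has_subgroup_iso quot.Q (cyclic_power n r)"
  shows "quot.Q \<cong> cyclic_power n r"
proof -
  obtain U where U: "subgroup U quot.Q" "quot.Q\<lparr>carrier := U\<rparr> \<cong> cyclic_power n r"
    using assms by (auto simp: has_subgroup_iso_def)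
  have "card U = card (carrier (cyclic_power n r))" using iso_same_card[OF U(2)] by simp
  also have "\<dots> = n ^ r" 
    unfolding cyclic_power_def using n_gt_1 by (subst card_cyclic_sum) auto
  finally have cU: "card U = n ^ r" .
  have pos: "0 < ns ! i" if "i < r" for i using ns(2)[of "ns ! i"] that by (simp add: r_def)
  have "card (carrier quot.Q) \<le> (\<Prod>i<r. n)"
    unfolding card_quotient using nth_dvd_n n_gt_1 by (intro prod_mono) (auto intro: dvd_imp_le)
  moreover have "0 < card (carrier quot.Q)" unfolding card_quotient using pos by (simp add: prod_pos)
  moreover have "U \<subseteq> carrier quot.Q" using U(1) by (rule subgroup.subset)
  ultimately have "U = carrier quot.Q" using cU by (intro card_seteq) (auto simp: card_gt_0_iff)
  thus ?thesis using U(2) by simp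
qed

text \<open>A basis element of the cyclic power has order \<open>m\<close>, and \<open>n\<close>
  kills it.\<close>

lemma cyclic_power_iso_dvd:
  assumes iso: "quot.Q \<cong> cyclic_power m t" and "0 < m" "0 < t"
  shows "m dvd n"
proof -
  interpret Q: group quot.Q by (rule quot.group_quotient)
  have iso': "quot.Q\<lparr>carrier := carrier quot.Q\<rparr> \<cong> cyclic_sum (replicate t m)" using iso by (simp add: cyclic_power_def)
  show ?thesis
  proof (rule quot.independent_of_subgroup_iso[OF _ Q.subgroup_self iso'])
    show "0 < replicate t m ! i" if "i < length (replicate t m)" for i using that assms by simp
    fix y assume y: "\<And>i. i < length (replicate t m) \<Longrightarrow> y i \<in> quot.V" "independent_mod L (replicate t m) y"
    have "lin_comb t (\<lambda>i. if i = 0 then int n else 0) y = (\<Sum>i<t. if i = 0 then frag_cmul (int n) (y 0) else 0)"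
      unfolding lin_comb_def by (intro sum.cong) auto
    also have "\<dots> = frag_cmul (int n) (y 0)" using assms by simp
    also have "\<dots> \<in> L" using kill y(1)[of 0] assms by simp
    finally have "\<forall>i<t. int m dvd (if i = 0 then int n else 0)" unfolding independent_lin_comb_iff[OF y(2)] .
    thus "m dvd n" using assms by auto
  qed
qed

theorem minimal_distances_finite_class_group:
  assumes card3: "3 \<le> card (carrier quot.Q)" and k: "1 \<le> k" "has_subgroup_iso quot.Q (cyclic_power n k)"
    and kmax: "\<forall>j\<ge>1. has_subgroup_iso quot.Q (cyclic_power n j) \<longrightarrow> j \<le> k"
  defines "M \<equiv> minimal_distances H"
  shows "{1..int r - 1} \<union> {max 1 (int n div 2 - 1)} \<union> {max 1 (int n - int k - 1)..int n - 2} \<subseteq> M \<and>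
     M \<subseteq> {1..max (int r - 1) (int n div 2 - 1)} \<union> {max 1 (int n - int k - 1)..int n - 2} \<and>
     (int r \<ge> int n div 2 - 1 \<longrightarrow>
        M = {1..max (int r - 1) (int n div 2 - 1)} \<union> {max 1 (int n - int k - 1)..int n - 2}) \<and>
     (integer_interval M \<longleftrightarrow> max 1 (int n - int k - 2) \<in> M) \<and>
     (max 1 (int n - int k - 2) \<in> M \<longleftrightarrow> int n - int k - 2 \<le> max (int r - 1) (int n div 2 - 1)) \<and>
     (int n - int k - 2 \<le> max (int r - 1) (int n div 2 - 1)
        \<longleftrightarrow> int r + int k \<ge> int n - 1 \<or>
            (int r + int k = int n - 2 \<and> quot.Q \<cong> cyclic_power (2 * r + 2) r))"
proof -
  obtain U where U: "subgroup U quot.Q" "quot.Q\<lparr>carrier := U\<rparr> \<cong> cyclic_sum (replicate k n)"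
    using k(2) by (auto simp: has_subgroup_iso_def cyclic_power_def)
  have "\<exists>y. (\<forall>i<k. y i \<in> quot.V) \<and> independent_mod L (replicate k n) y"
    by (rule quot.independent_of_subgroup_iso[OF _ U]) (use n_gt_1 in auto)
  then obtain y where y: "\<And>i. i < k \<Longrightarrow> y i \<in> quot.V" "independent_mod L (replicate k n) y" by blast
  have kr: "k \<le> r" by (rule independent_length_le[OF y])
  have v: "y 0 \<in> quot.V" "order_mod L (y 0) n"
  proof -
    show "y 0 \<in> quot.V" using y(1) k(1) by simp
    have "independent_mod L (replicate 1 n) y" by (rule independent_mod_prefix[OF y(2) k(1)])
    from independent_lin_comb_iff[OF this] have "frag_cmul j (y 0) \<in> L \<longleftrightarrow> int n dvd j" for j
      using spec[of "\<lambda>c. lin_comb 1 c y \<in> L \<longleftrightarrow> (\<forall>i<1. int n dvd c i)" "\<lambda>_. j"] by (simp add: lin_comb_def)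
    thus "order_mod L (y 0) n" using n_gt_1 by (simp add: order_mod_def)
  qed
  have star: "int d \<in> M" if "1 \<le> d" "d + 1 \<le> r" for d
    using minimal_distances_star[of "d + 1"] that by (simp add: M_def)
  have simplex: "int d \<in> M" if "1 \<le> d" "n \<le> d + k + 1" "d + 2 \<le> n" for d
    using minimal_distances_simplex[OF y, of "n - d"] that by (simp add: M_def)
  have half: "int (n div 2 - 1) \<in> M" if "4 \<le> n"
    using minimal_distances_cyclic(1)[OF v that] by (simp add: M_def)
  \<comment> \<open>The distance \<open>1\<close> comes from four multiples of one element for
    \<open>n \<ge> 5\<close>, from the middle point for \<open>n = 4\<close>, from two letters for
    \<open>n = 3\<close>, and from the rank for \<open>n = 2\<close>, where \<open>card3\<close>
    forces \<open>r \<ge> 2\<close>.\<close>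
  have one: "1 \<in> M"
  proof -
    consider "5 \<le> n" | "n = 4" | "n = 3" | "n = 2" using n_gt_1 by linarith
    thus ?thesis
    proof cases
      case 1 thus ?thesis using minimal_distances_cyclic(2)[OF v] by (simp add: M_def)
    next
      case 2 thus ?thesis using half by simp
    next
      case 3 thus ?thesis using simplex[of 1] k(1) by simp
    next
      case 4
      have "2 \<le> r"
      proof (rule ccontr)
        assume "\<not> 2 \<le> r"
        hence "r = 1" using kr k(1) by simp
        moreover have "ns ! 0 \<le> 2" using nth_dvd_n[of 0] 4 \<open>r = 1\<close> by (auto dest: dvd_imp_le)
        ultimately show False using card3 card_quotient by simp
      qed
      thus ?thesis using star[of 1] by simp
    qed
  qed
  have "\<And>D. D \<in> M \<Longrightarrow> D \<in> {1..max (int r - 1) (int n div 2 - 1)} \<union> {max 1 (int n - int k - 1)..int n - 2}"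
    unfolding M_def using minimal_distances_upper[of k] kmax by blast
  note ar = minimal_distances_arithmetic[OF _ kr k(1) one star simplex half this]
  have n2: "2 \<le> n" using n_gt_1 by simp
  have iso: "(int r + int k = int n - 2 \<and> n = 2 * r + 2 \<and> k = r) \<longleftrightarrow>
    (int r + int k = int n - 2 \<and> quot.Q \<cong> cyclic_power (2 * r + 2) r)"
  proof (intro conj_cong refl iffI)
    assume "n = 2 * r + 2 \<and> k = r"
    thus "quot.Q \<cong> cyclic_power (2 * r + 2) r" using iso_cyclic_power_of_max_rank k(2) by metis
  next
    \<comment> \<open>The isomorphism gives \<open>2 * r + 2 \<le> n\<close>, while
      \<open>k \<le> r\<close> gives \<open>n = r + k + 2 \<le> 2 * r + 2\<close>.\<close>
    assume s: "int r + int k = int n - 2" and "quot.Q \<cong> cyclic_power (2 * r + 2) r"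
    hence "2 * r + 2 dvd n" using kr k(1) by (intro cyclic_power_iso_dvd) auto
    hence "2 * r + 2 \<le> n" using n_gt_1 by (intro dvd_imp_le) auto
    thus "n = 2 * r + 2 \<and> k = r" using s kr by linarith
  qed
  show ?thesis
    using ar[OF n2] unfolding iso by blast
qed

end

theorem theorem1p1:
  fixes H :: "('a, 'b) monoid_scheme"
    and P :: "'p set"
    and \<phi> :: "'a \<Rightarrow> 'p multiset"
    and G :: "('p \<Rightarrow>\<^sub>0 int) set monoid"
    and n r k :: nat
  assumes "comm_monoid_cancel H"
    and "divisor_theory H P \<phi>"
    and "G = class_group H P \<phi>"
    and "finite (carrier G)"
    and "every_class_contains_prime H P \<phi>"
    and "card (carrier G) \<ge> 3"
    and "n = group_exp G"
    and "r = group_rank G"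
    and "1 \<le> k"
    and "has_subgroup_iso G (cyclic_power n k)"
    and "\<forall>j\<ge>1. has_subgroup_iso G (cyclic_power n j) \<longrightarrow> j \<le> k"
  shows
    "{1..int r - 1} \<union> {max 1 (int n div 2 - 1)} \<union> {max 1 (int n - int k - 1)..int n - 2}
       \<subseteq> minimal_distances H \<and>
     minimal_distances H
       \<subseteq> {1..max (int r - 1) (int n div 2 - 1)} \<union> {max 1 (int n - int k - 1)..int n - 2} \<and>
     (int r \<ge> int n div 2 - 1 \<longrightarrow>
        minimal_distances H =
          {1..max (int r - 1) (int n div 2 - 1)} \<union> {max 1 (int n - int k - 1)..int n - 2}) \<and>
     (integer_interval (minimal_distances H)
        \<longleftrightarrow> max 1 (int n - int k - 2) \<in> minimal_distances H) \<and>
     (max 1 (int n - int k - 2) \<in> minimal_distances H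
        \<longleftrightarrow> int n - int k - 2 \<le> max (int r - 1) (int n div 2 - 1)) \<and>
     (int n - int k - 2 \<le> max (int r - 1) (int n div 2 - 1)
        \<longleftrightarrow> int r + int k \<ge> int n - 1 \<or>
            (int r + int k = int n - 2 \<and> G \<cong> cyclic_power (2 * r + 2) r))"
proof -
  interpret comm_monoid_cancel H by fact
  interpret dh: divisor_hom H P \<phi>
    by unfold_locales (use assms(2) in \<open>simp add: divisor_theory_def\<close>)
  have L: "frag.subspace (principal_quotients H \<phi>)" by (rule dh.subspace_principal_quotients)
  interpret quot: free_abelian_quotient P "principal_quotients H \<phi>"
    by unfold_locales (rule L, rule dh.principal_quotients_keys)
  have G: "G = quot.Q" using assms(3) by (simp add: class_group_def)
  interpret Q: group quot.Q by (rule quot.group_quotient)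
  have "finite (coset_of (principal_quotients H \<phi>) ` quot.V)" using assms(4) G quot.carrier_quotient by simp
  then obtain ms z where ms: "\<forall>n\<in>set ms. 1 < n" "sorted_wrt (dvd) ms"
    and gen: "generating_mod quot.V (principal_quotients H \<phi>) (length ms) z"
    and ind: "independent_mod (principal_quotients H \<phi>) ms z"
    using ex_invariant_factor_basis[OF L quot.V quot.LV] by blast
  \<comment> \<open>One list of invariant factors makes the choice in
    \<open>invariant_factors\<close> meaningful.\<close>
  have "is_invariant_factors G ms"
  proof (rule quot.subgroup_iso_cyclic_sum[of ms z])
    show "0 < ms ! i" if "i < length ms" for i using ms(1) that by (metis less_trans nth_mem zero_less_one)
    show "z i \<in> quot.V" if "i < length ms" for i using gen that by (simp add: generating_mod_def)
    show "independent_mod (principal_quotients H \<phi>) ms z" by (rule ind)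
    fix U assume "quot.Q\<lparr>carrier := U\<rparr> \<cong> cyclic_sum ms"
      "generating_mod quot.V (principal_quotients H \<phi>) (length ms) z \<Longrightarrow> U = carrier quot.Q"
    thus "is_invariant_factors G ms" using ms gen G by (simp add: is_invariant_factors_def)
  qed
  define ns where "ns = invariant_factors G"
  have "is_invariant_factors G ns"
    unfolding ns_def invariant_factors_def by (rule someI) fact
  hence ns: "\<forall>m\<in>set ns. 1 < m" "sorted_wrt (dvd) ns" "quot.Q\<lparr>carrier := carrier quot.Q\<rparr> \<cong> cyclic_sum ns"
    using G by (simp_all add: is_invariant_factors_def)
  have pos: "0 < ns ! i" if "i < length ns" for i using ns(1) that by (metis less_trans nth_mem zero_less_one)
  \<comment> \<open>\<open>n\<close> and \<open>r\<close> refer to the chosen list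
    \<open>ns\<close>, so a basis adapted to \<open>ns\<close> is read off from its
    isomorphism.\<close>
  have "\<exists>x. generating_mod quot.V (principal_quotients H \<phi>) (length ns) x \<and> independent_mod (principal_quotients H \<phi>) ns x"
    by (rule quot.independent_of_subgroup_iso[OF pos Q.subgroup_self ns(3)]) auto
  then obtain x where x: "generating_mod quot.V (principal_quotients H \<phi>) (length ns) x" "independent_mod (principal_quotients H \<phi>) ns x" by blast
  have ne: "ns \<noteq> []"
  proof
    assume "ns = []"
    hence "card (carrier quot.Q) = 1" using iso_same_card[OF ns(3)] card_cyclic_sum[of "[]"] by simp
    thus False using assms(6) G by simp
  qed
  interpret K: krull_finite_class_group H P \<phi> ns x
  proof unfold_locales
    fix v :: "'p \<Rightarrow>\<^sub>0 int" assume v: "Poly_Mapping.keys v \<subseteq> P"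
    hence "coset_of (principal_quotients H \<phi>) v \<in> carrier (class_group H P \<phi>)"
      using quot.carrier_quotient by (auto simp: class_group_def)
    then obtain p where "p \<in> P" "frag_of p \<in> coset_of (principal_quotients H \<phi>) v"
      using assms(5) unfolding every_class_contains_prime_def by blast
    thus "\<exists>p\<in>P. frag_of p - v \<in> principal_quotients H \<phi>" unfolding coset_of_def by force
  qed (use ne ns x in auto)
  have "n = K.n" "r = K.r"
    using assms(7,8) ne by (simp_all add: group_exp_def group_rank_def K.n_def K.r_def ns_def[symmetric])
  thus ?thesis
    using K.minimal_distances_finite_class_group[of k] assms(6,9-11) G by simp
qed

end
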